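(* Let $\mathcal{F}$ be a family of ordered pairs $(f,g)$ of nonnegative measurable functions on $\mathbb{R}^n$. Suppose that for some $p_0$, $0<p_0<\infty$, and for every weight $\omega\in A_\infty^{\rho,\infty}$, $$\|f\|_{L^{p_0,\infty}(\omega)}\le C\|g\|_{L^{p_0,\infty}(\omega)},\qquad (f,g)\in\mathcal{F}.$$ Then for all $0<p<\infty$ and $\omega\in A_\infty^{\rho,\infty}$, $$\|f\|_{L^{p,\infty}(\omega)}\le C\|g\|_{L^{p,\infty}(\omega)},\qquad (f,g)\in\mathcal{F}.$$ Both inequalities are understood according to the convention stated in the context: they hold for those pairs whose left-hand side is finite, with $C$ depending only on the exponent and the $A_\infty^{\rho,\infty}$ constant of $\omega$.
   Context: Let $n\ge3$. For $1<q<\infty$, a nonnegative function $V\in L^q_{\rm loc}(\mathbb{R}^n)$ belongs to $B_q$ if there is $C>0$ with $\left(\frac1{|B|}\int_{B}V^q\right)^{1/q}\le C\,\frac1{|B|}\int_{B}V$ for every ball $B$. Standing assumption: $V\in B_{n/2}$ and $V\not\equiv0$. Define $\rho(x)=\sup\{r>0:\ r^{2-n}\int_{B(x,r)}V(y)\,dy\le1\}\in(0,\infty)$. For a ball $B=B(x_0,r)$ and $\theta\ge0$, $\Psi_\theta(B)=(1+r/\rho(x_0))^\theta$, and $M_{V,\theta}f(x)=\sup_{B\ni x}\frac1{\Psi_\theta(B)|B|}\int_B|f|$ (supremum over balls containing $x$). A weight is a positive locally integrable function. For $1<p<\infty$, a weight $\omega$ is in $A_p^{\rho,\theta}$ if $\big(\frac1{\Psi_\theta(B)|B|}\int_B\omega\big)\big(\frac1{\Psi_\theta(B)|B|}\int_B\omega^{-\frac1{p-1}}\big)^{p-1}\le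 K$ for all balls $B$ and some constant $K$; $\omega\in A_1^{\rho,\theta}$ if $M_{V,\theta}\omega\le K\omega$ a.e. The least such $K$ is the $A_p^{\rho,\theta}$ constant of $\omega$. Put $A_p^{\rho,\infty}=\bigcup_{\theta\ge0}A_p^{\rho,\theta}$ and $A_\infty^{\rho,\infty}=\bigcup_{p\ge1}A_p^{\rho,\infty}$. Convention: an inequality "for $(f,g)\in\mathcal{F}$" means that it holds for every $(f,g)\in\mathcal F$ for which the left-hand side is finite, with a constant $C$ depending only on the exponents involved and on the $A_\infty^{\rho,\infty}$ constant of $\omega$; the latter means that for any given $t\ge1$, $\theta\ge0$, $K>0$, the same $C$ can be used for all $\omega$ with $A_t^{\rho,\theta}$ constant at most $K$. $L^{p,\infty}(\omega)$ is the weak $L^p$ space with respect to the measure $\omega(x)\,dx$. *)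

theory Defs
  imports "HOL-Analysis.Analysis"
begin

text \<open>Locally integrable functions are Lebesgue measurable; the potential \<open>V\<close> and the
  weights are genuine functions, and a.e. statements refer to Lebesgue measure.\<close>

definition locally_Lebesgue_integrable :: "(real ^ 'n \<Rightarrow> real) \<Rightarrow> bool" where
  "locally_Lebesgue_integrable h \<longleftrightarrow> (\<forall>S. compact S \<longrightarrow> h absolutely_integrable_on S)"

definition ball_average :: "(real ^ 'n \<Rightarrow> real) \<Rightarrow> real ^ 'n \<Rightarrow> real \<Rightarrow> real" where
  "ball_average h x r =
     (LINT y:ball x r|lebesgue. h y) / measure lebesgue (ball x r)"

definition reverse_Hoelder :: "real \<Rightarrow> (real ^ 'n \<Rightarrow> real) set" where
  "reverse_Hoelder q = {V. V \<in> borel_measurable lebesgue \<and> (\<forall>x. V x \<ge> 0) \<and>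
     locally_Lebesgue_integrable (\<lambda>x. V x powr q) \<and>
     (\<exists>C>0. \<forall>x r. r > 0 \<longrightarrow>
        ball_average (\<lambda>y. V y powr q) x r powr (1 / q) \<le> C * ball_average V x r)}"

text \<open>If \<open>V\<close> is in \<open>reverse_Hoelder (n/2)\<close> with \<open>n \<ge> 3\<close>, and is not a.e. zero, the set below
  is nonempty and bounded above, so that the real supremum is the actual one and is positive.\<close>

definition critical_radius :: "(real ^ 'n \<Rightarrow> real) \<Rightarrow> real ^ 'n \<Rightarrow> real" where
  "critical_radius V x =
     Sup {r. r > 0 \<and> r powi (2 - int CARD('n)) * (LINT y:ball x r|lebesgue. V y) \<le> 1}"

definition Psi :: "(real ^ 'n \<Rightarrow> real) \<Rightarrow> real \<Rightarrow> real ^ 'n \<Rightarrow> real \<Rightarrow> real" where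
  "Psi V \<theta> x r = (1 + r / critical_radius V x) powr \<theta>"

definition Psi_average ::
  "(real ^ 'n \<Rightarrow> real) \<Rightarrow> real \<Rightarrow> real ^ 'n \<Rightarrow> real \<Rightarrow> (real ^ 'n \<Rightarrow> ennreal) \<Rightarrow> ennreal" where
  "Psi_average V \<theta> x r h =
     (\<integral>\<^sup>+y\<in>ball x r. h y \<partial>lebesgue) / ennreal (Psi V \<theta> x r * measure lebesgue (ball x r))"

definition Psi_maximal ::
  "(real ^ 'n \<Rightarrow> real) \<Rightarrow> real \<Rightarrow> (real ^ 'n \<Rightarrow> real) \<Rightarrow> real ^ 'n \<Rightarrow> ennreal" where
  "Psi_maximal V \<theta> f x =
     (SUP (z, r) \<in> {(z, r). r > 0 \<and> x \<in> ball z r}. Psi_average V \<theta> z r (\<lambda>y. ennreal \<bar>f y\<bar>))"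

definition weight :: "(real ^ 'n \<Rightarrow> real) \<Rightarrow> bool" where
  "weight \<omega> \<longleftrightarrow> (\<forall>x. \<omega> x > 0) \<and> locally_Lebesgue_integrable \<omega>"

text \<open>Powers of extended nonnegative reals, used only for exponents \<open>a > 0\<close>.\<close>

definition ennreal_powr :: "ennreal \<Rightarrow> real \<Rightarrow> ennreal" where
  "ennreal_powr x a = (if x = \<infinity> then \<infinity> else ennreal (enn2real x powr a))"

definition Ap_inequality ::
  "(real ^ 'n \<Rightarrow> real) \<Rightarrow> real \<Rightarrow> real \<Rightarrow> (real ^ 'n \<Rightarrow> real) \<Rightarrow> real \<Rightarrow> bool" where
  "Ap_inequality V \<theta> p \<omega> K \<longleftrightarrow>
     (if p = 1 then AE x in lebesgue. Psi_maximal V \<theta> \<omega> x \<le> ennreal (K * \<omega> x)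
      else \<forall>x r. r > 0 \<longrightarrow>
        Psi_average V \<theta> x r (\<lambda>y. ennreal (\<omega> y)) *
        ennreal_powr (Psi_average V \<theta> x r (\<lambda>y. ennreal (\<omega> y powr (- 1 / (p - 1))))) (p - 1)
        \<le> ennreal K)"

definition Ap :: "(real ^ 'n \<Rightarrow> real) \<Rightarrow> real \<Rightarrow> real \<Rightarrow> (real ^ 'n \<Rightarrow> real) set" where
  "Ap V \<theta> p = {\<omega>. weight \<omega> \<and> (\<exists>K>0. Ap_inequality V \<theta> p \<omega> K)}"

text \<open>The constant is \<open>\<infinity>\<close> (the infimum of the empty set) for weights outside \<open>Ap V \<theta> p\<close>.\<close>

definition Ap_constant ::
  "(real ^ 'n \<Rightarrow> real) \<Rightarrow> real \<Rightarrow> real \<Rightarrow> (real ^ 'n \<Rightarrow> real) \<Rightarrow> ennreal" where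
  "Ap_constant V \<theta> p \<omega> = Inf {ennreal K |K. K > 0 \<and> Ap_inequality V \<theta> p \<omega> K}"

definition Ap_infty :: "(real ^ 'n \<Rightarrow> real) \<Rightarrow> real \<Rightarrow> (real ^ 'n \<Rightarrow> real) set" where
  "Ap_infty V p = (\<Union>\<theta>\<in>{0..}. Ap V \<theta> p)"

definition A_infty :: "(real ^ 'n \<Rightarrow> real) \<Rightarrow> (real ^ 'n \<Rightarrow> real) set" where
  "A_infty V = (\<Union>p\<in>{1..}. Ap_infty V p)"

definition weak_Lp_norm ::
  "real \<Rightarrow> (real ^ 'n \<Rightarrow> real) \<Rightarrow> (real ^ 'n \<Rightarrow> ennreal) \<Rightarrow> ennreal" where
  "weak_Lp_norm p \<omega> f =
     (SUP s\<in>{0<..}. ennreal s *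
        ennreal_powr (emeasure (density lebesgue (\<lambda>x. ennreal (\<omega> x))) {x. f x > ennreal s}) (1 / p))"

text \<open>The weak-type inequality for all pairs in \<open>F\<close> with finite left-hand side and all weights in
  \<open>A_infty V\<close>. The constant \<open>C\<close> is uniform over all weights with \<open>Ap_constant V \<theta> t \<omega> \<le> K\<close>;
  each weight in \<open>A_infty V\<close> satisfies this for some \<open>t\<close>, \<open>\<theta>\<close>, \<open>K\<close>.\<close>

definition weak_type_inequality ::
  "(real ^ 'n \<Rightarrow> real) \<Rightarrow> ((real ^ 'n \<Rightarrow> ennreal) \<times> (real ^ 'n \<Rightarrow> ennreal)) set \<Rightarrow> real \<Rightarrow> bool" where
  "weak_type_inequality V F p \<longleftrightarrow>
     (\<forall>t\<ge>1. \<forall>\<theta>\<ge>0. \<forall>K>0. \<exists>C>0. \<forall>\<omega>\<in>A_infty V. Ap_constant V \<theta> t \<omega> \<le> ennreal K \<longrightarrow>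
        (\<forall>(f, g)\<in>F. weak_Lp_norm p \<omega> f < \<infinity> \<longrightarrow>
           weak_Lp_norm p \<omega> f \<le> ennreal C * weak_Lp_norm p \<omega> g))"

end

theory Submission
  imports Defs
begin

text \<open>
  Extrapolation with multipliers built from a maximal function adapted to the weight \<open>\<omega>\<close>, so that no
  reverse Hoelder or strong-type estimate for weights enters. An \<open>A\<^sub>q\<^sup>\<rho>\<close> weight satisfies
  \<open>\<omega>(B(z,s)) \<le> K \<Psi>(z,r)\<^sup>q (s/r)\<^sup>N \<omega>(B(z,r))\<close> for \<open>s \<ge> r\<close>, hence
  \<open>\<phi>(z,r) = sup {\<omega>(B(z,s)) (r/s)\<^sup>N | s \<ge> r}\<close> dominates \<open>\<omega>(B(z,r))\<close>, exceeds it by at most the factor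
  \<open>K \<Psi>(z,r)\<^sup>q\<close>, and is doubling. The maximal function \<open>M h\<close> given by the averages \<open>(1 / \<phi>(B)) \<integral>\<^sub>B h \<omega>\<close> is of weak
  type \<open>(1,1)\<close> by Vitali covering, and \<open>v = (M h)\<^sup>\<delta>\<close> with \<open>0 < \<delta> < 1\<close> is an \<open>A\<^sub>1\<close> weight relative to \<open>\<omega> dx\<close>
  up to powers of \<open>\<Psi>\<close>, as in the theorem of Coifman and Rochberg. Consequently \<open>\<omega> v\<close> and \<open>\<omega> v\<^sup>-\<^sup>b\<close> are again
  admissible weights, with controlled constants.

  For \<open>p > p\<^sub>0\<close> take \<open>h\<close> the indicator of \<open>E = {f > s}\<close> and \<open>\<delta> = 1 - p\<^sub>0 / p\<close>: then \<open>\<omega> v \<ge> \<omega>\<close> on \<open>E\<close>, while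
  Kolmogorov's inequality bounds the \<open>\<omega> v\<close>-measure of any set \<open>S\<close> by
  \<open>\<omega>(S)\<close> to the power \<open>1 - \<delta>\<close> times \<open>\<omega>(E)\<^sup>\<delta>\<close>. For \<open>p < p\<^sub>0\<close> take
  \<open>h\<close> the power \<open>p/2\<close> of \<open>max g (\<epsilon> f)\<close> and a negative power of \<open>v\<close>: the new weight is small where \<open>g\<close> is
  large, and the weak type of \<open>M\<close> shows that \<open>v\<close> is not too large on half of \<open>E\<close>.
\<close>

section \<open>Weak-type bounds\<close>

lemma ennreal_powr_ennreal: "x \<ge> 0 \<Longrightarrow> ennreal_powr (ennreal x) a = ennreal (x powr a)"
  by (simp add: ennreal_powr_def)

lemma ennreal_powr_1 [simp]: "ennreal_powr x 1 = x"
  by (cases x) (simp_all add: ennreal_powr_def)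

lemma ennreal_powr_mono:
  assumes "x \<le> y" "a > 0"
  shows "ennreal_powr x a \<le> ennreal_powr y a"
proof (cases y)
  case (real y')
  then obtain x' where "x = ennreal x'" "x' \<ge> 0" using assms by (cases x) (auto simp: top_unique)
  with real assms show ?thesis
    by (simp add: ennreal_powr_ennreal powr_mono2)
qed (simp add: ennreal_powr_def)

lemma ennreal_powr_measurable [measurable]:
  "(\<lambda>x. ennreal_powr x a) \<in> borel_measurable borel"
  unfolding ennreal_powr_def by measurable

lemma ennreal_less_powr_iff:
  assumes "a > 0" "t \<ge> 0"
  shows "ennreal t < ennreal_powr x a \<longleftrightarrow> ennreal (t powr (1 / a)) < x"
proof (cases x)
  case (real x')
  have "t < x' powr a \<longleftrightarrow> t powr (1 / a) < x'"
    using assms real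
    by (smt (verit, ccfv_SIG) divide_pos_pos nonzero_mult_div_cancel_right powr_ge_zero powr_less_mono2
        powr_mono2 powr_one powr_powr mult.commute times_divide_eq_left less_numeral_extra(1) mult_1)
  with real assms show ?thesis
    by (simp add: ennreal_powr_ennreal ennreal_less_iff)
qed (simp add: ennreal_powr_def)

text \<open>Solving \<open>s * e powr (1 / p) \<le> G\<close> for the measure \<open>e\<close> of a
  level set trades the norm for distribution estimates, the form in which the later bounds are
  proved and used.\<close>

lemma weak_Lp_norm_le_iff:
  assumes "p > 0" "G \<ge> 0"
  shows "weak_Lp_norm p \<omega> f \<le> ennreal G \<longleftrightarrow>
    (\<forall>s>0. emeasure (density lebesgue (\<lambda>x. ennreal (\<omega> x))) {x. f x > ennreal s}
              \<le> ennreal ((G / s) powr p))"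
proof -
  have *: "ennreal s * ennreal_powr e (1 / p) \<le> ennreal G \<longleftrightarrow> e \<le> ennreal ((G / s) powr p)"
    if "s > 0" for s e
  proof (cases e)
    case (real x)
    have "s * x powr (1 / p) \<le> G \<longleftrightarrow> x powr (1 / p) \<le> G / s"
      using that by (simp add: field_simps)
    also have "\<dots> \<longleftrightarrow> x \<le> (G / s) powr p"
    proof
      assume "x powr (1 / p) \<le> G / s"
      then have "(x powr (1 / p)) powr p \<le> (G / s) powr p"
        using assms by (intro powr_mono2) auto
      then show "x \<le> (G / s) powr p"
        using real assms by (simp add: powr_powr)
    next
      assume "x \<le> (G / s) powr p"
      then have "x powr (1 / p) \<le> ((G / s) powr p) powr (1 / p)"
        using assms real by (intro powr_mono2) auto
      then show "x powr (1 / p) \<le> G / s"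
        using that assms by (simp add: powr_powr)
    qed
    finally show ?thesis
      using real that assms by (simp add: ennreal_powr_ennreal flip: ennreal_mult)
  next
    case top
    then show ?thesis
      using that by (simp add: ennreal_powr_def ennreal_mult_top top_unique)
  qed
  show ?thesis
    unfolding weak_Lp_norm_def by (auto simp: SUP_le_iff *)
qed

text \<open>Young's inequality for \<open>F / X\<close> and \<open>G / Y\<close>, integrated: the
  normalised right-hand side integrates to at most \<open>\<beta> + (1 - \<beta>) = 1\<close>. As
  \<open>X\<close> and \<open>Y\<close> are just positive upper bounds, vanishing integrals form no
  separate case.\<close>

lemma nn_integral_Hoelder:
  fixes F G :: "'a \<Rightarrow> real"
  assumes [measurable]: "F \<in> borel_measurable M" "G \<in> borel_measurable M" "S \<in> sets M"
    and pos: "\<And>x. F x \<ge> 0" "\<And>x. G x \<ge> 0" and \<beta>: "0 < \<beta>" "\<beta> < 1" and XY: "X > 0" "Y > 0"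
    and X: "(\<integral>\<^sup>+x\<in>S. ennreal (F x) \<partial>M) \<le> ennreal X"
    and Y: "(\<integral>\<^sup>+x\<in>S. ennreal (G x) \<partial>M) \<le> ennreal Y"
  shows "(\<integral>\<^sup>+x\<in>S. ennreal (F x powr \<beta> * G x powr (1 - \<beta>)) \<partial>M)
           \<le> ennreal (X powr \<beta> * Y powr (1 - \<beta>))"
proof -
  let ?c = "X powr \<beta> * Y powr (1 - \<beta>)"
  have c: "?c > 0" using XY by simp
  have young: "F x powr \<beta> * G x powr (1 - \<beta>) \<le> ?c * (\<beta> / X * F x + (1 - \<beta>) / Y * G x)" for x
  proof (cases "F x = 0 \<or> G x = 0")
    case True
    then show ?thesis
      using \<beta> XY pos[of x] c by (auto intro!: mult_nonneg_nonneg)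
  next
    case False
    then have "F x > 0" "G x > 0" using pos[of x] by auto
    then have "(F x / X) powr \<beta> * (G x / Y) powr (1 - \<beta>) \<le> \<beta> * (F x / X) + (1 - \<beta>) * (G x / Y)"
      using \<beta> XY by (intro Youngs_inequality_0) auto
    then have "?c * ((F x / X) powr \<beta> * (G x / Y) powr (1 - \<beta>)) \<le> ?c * (\<beta> * (F x / X) + (1 - \<beta>) * (G x / Y))"
      using c by (intro mult_left_mono) auto
    moreover have "?c * ((F x / X) powr \<beta> * (G x / Y) powr (1 - \<beta>)) = F x powr \<beta> * G x powr (1 - \<beta>)"
      using XY pos[of x] by (simp add: powr_divide)
    ultimately show ?thesis by simp
  qed
  have "(\<integral>\<^sup>+x\<in>S. ennreal (F x powr \<beta> * G x powr (1 - \<beta>)) \<partial>M)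
      \<le> (\<integral>\<^sup>+x. ennreal ?c * (ennreal (\<beta> / X) * (ennreal (F x) * indicator S x)
              + ennreal ((1 - \<beta>) / Y) * (ennreal (G x) * indicator S x)) \<partial>M)"
  proof (intro nn_integral_mono)
    fix x
    have "ennreal (F x powr \<beta> * G x powr (1 - \<beta>)) \<le> ennreal (?c * (\<beta> / X * F x + (1 - \<beta>) / Y * G x))"
      using young by (rule ennreal_leI)
    also have "\<dots> = ennreal ?c * (ennreal (\<beta> / X) * ennreal (F x) + ennreal ((1 - \<beta>) / Y) * ennreal (G x))"
      proof -
      have "ennreal (\<beta> / X * F x + (1 - \<beta>) / Y * G x) = ennreal (\<beta> / X * F x) + ennreal ((1 - \<beta>) / Y * G x)"
        using \<beta> XY pos[of x] by (intro ennreal_plus mult_nonneg_nonneg) auto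
      also have "\<dots> = ennreal (\<beta> / X) * ennreal (F x) + ennreal ((1 - \<beta>) / Y) * ennreal (G x)"
        using \<beta> XY pos[of x] by (intro arg_cong2[where f = "(+)"] ennreal_mult) auto
      finally show ?thesis
        using c \<beta> XY pos[of x] by (subst ennreal_mult) auto
    qed
    finally show "ennreal (F x powr \<beta> * G x powr (1 - \<beta>)) * indicator S x
      \<le> ennreal ?c * (ennreal (\<beta> / X) * (ennreal (F x) * indicator S x)
              + ennreal ((1 - \<beta>) / Y) * (ennreal (G x) * indicator S x))"
      by (auto split: split_indicator)
  qed
  also have "\<dots> = ennreal ?c * (ennreal (\<beta> / X) * (\<integral>\<^sup>+x\<in>S. ennreal (F x) \<partial>M)
              + ennreal ((1 - \<beta>) / Y) * (\<integral>\<^sup>+x\<in>S. ennreal (G x) \<partial>M))"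
    by (simp add: nn_integral_cmult nn_integral_add)
  also have "\<dots> \<le> ennreal ?c * (ennreal (\<beta> / X) * ennreal X + ennreal ((1 - \<beta>) / Y) * ennreal Y)"
    by (intro mult_left_mono add_mono X Y) auto
  also have "ennreal (\<beta> / X) * ennreal X + ennreal ((1 - \<beta>) / Y) * ennreal Y = 1"
    using \<beta> XY by (simp flip: ennreal_mult ennreal_plus)
  finally show ?thesis by simp
qed

section \<open>Integrals of functions of weak type\<close>

lemma weak_type_imp_AE_finite:
  fixes k :: "'a \<Rightarrow> ennreal"
  assumes [measurable]: "k \<in> borel_measurable M" and "c > 0"
    and weak: "\<And>t. t > 0 \<Longrightarrow> emeasure M {x \<in> space M. k x > ennreal t} \<le> ennreal (A * t powr (- c))"
  shows "AE x in M. k x \<noteq> \<infinity>"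
proof -
  let ?N = "{x \<in> space M. k x = \<infinity>}"
  have le: "emeasure M ?N \<le> ennreal (A * real n powr (- c))" if "n > 0" for n
    using that by (intro order.trans[OF emeasure_mono weak]) auto
  have "((\<lambda>n. ennreal (A * real n powr (- c))) \<longlongrightarrow> ennreal (A * 0)) sequentially"
    using \<open>c > 0\<close>
    by (intro tendsto_ennrealI tendsto_mult tendsto_const tendsto_neg_powr filterlim_real_sequentially) auto
  then have "emeasure M ?N \<le> ennreal (A * 0)"
    by (rule tendsto_lowerbound) (auto intro!: eventually_sequentiallyI[of 1] le[unfolded infinity_ennreal_def])
  then have "emeasure M ?N = 0" by simp
  then show ?thesis
    by (subst AE_iff_measurable[of ?N]) auto
qed

lemma dyadic_level:
  fixes y \<tau> :: real
  assumes "\<tau> > 0" "y > \<tau>"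
  obtains j :: nat where "2 ^ j * \<tau> < y" "y \<le> 2 ^ Suc j * \<tau>"
proof -
  obtain m :: nat where m: "y / \<tau> < 2 ^ m"
    using real_arch_pow[of 2 "y / \<tau>"] by auto
  \<comment> \<open>Minimality of \<open>j\<close> gives the lower bound; for \<open>j = 0\<close>
    it is the assumption \<open>y > \<tau>\<close>.\<close>
  define j where "j = (LEAST j. y \<le> 2 ^ Suc j * \<tau>)"
  have "y \<le> 2 ^ Suc m * \<tau>"
    using m assms by (simp add: field_simps)
  then have 1: "y \<le> 2 ^ Suc j * \<tau>"
    unfolding j_def by (rule LeastI)
  have "2 ^ j * \<tau> < y"
  proof (cases j)
    case (Suc i)
    then have "\<not> y \<le> 2 ^ Suc i * \<tau>"
      using not_less_Least[of i "\<lambda>j. y \<le> 2 ^ Suc j * \<tau>"] by (simp add: j_def)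
    then show ?thesis using Suc by simp
  qed (use assms in auto)
  with 1 show ?thesis by (rule that[rotated])
qed

text \<open>Dyadic shells: where \<open>k\<close> lies between \<open>2 ^ j * \<tau>\<close> and
  twice that, the integrand is at most the power \<open>e\<close> of the upper end, while the shell
  has measure at most \<open>A\<close> times the power \<open>- c\<close> of the lower end. The sum
  is geometric with ratio \<open>2 powr (e - c) < 1\<close>.\<close>

lemma weak_type_tail_integral:
  fixes k :: "'a \<Rightarrow> ennreal"
  assumes [measurable]: "k \<in> borel_measurable M" and e: "0 < e" "e < c" and "\<tau> > 0" "A \<ge> 0"
    and weak: "\<And>t. t > 0 \<Longrightarrow> emeasure M {x \<in> space M. k x > ennreal t} \<le> ennreal (A * t powr (- c))"
  shows "(\<integral>\<^sup>+x. ennreal_powr (k x) e * indicator {x. k x > ennreal \<tau>} x \<partial>M)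
           \<le> ennreal (2 powr e / (1 - 2 powr (e - c)) * (A * \<tau> powr (e - c)))"
proof -
  let ?S = "\<lambda>j::nat. {x \<in> space M. k x > ennreal (2 ^ j * \<tau>)}"
  let ?a = "\<lambda>j::nat. (2 ^ Suc j * \<tau>) powr e"
  have r: "2 powr (e - c) < (1::real)"
    using e by (simp add: powr_less_one)
  have AE: "AE x in M. k x \<noteq> \<infinity>"
    using e weak by (intro weak_type_imp_AE_finite[where c = c]) auto
  have "(\<integral>\<^sup>+x. ennreal_powr (k x) e * indicator {x. k x > ennreal \<tau>} x \<partial>M)
      \<le> (\<integral>\<^sup>+x. (\<Sum>j. ennreal (?a j) * indicator (?S j) x) \<partial>M)"
  proof (rule nn_integral_mono_AE, use AE AE_space in eventually_elim)
    fix x assume elim: "k x \<noteq> \<infinity>" "x \<in> space M"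
    then obtain y where y: "k x = ennreal y" "y \<ge> 0" by (cases "k x") auto
    show "ennreal_powr (k x) e * indicator {x. k x > ennreal \<tau>} x \<le> (\<Sum>j. ennreal (?a j) * indicator (?S j) x)"
    proof (cases "\<tau> < y")
      case True
      then obtain j where j: "2 ^ j * \<tau> < y" "y \<le> 2 ^ Suc j * \<tau>"
        using \<open>\<tau> > 0\<close> dyadic_level by blast
      have "ennreal_powr (k x) e \<le> ennreal (?a j) * indicator (?S j) x"
        using y j e elim \<open>\<tau> > 0\<close> by (auto simp: ennreal_powr_ennreal ennreal_less_iff intro!: ennreal_leI powr_mono2)
      also have "\<dots> \<le> (\<Sum>j. ennreal (?a j) * indicator (?S j) x)"
      proof -
        have "g j \<le> suminf g" for g :: "nat \<Rightarrow> ennreal"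
          using sum_le_suminf[of g "{j}"] by (simp add: summableI)
        then show ?thesis .
      qed
      finally show ?thesis
        by (auto split: split_indicator)
    next
      case False
      then show ?thesis using y \<open>\<tau> > 0\<close> by (auto simp: ennreal_less_iff)
    qed
  qed
  also have "\<dots> = (\<Sum>j. ennreal (?a j) * emeasure M (?S j))"
    by (subst nn_integral_suminf) (auto simp: nn_integral_cmult)
  also have "\<dots> \<le> (\<Sum>j. ennreal (2 powr e * (A * \<tau> powr (e - c)) * (2 powr (e - c)) ^ j))"
  proof (intro suminf_le summableI)
    fix j :: nat
    have "ennreal (?a j) * emeasure M (?S j) \<le> ennreal (?a j) * ennreal (A * (2 ^ j * \<tau>) powr (- c))"
      using \<open>\<tau> > 0\<close> by (intro mult_left_mono weak) auto
    also have "\<dots> = ennreal (?a j * (A * (2 ^ j * \<tau>) powr (- c)))"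
      using \<open>A \<ge> 0\<close> by (simp add: ennreal_mult)
    also have "?a j * (A * (2 ^ j * \<tau>) powr (- c)) = 2 powr e * (A * \<tau> powr (e - c)) * (2 powr (e - c)) ^ j"
    proof -
      have j: "(2 powr (e - c)) ^ j = (2 ^ j :: real) powr (e - c)"
        by (simp add: powr_powr mult.commute flip: powr_realpow)
      show ?thesis
        unfolding j using \<open>\<tau> > 0\<close> by (simp add: powr_mult powr_diff powr_minus field_simps)
    qed
    finally show "ennreal (?a j) * emeasure M (?S j)
        \<le> ennreal (2 powr e * (A * \<tau> powr (e - c)) * (2 powr (e - c)) ^ j)" .
  qed
  also have "\<dots> = ennreal (2 powr e * (A * \<tau> powr (e - c)) * (1 / (1 - 2 powr (e - c))))"
    using r \<open>A \<ge> 0\<close> by (intro suminf_ennreal_eq sums_mult geometric_sums) auto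
  finally show ?thesis by (simp add: mult_ac)
qed

text \<open>Below a level \<tau> the integrand is at most \<open>\<tau> powr \<delta>\<close> on a
  set of measure at most \<open>b\<close>; above it the dyadic tail bound applies with
  \<open>c = 1\<close>.\<close>

lemma Kolmogorov_inequality:
  fixes k :: "'a \<Rightarrow> ennreal"
  assumes [measurable]: "k \<in> borel_measurable M" "S \<in> sets M" and \<delta>: "0 < \<delta>" "\<delta> < 1"
    and "A > 0" "b > 0" and S: "emeasure M S \<le> ennreal b"
    and weak: "\<And>t. t > 0 \<Longrightarrow> emeasure M {x \<in> space M. k x > ennreal t} \<le> ennreal (A / t)"
  shows "(\<integral>\<^sup>+x\<in>S. ennreal_powr (k x) \<delta> \<partial>M)
           \<le> ennreal ((1 + 2 powr \<delta> / (1 - 2 powr (\<delta> - 1))) * (b powr (1 - \<delta>) * A powr \<delta>))"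
proof -
  \<comment> \<open>At this level the bound \<open>b\<close> for the measure of \<open>S\<close>
    equals the weak-type bound \<open>A / \<tau>\<close>, so both parts have the size
    \<open>b powr (1 - \<delta>) * A powr \<delta>\<close>.\<close>
  define \<tau> where "\<tau> = A / b"
  have "\<tau> > 0" using \<open>A > 0\<close> \<open>b > 0\<close> by (simp add: \<tau>_def)
  let ?C = "2 powr \<delta> / (1 - 2 powr (\<delta> - 1))"
  have C: "?C \<ge> 0"
    using \<delta> by (intro divide_nonneg_nonneg) (auto intro!: less_imp_le[OF powr_less_one])
  have "(\<integral>\<^sup>+x\<in>S. ennreal_powr (k x) \<delta> \<partial>M)
     \<le> (\<integral>\<^sup>+x. ennreal (\<tau> powr \<delta>) * indicator S x
          + ennreal_powr (k x) \<delta> * indicator {x. k x > ennreal \<tau>} x \<partial>M)"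
  proof (intro nn_integral_mono)
    fix x
    show "ennreal_powr (k x) \<delta> * indicator S x \<le> ennreal (\<tau> powr \<delta>) * indicator S x
          + ennreal_powr (k x) \<delta> * indicator {x. k x > ennreal \<tau>} x"
    proof (cases "k x > ennreal \<tau>")
      case True
      then show ?thesis by (auto split: split_indicator)
    next
      case False
      then have "ennreal_powr (k x) \<delta> \<le> ennreal_powr (ennreal \<tau>) \<delta>"
        using \<delta> by (intro ennreal_powr_mono) auto
      then show ?thesis
        using \<open>\<tau> > 0\<close> False by (auto simp: ennreal_powr_ennreal split: split_indicator)
    qed
  qed
  also have "\<dots> = ennreal (\<tau> powr \<delta>) * emeasure M S
     + (\<integral>\<^sup>+x. ennreal_powr (k x) \<delta> * indicator {x. k x > ennreal \<tau>} x \<partial>M)"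
  proof -
    have "(\<lambda>x. ennreal_powr (k x) \<delta> * indicator {x. k x > ennreal \<tau>} x) \<in> borel_measurable M"
      by measurable
    then show ?thesis by (simp add: nn_integral_add nn_integral_cmult)
  qed
  also have "\<dots> \<le> ennreal (\<tau> powr \<delta>) * ennreal b + ennreal (?C * (A * \<tau> powr (\<delta> - 1)))"
    using \<delta> \<open>\<tau> > 0\<close> \<open>A > 0\<close> weak
    by (intro add_mono mult_left_mono S weak_type_tail_integral[where c = 1])
       (auto simp: powr_minus field_simps)
  also have "\<dots> = ennreal (\<tau> powr \<delta> * b + ?C * (A * \<tau> powr (\<delta> - 1)))"
    using mult_nonneg_nonneg[OF C, of "A * \<tau> powr (\<delta> - 1)"] \<open>A > 0\<close> \<open>b > 0\<close>
    by (subst ennreal_plus) (auto simp: ennreal_mult)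
  also have "\<tau> powr \<delta> * b + ?C * (A * \<tau> powr (\<delta> - 1)) = (1 + ?C) * (b powr (1 - \<delta>) * A powr \<delta>)"
  proof -
    have "\<tau> powr \<delta> * b = b powr (1 - \<delta>) * A powr \<delta>"
      using \<open>A > 0\<close> \<open>b > 0\<close> by (simp add: \<tau>_def powr_divide powr_diff)
    moreover have "A * \<tau> powr (\<delta> - 1) = b powr (1 - \<delta>) * A powr \<delta>"
      using \<open>A > 0\<close> \<open>b > 0\<close> by (simp add: \<tau>_def powr_divide powr_diff field_simps)
    ultimately show ?thesis by (simp only: distrib_right mult_1)
  qed
  finally show ?thesis .
qed

section \<open>Maximal functions relative to a doubling majorant\<close>

text \<open>The measure itself may fail to be doubling; only a majorant of its values on balls is.
  That is enough for covering arguments, because the measure of an enlarged ball is still controlled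
  by the majorant of the original one. The factor 5 is that of the Vitali covering lemma.\<close>

locale doubling_majorant =
  fixes \<nu> :: "'a::euclidean_space measure" and \<phi> :: "'a \<Rightarrow> real \<Rightarrow> real" and D :: real
  assumes sets_eq [measurable_cong]: "sets \<nu> = sets lebesgue"
    and emeasure_ball_le: "r > 0 \<Longrightarrow> emeasure \<nu> (ball z r) \<le> ennreal (\<phi> z r)"
    and majorant_pos: "r > 0 \<Longrightarrow> \<phi> z r > 0"
    and majorant_doubling: "r > 0 \<Longrightarrow> \<phi> z (5 * r) \<le> D * \<phi> z r"
begin

lemma space_eq [simp]: "space \<nu> = UNIV"
  using sets_eq_imp_space_eq[OF sets_eq] by simp

lemma D_pos: "D > 0"
proof -
  have "0 < D * \<phi> undefined 1"
    using majorant_pos[of "5 * 1" undefined] majorant_doubling[of 1 undefined] by linarith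
  then show ?thesis
    using majorant_pos[of 1 undefined] by (simp add: zero_less_mult_iff)
qed

lemma ball_in_sets [measurable, simp]: "ball z r \<in> sets \<nu>"
  by (simp add: sets_eq)

lemma superlevel_in_sets:
  fixes k :: "'a \<Rightarrow> ennreal"
  assumes [measurable]: "k \<in> borel_measurable \<nu>"
  shows "{x. t < k x} \<in> sets \<nu>"
proof -
  have "{x \<in> space \<nu>. t < k x} \<in> sets \<nu>" by measurable
  then show ?thesis by simp
qed

section \<open>The maximal function and its weak type (1,1)\<close>

definition avg :: "('a \<Rightarrow> ennreal) \<Rightarrow> 'a \<Rightarrow> real \<Rightarrow> ennreal" where
  "avg h z r = (\<integral>\<^sup>+x\<in>ball z r. h x \<partial>\<nu>) / ennreal (\<phi> z r)"

text \<open>Including \<open>h\<close> itself plays the role of balls of radius zero: pointwise domination of \<open>h\<close> then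
  needs no differentiation theorem.\<close>

definition maxf :: "('a \<Rightarrow> ennreal) \<Rightarrow> 'a \<Rightarrow> ennreal" where
  "maxf h x = max (h x) (SUP (z, r)\<in>{(z, r). r > 0 \<and> x \<in> ball z r}. avg h z r)"

lemma le_maxf: "h x \<le> maxf h x"
  by (simp add: maxf_def)

lemma avg_le_maxf: "r > 0 \<Longrightarrow> x \<in> ball z r \<Longrightarrow> avg h z r \<le> maxf h x"
  unfolding maxf_def by (rule max.coboundedI2) (rule SUP_upper2[of "(z, r)"], auto)

lemma less_maxf_iff:
  "t < maxf h x \<longleftrightarrow> t < h x \<or> (\<exists>z r. r > 0 \<and> x \<in> ball z r \<and> t < avg h z r)"
  unfolding maxf_def less_max_iff_disj less_SUP_iff by auto

lemma maxf_leI: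
  assumes "h x \<le> c" "\<And>z r. r > 0 \<Longrightarrow> x \<in> ball z r \<Longrightarrow> avg h z r \<le> c"
  shows "maxf h x \<le> c"
  using assms by (auto simp: not_less[symmetric] less_maxf_iff)

text \<open>A superlevel set is that of \<open>h\<close> together with a union of open balls, so the
  uncountable supremum causes no trouble.\<close>

lemma measurable_maxf [measurable]:
  assumes [measurable]: "h \<in> borel_measurable \<nu>"
  shows "maxf h \<in> borel_measurable \<nu>"
proof (rule borel_measurableI_greater)
  fix t
  let ?U = "\<Union>(z, r)\<in>{(z, r). r > 0 \<and> t < avg h z r}. ball z r"
  have "open ?U" by auto
  then have [measurable]: "?U \<in> sets \<nu>"
    by (simp add: sets_eq)
  have "{x \<in> space \<nu>. t < maxf h x} = {x \<in> space \<nu>. t < h x} \<union> ?U"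
    by (auto simp: less_maxf_iff)
  also have "\<dots> \<in> sets \<nu>" by measurable
  finally show "{x \<in> space \<nu>. t < maxf h x} \<in> sets \<nu>" .
qed

lemma nn_integral_ball_avg:
  assumes "r > 0"
  shows "(\<integral>\<^sup>+x\<in>ball z r. h x \<partial>\<nu>) = avg h z r * ennreal (\<phi> z r)"
  unfolding avg_def using majorant_pos[OF assms, of z]
  by (simp add: ennreal_divide_times ennreal_mult_divide_eq)

text \<open>Vitali covering: among the balls with average above \<open>t\<close> choose disjoint
  ones whose fivefold enlargements cover the union. Each enlargement has measure at most
  \<open>D * \<phi>\<close>, which is at most \<open>D / t\<close> times the integral of
  \<open>h\<close> over the chosen ball, and these integrals add up by disjointness. The covering
  lemma requires bounded radii, hence \<open>R\<close>.\<close>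

lemma weak_type_bounded_radii:
  assumes [measurable]: "h \<in> borel_measurable \<nu>" and "t > 0"
  shows "emeasure \<nu> (\<Union>(z, r)\<in>{(z, r). 0 < r \<and> r \<le> R \<and> ennreal t < avg h z r}. ball z r)
           \<le> ennreal (D / t) * (\<integral>\<^sup>+x. h x \<partial>\<nu>)"
proof -
  define K where "K = {(z, r). 0 < r \<and> r \<le> R \<and> ennreal t < avg h z r}"
  let ?U = "\<Union>i\<in>K. ball (fst i) (snd i)"
  have K: "0 < snd i \<and> snd i \<le> R" if "i \<in> K" for i
    using that by (cases i) (simp add: K_def)
  obtain C where C: "countable C" "C \<subseteq> K"
    "pairwise (\<lambda>i j. disjnt (ball (fst i) (snd i)) (ball (fst j) (snd j))) C"
    "?U \<subseteq> (\<Union>i\<in>C. ball (fst i) (5 * snd i))"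
    by (rule Vitali_covering_lemma_balls[where a = fst, OF subset_refl K])
  have "open ?U" by auto
  then have [measurable]: "?U \<in> sets \<nu>"
    by (simp add: sets_eq)
  have "emeasure \<nu> ?U = (\<integral>\<^sup>+x. indicator ?U x \<partial>\<nu>)"
    by simp
  \<comment> \<open>The sum over the countable subfamily is an integral against counting measure;
    subadditivity then becomes an exchange of integrals.\<close>
  also have "\<dots> \<le> (\<integral>\<^sup>+x. (\<integral>\<^sup>+i. indicator (ball (fst i) (5 * snd i)) x \<partial>count_space C) \<partial>\<nu>)"
  proof (intro nn_integral_mono)
    fix x
    show "indicator ?U x \<le> (\<integral>\<^sup>+i. indicator (ball (fst i) (5 * snd i)) x \<partial>count_space C :: ennreal)"
    proof (cases "x \<in> ?U")
      case True
      then obtain i where "i \<in> C" "x \<in> ball (fst i) (5 * snd i)" using C(4) by blast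
      then show ?thesis
        using nn_integral_ge_point[of i C "\<lambda>i. indicator (ball (fst i) (5 * snd i)) x"] True
        by (auto split: split_indicator)
    qed auto
  qed
  also have "\<dots> = (\<integral>\<^sup>+i. (\<integral>\<^sup>+x. indicator (ball (fst i) (5 * snd i)) x \<partial>\<nu>) \<partial>count_space C)"
    using C(1) by (intro nn_integral_count_space_nn_integral) auto
  also have "\<dots> = (\<integral>\<^sup>+i. emeasure \<nu> (ball (fst i) (5 * snd i)) \<partial>count_space C)"
    by simp
  \<comment> \<open>Integrals of \<open>h\<close> over balls are written as values of the measure
    with density \<open>h\<close>, so that disjointness can enter as countable additivity.\<close>
  also have "\<dots> \<le> (\<integral>\<^sup>+i. ennreal (D / t) * emeasure (density \<nu> h) (ball (fst i) (snd i)) \<partial>count_space C)"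
  proof (intro nn_integral_mono)
    fix i assume "i \<in> space (count_space C)"
    then have i: "snd i > 0" "ennreal t < avg h (fst i) (snd i)"
      using C(2) by (auto simp: K_def)
    have "emeasure \<nu> (ball (fst i) (5 * snd i)) \<le> ennreal (D * \<phi> (fst i) (snd i))"
      using i by (intro order.trans[OF emeasure_ball_le] ennreal_leI majorant_doubling) auto
    also have "\<dots> = ennreal (D / t) * (ennreal t * ennreal (\<phi> (fst i) (snd i)))"
      using \<open>t > 0\<close> D_pos majorant_pos[OF i(1), of "fst i"] by (simp flip: ennreal_mult)
    also have "\<dots> \<le> ennreal (D / t) * (avg h (fst i) (snd i) * ennreal (\<phi> (fst i) (snd i)))"
      using i by (intro mult_left_mono mult_right_mono) auto
    also have "\<dots> = ennreal (D / t) * emeasure (density \<nu> h) (ball (fst i) (snd i))"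
      using i by (simp add: emeasure_density nn_integral_ball_avg)
    finally show "emeasure \<nu> (ball (fst i) (5 * snd i))
      \<le> ennreal (D / t) * emeasure (density \<nu> h) (ball (fst i) (snd i))" .
  qed
  also have "\<dots> = ennreal (D / t) * (\<integral>\<^sup>+i. emeasure (density \<nu> h) (ball (fst i) (snd i)) \<partial>count_space C)"
    by (rule nn_integral_cmult) auto
  also have "(\<integral>\<^sup>+i. emeasure (density \<nu> h) (ball (fst i) (snd i)) \<partial>count_space C)
      = emeasure (density \<nu> h) (\<Union>i\<in>C. ball (fst i) (snd i))"
    using C(1,3)
    by (intro emeasure_UN_countable[symmetric]) (auto simp: disjoint_family_on_def pairwise_def disjnt_def)
  also have "\<dots> \<le> emeasure (density \<nu> h) (space (density \<nu> h))"
    by (rule emeasure_space)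
  also have "\<dots> = (\<integral>\<^sup>+x. h x \<partial>\<nu>)"
    using emeasure_density[of h \<nu> UNIV] sets.top[of \<nu>] by simp
  finally have "emeasure \<nu> ?U \<le> ennreal (D / t) * (\<integral>\<^sup>+x. h x \<partial>\<nu>)"
    by (simp add: mult_left_mono)
  then show ?thesis
    by (simp add: K_def case_prod_unfold)
qed

text \<open>Continuity from below along integer bounds for the radii removes that restriction and
  contributes \<open>D / t\<close>; the term \<open>h\<close> inside \<open>maxf\<close> contributes
  \<open>1 / t\<close> by Markov's inequality.\<close>

lemma weak_type_maxf:
  assumes [measurable]: "h \<in> borel_measurable \<nu>" and "t > 0"
  shows "emeasure \<nu> {x. maxf h x > ennreal t} \<le> ennreal ((D + 1) / t) * (\<integral>\<^sup>+x. h x \<partial>\<nu>)"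
proof -
  define U where "U n = (\<Union>(z, r)\<in>{(z, r). 0 < r \<and> r \<le> real n \<and> ennreal t < avg h z r}. ball z r)" for n
  have h_level: "{x \<in> space \<nu>. h x > ennreal t} \<in> sets \<nu>"
    by measurable
  have openU: "open (U n)" for n by (auto simp: U_def)
  have U [measurable]: "U n \<in> sets \<nu>" for n
    using openU by (simp add: sets_eq)
  have "incseq U"
    by (fastforce simp: incseq_def U_def)
  have "{x. maxf h x > ennreal t} \<subseteq> {x \<in> space \<nu>. h x > ennreal t} \<union> (\<Union>n. U n)"
  proof
    fix x assume "x \<in> {x. maxf h x > ennreal t}"
    then consider "h x > ennreal t" | z r where "r > 0" "x \<in> ball z r" "ennreal t < avg h z r"
      by (auto simp: less_maxf_iff)
    then show "x \<in> {x \<in> space \<nu>. h x > ennreal t} \<union> (\<Union>n. U n)"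
    proof cases
      case 2
      moreover obtain n :: nat where "r \<le> real n" using real_arch_simple by blast
      ultimately have "x \<in> U n" by (auto simp: U_def)
      then show ?thesis by auto
    qed auto
  qed
  then have "emeasure \<nu> {x. maxf h x > ennreal t}
      \<le> emeasure \<nu> ({x \<in> space \<nu>. h x > ennreal t} \<union> (\<Union>n. U n))"
    by (rule emeasure_mono) (intro sets.Un sets.countable_UN image_subsetI U h_level)
  also have "\<dots> \<le> emeasure \<nu> {x \<in> space \<nu>. h x > ennreal t} + emeasure \<nu> (\<Union>n. U n)"
    using h_level by (intro emeasure_subadditive) auto
  also have "\<dots> \<le> ennreal (1 / t) * (\<integral>\<^sup>+x. h x \<partial>\<nu>) + ennreal (D / t) * (\<integral>\<^sup>+x. h x \<partial>\<nu>)"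
  proof (intro add_mono)
    have "emeasure \<nu> {x \<in> space \<nu>. h x > ennreal t}
        \<le> emeasure \<nu> ({x \<in> space \<nu>. 1 \<le> ennreal (1 / t) * h x} \<inter> UNIV)"
    proof (intro emeasure_mono)
      show "{x \<in> space \<nu>. h x > ennreal t} \<subseteq> {x \<in> space \<nu>. 1 \<le> ennreal (1 / t) * h x} \<inter> UNIV"
      proof safe
        fix x assume "ennreal t < h x"
        then have "ennreal (1 / t) * ennreal t \<le> ennreal (1 / t) * h x"
          by (intro mult_left_mono) auto
        then show "1 \<le> ennreal (1 / t) * h x"
          using \<open>t > 0\<close> by (simp flip: ennreal_mult)
      qed auto
    qed measurable
    also have "\<dots> \<le> ennreal (1 / t) * (\<integral>\<^sup>+x\<in>UNIV. h x \<partial>\<nu>)"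
      using sets.top[of \<nu>] nn_integral_Markov_inequality[where u = h and A = UNIV and c = "ennreal (1 / t)" and M = \<nu>] by simp
    finally show "emeasure \<nu> {x \<in> space \<nu>. h x > ennreal t} \<le> ennreal (1 / t) * (\<integral>\<^sup>+x. h x \<partial>\<nu>)"
      by simp
    have "emeasure \<nu> (\<Union>n. U n) = (SUP n. emeasure \<nu> (U n))"
      using \<open>incseq U\<close> by (intro SUP_emeasure_incseq[symmetric]) auto
    also have "\<dots> \<le> ennreal (D / t) * (\<integral>\<^sup>+x. h x \<partial>\<nu>)"
      unfolding U_def using \<open>t > 0\<close> by (intro SUP_least weak_type_bounded_radii) auto
    finally show "emeasure \<nu> (\<Union>n. U n) \<le> ennreal (D / t) * (\<integral>\<^sup>+x. h x \<partial>\<nu>)" .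
  qed
  also have "\<dots> = ennreal ((D + 1) / t) * (\<integral>\<^sup>+x. h x \<partial>\<nu>)"
    using \<open>t > 0\<close> D_pos by (simp add: add_divide_distrib add.commute flip: distrib_right ennreal_plus)
  finally show ?thesis .
qed

text \<open>The first summand is Kolmogorov's constant applied to the part of \<open>h\<close> near
  the ball, the second comes from the part far away.\<close>

definition A1_const :: "real \<Rightarrow> real" where
  "A1_const \<delta> = (1 + 2 powr \<delta> / (1 - 2 powr (\<delta> - 1))) * ((D + 1) * D) powr \<delta> + D powr \<delta>"

text \<open>The argument of Coifman and Rochberg. Balls of radius at most \<open>r\<^sub>0\<close>
  that meet \<open>?B\<close> stay inside \<open>?B5\<close> and see only the truncation
  \<open>h5\<close>, to which Kolmogorov's inequality applies; larger balls contribute at most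
  \<open>D * Y\<close>. The comparison is with the value at a single point \<open>y\<close> rather
  than with an essential infimum.\<close>

lemma maxf_A1:
  assumes [measurable]: "h \<in> borel_measurable \<nu>" and \<delta>: "0 < \<delta>" "\<delta> < 1" and "r\<^sub>0 > 0"
    and y: "y \<in> ball x\<^sub>0 r\<^sub>0" "maxf h y = ennreal Y" "Y > 0"
  shows "(\<integral>\<^sup>+x\<in>ball x\<^sub>0 r\<^sub>0. ennreal_powr (maxf h x) \<delta> \<partial>\<nu>)
           \<le> ennreal (A1_const \<delta> * \<phi> x\<^sub>0 r\<^sub>0 * Y powr \<delta>)"
proof -
  let ?B = "ball x\<^sub>0 r\<^sub>0" and ?B5 = "ball x\<^sub>0 (5 * r\<^sub>0)"
  define h5 where "h5 x = h x * indicator ?B5 x" for x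
  have [measurable]: "h5 \<in> borel_measurable \<nu>"
    unfolding h5_def by measurable
  have \<phi>: "\<phi> x\<^sub>0 r\<^sub>0 > 0" using majorant_pos \<open>r\<^sub>0 > 0\<close> by auto
  have split: "maxf h x \<le> max (maxf h5 x) (ennreal (D * Y))" if x: "x \<in> ?B" for x
  proof (rule maxf_leI)
    have "h x = h5 x" using x \<open>r\<^sub>0 > 0\<close> by (auto simp: h5_def)
    then show "h x \<le> max (maxf h5 x) (ennreal (D * Y))"
      using le_maxf[of h5 x] by (simp add: le_max_iff_disj)
  next
    fix z r assume r: "r > 0" and xz: "x \<in> ball z r"
    show "avg h z r \<le> max (maxf h5 x) (ennreal (D * Y))"
    proof (cases "r \<le> r\<^sub>0")
      case True
      have "ball z r \<subseteq> ?B5"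
      proof
        fix u assume "u \<in> ball z r"
        then have "dist x\<^sub>0 u < r\<^sub>0 + r + r"
          using x xz by simp metric
        then show "u \<in> ?B5" using True \<open>r\<^sub>0 > 0\<close> by simp
      qed
      then have "avg h z r = avg h5 z r"
        unfolding avg_def h5_def
        by (intro arg_cong2[where f = divide] nn_integral_cong) (auto split: split_indicator)
      then show ?thesis
        using avg_le_maxf[OF r xz, of h5] by (simp add: le_max_iff_disj)
    next
      case False
      \<comment> \<open>A larger ball meeting \<open>?B\<close> contains \<open>y\<close> once it is
        enlarged five times. The enlarged average is therefore at most \<open>Y\<close>, and
        returning to the ball itself costs one doubling factor.\<close>
      have "dist z y < 5 * r"
      proof -
        have "dist z y < r + r\<^sub>0 + r\<^sub>0"
          using x xz y(1) by simp metric
        then show ?thesis using False \<open>r\<^sub>0 > 0\<close> by simp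
      qed
      then have avg5: "avg h z (5 * r) \<le> ennreal Y"
        using avg_le_maxf[of "5 * r" y z h] r y by simp
      have "(\<integral>\<^sup>+x\<in>ball z r. h x \<partial>\<nu>) \<le> (\<integral>\<^sup>+x\<in>ball z (5 * r). h x \<partial>\<nu>)"
        using r by (intro nn_integral_mono) (auto split: split_indicator)
      also have "\<dots> = avg h z (5 * r) * ennreal (\<phi> z (5 * r))"
        using r by (simp add: nn_integral_ball_avg)
      also have "\<dots> \<le> ennreal Y * ennreal (D * \<phi> z r)"
        using r by (intro mult_mono avg5 ennreal_leI majorant_doubling) auto
      finally have "avg h z r \<le> ennreal Y * ennreal (D * \<phi> z r) / ennreal (\<phi> z r)"
        unfolding avg_def by (rule divide_right_mono_ennreal)
      also have "\<dots> = ennreal (D * Y)"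
        using majorant_pos[OF r, of z] D_pos y(3) by (simp add: divide_ennreal flip: ennreal_mult)
      finally show ?thesis by (simp add: le_max_iff_disj)
    qed
  qed
  \<comment> \<open>The ball \<open>?B5\<close> also contains \<open>y\<close>, so \<open>Y\<close>
    controls the total integral of \<open>h5\<close> as well.\<close>
  have h5_int: "(\<integral>\<^sup>+x. h5 x \<partial>\<nu>) \<le> ennreal (D * \<phi> x\<^sub>0 r\<^sub>0 * Y)"
  proof -
    have "(\<integral>\<^sup>+x. h5 x \<partial>\<nu>) = avg h x\<^sub>0 (5 * r\<^sub>0) * ennreal (\<phi> x\<^sub>0 (5 * r\<^sub>0))"
      unfolding h5_def using \<open>r\<^sub>0 > 0\<close> by (simp add: nn_integral_ball_avg)
    also have "\<dots> \<le> ennreal Y * ennreal (D * \<phi> x\<^sub>0 r\<^sub>0)"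
      using \<open>r\<^sub>0 > 0\<close> y avg_le_maxf[of "5 * r\<^sub>0" y x\<^sub>0 h]
      by (intro mult_mono ennreal_leI majorant_doubling) auto
    also have "\<dots> = ennreal (D * \<phi> x\<^sub>0 r\<^sub>0 * Y)"
      using D_pos \<phi> y by (simp add: mult_ac flip: ennreal_mult)
    finally show ?thesis .
  qed
  let ?A = "(D + 1) * (D * \<phi> x\<^sub>0 r\<^sub>0 * Y)"
  let ?C = "1 + 2 powr \<delta> / (1 - 2 powr (\<delta> - 1))"
  have C: "?C \<ge> 0"
    using \<delta> by (intro add_nonneg_nonneg divide_nonneg_nonneg) (auto intro!: less_imp_le[OF powr_less_one])
  have A: "?A > 0" using D_pos \<phi> y by simp
  have weak: "emeasure \<nu> {x \<in> space \<nu>. maxf h5 x > ennreal t} \<le> ennreal (?A / t)" if "t > 0" for t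
  proof -
    have "emeasure \<nu> {x. maxf h5 x > ennreal t} \<le> ennreal ((D + 1) / t) * ennreal (D * \<phi> x\<^sub>0 r\<^sub>0 * Y)"
      using that by (intro order.trans[OF weak_type_maxf] mult_left_mono h5_int) auto
    also have "\<dots> = ennreal (?A / t)"
      using D_pos \<phi> y that by (subst ennreal_mult[symmetric]) auto
    finally show ?thesis by simp
  qed
  have "(\<integral>\<^sup>+x\<in>?B. ennreal_powr (maxf h x) \<delta> \<partial>\<nu>)
      \<le> (\<integral>\<^sup>+x. ennreal_powr (maxf h5 x) \<delta> * indicator ?B x + ennreal ((D * Y) powr \<delta>) * indicator ?B x \<partial>\<nu>)"
  proof (intro nn_integral_mono)
    fix x
    show "ennreal_powr (maxf h x) \<delta> * indicator ?B x
      \<le> ennreal_powr (maxf h5 x) \<delta> * indicator ?B x + ennreal ((D * Y) powr \<delta>) * indicator ?B x"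
    proof (cases "x \<in> ?B")
      case True
      have "ennreal_powr (maxf h x) \<delta> \<le> ennreal_powr (max (maxf h5 x) (ennreal (D * Y))) \<delta>"
        using split[OF True] \<delta> by (intro ennreal_powr_mono) auto
      also have "\<dots> \<le> ennreal_powr (maxf h5 x) \<delta> + ennreal ((D * Y) powr \<delta>)"
        using D_pos y by (auto simp: max_def ennreal_powr_ennreal)
      finally show ?thesis using True by simp
    qed auto
  qed
  also have "\<dots> = (\<integral>\<^sup>+x\<in>?B. ennreal_powr (maxf h5 x) \<delta> \<partial>\<nu>) + ennreal ((D * Y) powr \<delta>) * emeasure \<nu> ?B"
    by (simp add: nn_integral_add nn_integral_cmult)
  also have "\<dots> \<le> ennreal (?C * (\<phi> x\<^sub>0 r\<^sub>0 powr (1 - \<delta>) * ?A powr \<delta>))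
                 + ennreal ((D * Y) powr \<delta>) * ennreal (\<phi> x\<^sub>0 r\<^sub>0)"
    using \<delta> A \<phi> weak \<open>r\<^sub>0 > 0\<close>
    by (intro add_mono mult_left_mono Kolmogorov_inequality emeasure_ball_le) auto
  also have "\<dots> = ennreal (?C * (\<phi> x\<^sub>0 r\<^sub>0 powr (1 - \<delta>) * ?A powr \<delta>) + (D * Y) powr \<delta> * \<phi> x\<^sub>0 r\<^sub>0)"
    using mult_nonneg_nonneg[OF C, of "\<phi> x\<^sub>0 r\<^sub>0 powr (1 - \<delta>) * ?A powr \<delta>"] \<phi>
    by (subst ennreal_plus) (auto simp: ennreal_mult)
  also have "?C * (\<phi> x\<^sub>0 r\<^sub>0 powr (1 - \<delta>) * ?A powr \<delta>) + (D * Y) powr \<delta> * \<phi> x\<^sub>0 r\<^sub>0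
      = A1_const \<delta> * \<phi> x\<^sub>0 r\<^sub>0 * Y powr \<delta>"
  proof -
    have "\<phi> x\<^sub>0 r\<^sub>0 powr (1 - \<delta>) * ?A powr \<delta> = ((D + 1) * D) powr \<delta> * \<phi> x\<^sub>0 r\<^sub>0 * Y powr \<delta>"
      using \<phi> D_pos y by (simp add: powr_mult powr_diff)
    then show ?thesis
      unfolding A1_const_def using \<phi> D_pos y by (simp add: powr_mult algebra_simps)
  qed
  finally show ?thesis .
qed

text \<open>A zero at \<open>y\<close> makes the averages over all balls centred at \<open>y\<close>
  vanish, and these balls exhaust the space.\<close>

lemma maxf_pos:
  assumes [measurable]: "h \<in> borel_measurable \<nu>" and "(\<integral>\<^sup>+x. h x \<partial>\<nu>) > 0"
  shows "maxf h y > 0"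
proof (rule ccontr)
  assume "\<not> maxf h y > 0"
  then have "avg h y r = 0" if "r > 0" for r
    using avg_le_maxf[of r y y h] that by auto
  then have "(\<integral>\<^sup>+x\<in>ball y (real (Suc n)). h x \<partial>\<nu>) = 0" for n
    by (simp add: nn_integral_ball_avg)
  then have "AE x in \<nu>. \<forall>n. h x * indicator (ball y (real (Suc n))) x = 0"
    by (subst AE_all_countable) (simp add: nn_integral_0_iff_AE)
  then have "AE x in \<nu>. h x = 0"
  proof eventually_elim
    case (elim x)
    obtain n :: nat where "dist y x \<le> real n" using real_arch_simple by blast
    then have "x \<in> ball y (real (Suc n))" by simp
    then show ?case using elim[rule_format, of n] by (simp split: split_indicator_asm)
  qed
  then have "(\<integral>\<^sup>+x. h x \<partial>\<nu>) = 0"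
    by (simp add: nn_integral_0_iff_AE)
  with assms(2) show False by simp
qed

text \<open>Truncation at \<open>t / 2\<close>: the small part of \<open>h\<close> has averages at
  most \<open>t / 2\<close>, because the majorant dominates the measure. The large part
  \<open>k\<close> is integrable by the tail bound with exponents \<open>1 < 2\<close>, so the weak
  type (1,1) applies to it.\<close>

lemma weak_type_maxf_2:
  assumes [measurable]: "h \<in> borel_measurable \<nu>" and "L \<ge> 0" "t > 0"
    and weak: "\<And>t. t > 0 \<Longrightarrow> emeasure \<nu> {x. h x > ennreal t} \<le> ennreal (L * t powr (- 2))"
  shows "emeasure \<nu> {x. maxf h x > ennreal t} \<le> ennreal (16 * (D + 1) * L * t powr (- 2))"
proof -
  define k where "k x = h x * indicator {x. h x > ennreal (t / 2)} x" for x
  have [measurable]: "k \<in> borel_measurable \<nu>"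
    unfolding k_def by measurable
  have "maxf h x \<le> ennreal (t / 2) + maxf k x" for x
  proof (rule maxf_leI)
    have hk: "h u \<le> ennreal (t / 2) + k u" for u
      by (cases "h u > ennreal (t / 2)") (auto simp: k_def not_less)
    show "h x \<le> ennreal (t / 2) + maxf k x"
      using hk[of x] le_maxf[of k x] by (meson add_left_mono order.trans)
    fix z r assume r: "r > 0" "x \<in> ball z r"
    have "(\<integral>\<^sup>+x\<in>ball z r. h x \<partial>\<nu>) \<le> (\<integral>\<^sup>+x. ennreal (t / 2) * indicator (ball z r) x + k x * indicator (ball z r) x \<partial>\<nu>)"
      using hk by (intro nn_integral_mono) (auto split: split_indicator)
    also have "\<dots> = ennreal (t / 2) * emeasure \<nu> (ball z r) + (\<integral>\<^sup>+x\<in>ball z r. k x \<partial>\<nu>)"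
      by (simp add: nn_integral_add nn_integral_cmult)
    also have "\<dots> \<le> ennreal (t / 2) * ennreal (\<phi> z r) + avg k z r * ennreal (\<phi> z r)"
      using r by (intro add_mono mult_left_mono emeasure_ball_le) (auto simp: nn_integral_ball_avg)
    also have "\<dots> = (ennreal (t / 2) + avg k z r) * ennreal (\<phi> z r)"
      by (simp add: distrib_right)
    finally have "avg h z r \<le> (ennreal (t / 2) + avg k z r) * ennreal (\<phi> z r) / ennreal (\<phi> z r)"
      unfolding avg_def[of h] by (rule divide_right_mono_ennreal)
    also have "\<dots> = ennreal (t / 2) + avg k z r"
      using majorant_pos[OF r(1), of z] by (intro ennreal_mult_divide_eq) auto
    also have "\<dots> \<le> ennreal (t / 2) + maxf k x"
      using r by (intro add_left_mono avg_le_maxf)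
    finally show "avg h z r \<le> ennreal (t / 2) + maxf k x" .
  qed
  moreover have "ennreal (t / 2) + ennreal (t / 2) = ennreal t"
    using \<open>t > 0\<close> by (simp flip: ennreal_plus)
  ultimately have "maxf k x > ennreal (t / 2)" if "maxf h x > ennreal t" for x
    using that by (metis add_left_mono leD le_less_linear order.trans)
  then have "emeasure \<nu> {x. maxf h x > ennreal t} \<le> emeasure \<nu> {x \<in> space \<nu>. maxf k x > ennreal (t / 2)}"
    by (intro emeasure_mono) (auto simp: superlevel_in_sets)
  also have "\<dots> \<le> ennreal ((D + 1) / (t / 2)) * (\<integral>\<^sup>+x. k x \<partial>\<nu>)"
    using weak_type_maxf[of k "t / 2"] \<open>t > 0\<close> by simp
  also have "(\<integral>\<^sup>+x. k x \<partial>\<nu>) \<le> ennreal (2 powr 1 / (1 - 2 powr (1 - 2)) * (L * (t / 2) powr (1 - 2)))"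
    using weak_type_tail_integral[of h \<nu> 1 2 "t / 2" L] weak \<open>t > 0\<close> \<open>L \<ge> 0\<close> by (simp add: k_def)
  \<comment> \<open>The factor 16 is the product of 2 from \<open>1 / (t / 2)\<close>, 4 from the
    geometric series, and 2 from the power \<open>- 1\<close> of \<open>t / 2\<close>.\<close>
  also have "ennreal ((D + 1) / (t / 2)) * ennreal (2 powr 1 / (1 - 2 powr (1 - 2)) * (L * (t / 2) powr (1 - 2)))
    = ennreal (16 * (D + 1) * L * t powr (- 2))"
    using \<open>t > 0\<close> \<open>L \<ge> 0\<close> D_pos
    by (simp add: powr_minus power2_eq_square field_simps flip: ennreal_mult)
  finally show ?thesis
    by (auto simp: mult_left_mono)
qed

end

section \<open>Positivity of the critical radius\<close>

text \<open>Stands in for Hoelder's inequality when the integral of \<open>V\<close> is estimated by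
  that of its power; the free level \<open>s\<close> is chosen afterwards.\<close>

lemma le_add_powr:
  fixes v s q :: real
  assumes "v \<ge> 0" "s > 0" "q > 1"
  shows "v \<le> s + s powr (1 - q) * v powr q"
proof (cases "v \<le> s")
  case True
  then show ?thesis using assms by (meson add_increasing2 mult_nonneg_nonneg powr_ge_zero)
next
  case False
  then have "v / s \<le> (v / s) powr q"
    using assms powr_mono[of 1 q "v / s"] by simp
  then have "v \<le> s * (v / s) powr q"
    using assms by (simp add: field_simps)
  also have "\<dots> = s powr (1 - q) * v powr q"
    using assms by (simp add: powr_divide powr_diff)
  finally show ?thesis using assms by simp
qed

lemma set_integral_le_powr:
  fixes V :: "'a \<Rightarrow> real"
  assumes [measurable]: "V \<in> borel_measurable M" "S \<in> sets M" and fin: "emeasure M S < \<infinity>"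
    and V: "\<And>x. V x \<ge> 0" and int: "set_integrable M S (\<lambda>x. V x powr q)" and "s > 0" "q > 1"
  shows "set_integrable M S V"
    and "(LINT x:S|M. V x) \<le> s * measure M S + s powr (1 - q) * (LINT x:S|M. V x powr q)"
proof -
  have const: "set_integrable M S (\<lambda>x. s)"
    unfolding set_integrable_def using fin by simp
  have bnd: "set_integrable M S (\<lambda>x. s + s powr (1 - q) * V x powr q)"
    using int by (intro set_integral_add(1)[OF const] set_integrable_mult_right) auto
  show 1: "set_integrable M S V"
  proof (rule set_integrable_bound[OF bnd])
    show "set_borel_measurable M S V"
      unfolding set_borel_measurable_def by measurable
    show "AE x in M. x \<in> S \<longrightarrow> norm (V x) \<le> norm (s + s powr (1 - q) * V x powr q)"
      using V le_add_powr[OF V \<open>s > 0\<close> \<open>q > 1\<close>] by (intro AE_I2) (smt (verit) real_norm_def)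
  qed
  have "(LINT x:S|M. V x) \<le> (LINT x:S|M. s + s powr (1 - q) * V x powr q)"
    by (intro set_integral_mono 1 bnd le_add_powr V \<open>s > 0\<close> \<open>q > 1\<close>)
  also have "\<dots> = s * measure M S + s powr (1 - q) * (LINT x:S|M. V x powr q)"
    using int fin by (subst set_integral_add(2)[OF const]) (auto simp: set_lebesgue_integral_def mult_ac)
  finally show "(LINT x:S|M. V x) \<le> s * measure M S + s powr (1 - q) * (LINT x:S|M. V x powr q)" .
qed

section \<open>Volumes of balls and integrals over them\<close>

lemma measure_lebesgue_ball:
  fixes x :: "real ^ 'n"
  assumes "r \<ge> 0"
  shows "measure lebesgue (ball x r) = unit_ball_vol (real CARD('n)) * r ^ CARD('n)"
  using content_ball[OF assms, of x] by simp

lemma measure_lebesgue_ball_pos: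
  fixes x :: "real ^ 'n"
  shows "r > 0 \<Longrightarrow> measure lebesgue (ball x r) > 0"
  by (simp add: measure_lebesgue_ball)

lemma emeasure_lebesgue_ball_finite: "emeasure lebesgue (ball x r) < \<infinity>"
  using emeasure_bounded_finite[OF bounded_ball] by simp

lemma set_integrable_ball:
  assumes "locally_Lebesgue_integrable f"
  shows "set_integrable lebesgue (ball x r) f"
proof -
  have "f absolutely_integrable_on cball x r"
    using assms by (simp add: locally_Lebesgue_integrable_def)
  then show ?thesis
    by (rule set_integrable_subset) auto
qed

lemma set_integral_ball_tendsto_0:
  fixes f :: "real ^ 'n \<Rightarrow> real"
  assumes "locally_Lebesgue_integrable f"
  shows "(\<lambda>m. LINT y:ball x (1 / real (Suc m))|lebesgue. f y) \<longlonglongrightarrow> 0"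
proof -
  have "(\<lambda>m. LINT y|lebesgue. indicat_real (ball x (1 / real (Suc m))) y *\<^sub>R f y) \<longlonglongrightarrow> (LINT y|(lebesgue :: (real ^ 'n) measure). 0)"
  proof (rule integral_dominated_convergence[where w = "\<lambda>y. norm (indicat_real (ball x 1) y *\<^sub>R f y)"])
    show "(\<lambda>y. indicat_real (ball x (1 / real (Suc m))) y *\<^sub>R f y) \<in> borel_measurable lebesgue" for m
      using set_integrable_ball[OF assms, of x "1 / real (Suc m)"]
      by (auto simp: set_integrable_def dest: borel_measurable_integrable)
    show "integrable lebesgue (\<lambda>y. norm (indicat_real (ball x 1) y *\<^sub>R f y))"
      using set_integrable_ball[OF assms, of x 1]
      by (intro integrable_norm) (simp add: set_integrable_def)
    have "AE y in lebesgue. y \<noteq> x"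
      by (intro AE_I'[of "{x}"]) (auto simp flip: negligible_iff_null_sets)
    then show "AE y in lebesgue. (\<lambda>m. indicat_real (ball x (1 / real (Suc m))) y *\<^sub>R f y) \<longlonglongrightarrow> 0"
    proof eventually_elim
      case (elim y)
      then have "eventually (\<lambda>m. 1 / real (Suc m) < dist x y) sequentially"
        by (intro order_tendstoD[OF LIMSEQ_Suc[OF lim_1_over_n]]) auto
      then show ?case
        by (intro tendsto_eventually) (auto elim: eventually_mono)
    qed
    show "AE y in lebesgue. norm (indicat_real (ball x (1 / real (Suc m))) y *\<^sub>R f y)
        \<le> norm (indicat_real (ball x 1) y *\<^sub>R f y)" for m
    proof (intro AE_I2)
      fix y
      have "dist x y < 1" if "dist x y < 1 / real (Suc m)"
        using that by (rule order.strict_trans2) simp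
      then show "norm (indicat_real (ball x (1 / real (Suc m))) y *\<^sub>R f y)
        \<le> norm (indicat_real (ball x 1) y *\<^sub>R f y)" by (auto split: split_indicator)
    qed
  qed auto
  then show ?thesis
    by (simp add: set_lebesgue_integral_def)
qed

text \<open>Here \<open>I\<close>, \<open>J\<close>, \<open>m\<close> stand for the integrals of \<open>V\<close>, of \<open>V\<^sup>q\<close> and of \<open>1\<close> over concentric balls.
  Splitting \<open>I\<close> at a radius beyond which \<open>J\<close> gains little, the reverse Hoelder inequality on a huge
  ball bounds the total of \<open>J\<close> by an arbitrarily small number.\<close>

lemma set_integral_powr_small:
  fixes J I m :: "real \<Rightarrow> real"
  assumes C: "C > 0" and q: "q > 1" and m: "\<And>r. r > 0 \<Longrightarrow> m r > 0" "filterlim m at_top at_top"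
    and I0: "\<And>r. I r \<ge> 0" and J0: "\<And>r. J r \<ge> 0" "mono J" "\<And>r. J r \<le> M"
    and rH: "\<And>r. r > 0 \<Longrightarrow> J r \<le> C powr q * m r powr (1 - q) * I r powr q"
    and split: "\<And>r R s. 0 < r \<Longrightarrow> r \<le> R \<Longrightarrow> s > 0 \<Longrightarrow> I R \<le> I r + s * m R + s powr (1 - q) * (J R - J r)"
  shows "J r = 0"
proof -
  define S where "S = (SUP r. J r)"
  have bdd: "bdd_above (range J)" using J0(3) by (auto intro!: bdd_aboveI)
  have JS: "J r \<le> S" for r unfolding S_def using bdd by (rule cSUP_upper[rotated]) auto
  have "S \<le> (1 + (3 * C) powr q) * \<eta>" if \<eta>: "\<eta> > 0" for \<eta>
  proof -
    have "\<exists>r. S - \<eta> < J r"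
      using less_cSUP_iff[OF _ bdd, of "S - \<eta>"] \<eta> unfolding S_def by auto
    then obtain r\<^sub>1 where r1: "S - \<eta> < J r\<^sub>1" by blast
    define r\<^sub>0 where "r\<^sub>0 = max r\<^sub>1 1"
    have r0: "S - \<eta> < J r\<^sub>0" "r\<^sub>0 > 0"
      using r1 monoD[OF J0(2), of r\<^sub>1 r\<^sub>0] by (auto simp: r\<^sub>0_def)
    \<comment> \<open>The ball is taken so large that the inner integral \<open>I r\<^sub>0\<close>
      is at most the common size \<open>?u\<close> of the two other terms.\<close>
    have "eventually (\<lambda>R. (I r\<^sub>0 / \<eta> powr (1 / q)) powr (q / (q - 1)) \<le> m R \<and> r\<^sub>0 \<le> R) at_top"
      using m(2) by (intro eventually_conj eventually_ge_at_top) (simp add: filterlim_at_top)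
    then obtain R where R: "(I r\<^sub>0 / \<eta> powr (1 / q)) powr (q / (q - 1)) \<le> m R" "r\<^sub>0 \<le> R"
      by (auto dest: eventually_happens)
    have mR: "m R > 0" using R r0 m(1) by auto
    \<comment> \<open>This level balances the two terms of \<open>split\<close>: both
      \<open>s * m R\<close> and \<open>s powr (1 - q) * \<eta>\<close> equal
      \<open>?u\<close>.\<close>
    define s where "s = (\<eta> / m R) powr (1 / q)"
    have s: "s > 0" using \<eta> mR by (simp add: s_def)
    let ?u = "\<eta> powr (1 / q) * m R powr (1 - 1 / q)"
    have 1: "s * m R = ?u"
      using \<eta> mR by (simp add: s_def powr_divide powr_diff field_simps)
    have 2: "s powr (1 - q) * \<eta> = ?u"
    proof -
      have "s powr (1 - q) * \<eta> = s * \<eta> / s powr q"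
        using s by (simp add: powr_diff)
      also have "s powr q = \<eta> / m R"
        using \<eta> mR q by (simp add: s_def powr_powr)
      finally show ?thesis using 1 \<eta> by simp
    qed
    have 3: "I r\<^sub>0 \<le> ?u"
    proof -
      have "((I r\<^sub>0 / \<eta> powr (1 / q)) powr (q / (q - 1))) powr ((q - 1) / q) \<le> m R powr ((q - 1) / q)"
        using R(1) q by (intro powr_mono2) auto
      then have "I r\<^sub>0 / \<eta> powr (1 / q) \<le> m R powr ((q - 1) / q)"
        using q I0[of r\<^sub>0] by (simp add: powr_powr)
      also have "(q - 1) / q = 1 - 1 / q" using q by (simp add: field_simps)
      finally show ?thesis using \<eta> by (simp add: field_simps)
    qed
    have "s powr (1 - q) * (J R - J r\<^sub>0) \<le> s powr (1 - q) * \<eta>"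
      using JS[of R] r0 by (intro mult_left_mono) auto
    then have "I R \<le> 3 * ?u"
      using split[OF r0(2) R(2) s] 1 2 3 by linarith
    then have "I R powr q \<le> (3 * ?u) powr q"
      using I0[of R] q by (intro powr_mono2) auto
    also have "\<dots> = 3 powr q * \<eta> * m R powr (q - 1)"
    proof -
      have "(1 - 1 / q) * q = q - 1" using q by (simp add: field_simps)
      then show ?thesis
        using \<eta> mR q by (simp add: powr_mult powr_powr)
    qed
    finally have "C powr q * m R powr (1 - q) * I R powr q
        \<le> C powr q * m R powr (1 - q) * (3 powr q * \<eta> * m R powr (q - 1))"
      by (intro mult_left_mono) auto
    also have "\<dots> = (3 * C) powr q * \<eta> * (m R powr (1 - q) * m R powr (q - 1))"
      using C by (simp add: powr_mult mult_ac)
    also have "m R powr (1 - q) * m R powr (q - 1) = 1"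
      using mR by (simp flip: powr_add)
    finally have "J R \<le> (3 * C) powr q * \<eta>"
      using rH[of R] R r0 by simp
    moreover have "J r\<^sub>0 \<le> J R" using monoD[OF J0(2) R(2)] .
    ultimately show ?thesis using r0 by (simp add: algebra_simps)
  qed
  then have "S / (1 + (3 * C) powr q) \<le> \<eta>" if "\<eta> > 0" for \<eta>
    using that by (simp add: field_simps add_pos_nonneg)
  then have "S / (1 + (3 * C) powr q) \<le> 0"
    by (rule dense_ge)
  then have "S \<le> 0"
    by (smt (verit) divide_pos_pos powr_ge_zero)
  then show ?thesis using JS[of r] J0(1)[of r] by linarith
qed

text \<open>A positive element of the defining set is not enough, since \<open>Sup\<close> carries
  no information about an unbounded set; boundedness has to be shown too. If it failed, the
  integrals of \<open>V powr q\<close> over balls would be bounded, hence zero by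
  \<open>set_integral_powr_small\<close>, and \<open>V\<close> would vanish a.e.\<close>

lemma critical_radius_pos:
  fixes V :: "real ^ 'n \<Rightarrow> real"
  assumes n: "CARD('n) \<ge> 3" and V: "V \<in> reverse_Hoelder (real CARD('n) / 2)"
    and nonzero: "\<not> (AE x in lebesgue. V x = 0)"
  shows "critical_radius V x > 0"
proof -
  define n where "n = CARD('n)"
  define q where "q = real n / 2"
  define c where "c = unit_ball_vol (real n)"
  have q: "q > 1" using n by (simp add: q_def n_def)
  have c: "c > 0" by (simp add: c_def)
  have [measurable]: "V \<in> borel_measurable lebesgue" and V0: "\<And>x. V x \<ge> 0"
    and loc: "locally_Lebesgue_integrable (\<lambda>x. V x powr q)"
    using V by (auto simp: reverse_Hoelder_def q_def n_def)
  obtain C where C: "C > 0"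
    "\<And>x r. r > 0 \<Longrightarrow> ball_average (\<lambda>y. V y powr q) x r powr (1 / q) \<le> C * ball_average V x r"
    using V by (auto simp: reverse_Hoelder_def q_def n_def)
  define m where "m r = measure lebesgue (ball x r)" for r
  define I where "I r = (LINT y:ball x r|lebesgue. V y)" for r
  define J where "J r = (LINT y:ball x r|lebesgue. V y powr q)" for r
  have m: "m r = c * r ^ n" if "r > 0" for r
    using that measure_lebesgue_ball[of r x] by (simp add: m_def c_def n_def)
  have m_pos: "m r > 0" if "r > 0" for r using m[OF that] that c by simp
  have intJ: "set_integrable lebesgue (ball z r) (\<lambda>x. V x powr q)" for r z
    by (rule set_integrable_ball[OF loc])
  have intI: "set_integrable lebesgue (ball z r) V" for r z
    by (rule set_integral_le_powr(1)[where s = 1 and q = q, OF _ _ emeasure_lebesgue_ball_finite V0 intJ _ q]) auto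
  have I_le: "I r \<le> s * m r + s powr (1 - q) * J r" if "s > 0" for s r
    unfolding I_def J_def m_def
    by (rule set_integral_le_powr(2)[OF _ _ emeasure_lebesgue_ball_finite V0 intJ that q]) auto
  have I0: "I r \<ge> 0" and J0: "J r \<ge> 0" for r
    unfolding I_def J_def set_lebesgue_integral_def using V0 by (auto intro!: integral_nonneg_AE)
  have rH: "J r \<le> C powr q * m r powr (1 - q) * I r powr q" if r: "r > 0" for r
  proof -
    have "(J r / m r) powr (1 / q) \<le> C * (I r / m r)"
      using C(2)[OF r, of x] by (simp add: ball_average_def J_def I_def m_def)
    then have "((J r / m r) powr (1 / q)) powr q \<le> (C * (I r / m r)) powr q"
      using q by (intro powr_mono2) auto
    then have "J r / m r \<le> (C * (I r / m r)) powr q"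
      using q J0[of r] m_pos[OF r] by (simp add: powr_powr)
    also have "\<dots> = C powr q * (I r powr q / m r powr q)"
      using C(1) I0[of r] m_pos[OF r] by (simp add: powr_mult powr_divide)
    finally show ?thesis
      using m_pos[OF r] by (simp add: field_simps powr_diff)
  qed
  have split: "I R \<le> I r + s * m R + s powr (1 - q) * (J R - J r)" if "0 < r" "r \<le> R" "s > 0" for r R s
  proof -
    let ?A = "ball x R - ball x r"
    have eq: "ball x R = ball x r \<union> ?A" using that by auto
    have intA: "set_integrable lebesgue ?A (\<lambda>x. V x powr q)" "set_integrable lebesgue ?A V"
      by (auto intro: set_integrable_subset[OF intJ[of x R]] set_integrable_subset[OF intI[of x R]])
    have fin: "emeasure lebesgue ?A < \<infinity>"
      by (rule order.strict_trans1[OF emeasure_mono emeasure_lebesgue_ball_finite[of x R]]) auto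
    have "I R = I r + (LINT y:?A|lebesgue. V y)"
      unfolding I_def by (subst eq, rule set_integral_Un[OF _ intI intA(2)]) auto
    moreover have "J R = J r + (LINT y:?A|lebesgue. V y powr q)"
      unfolding J_def by (subst eq, rule set_integral_Un[OF _ intJ intA(1)]) auto
    moreover have "(LINT y:?A|lebesgue. V y) \<le> s * measure lebesgue ?A + s powr (1 - q) * (LINT y:?A|lebesgue. V y powr q)"
      by (rule set_integral_le_powr(2)[OF _ _ fin V0 intA(1) that(3) q]) auto
    moreover have "s * measure lebesgue ?A \<le> s * m R"
      unfolding m_def using that
      by (intro mult_left_mono measure_mono_fmeasurable) auto
    ultimately show ?thesis by simp
  qed
  have "mono J"
  proof (rule monoI)
    fix r R :: real assume "r \<le> R"
    then show "J r \<le> J R"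
      unfolding J_def set_lebesgue_integral_def
      by (intro integral_mono intJ[unfolded set_integrable_def]) (auto split: split_indicator)
  qed
  have powi: "r powi (2 - int n) = r powr (2 - real n)" if "r > 0" for r :: real
    using powr_real_of_int'[of r "2 - int n"] that by simp
  define P where "P = {r. r > 0 \<and> r powi (2 - int n) * I r \<le> 1}"
  have "bdd_above P"
  proof (rule ccontr)
    assume unb: "\<not> bdd_above P"
    \<comment> \<open>At a radius \<open>R\<close> in \<open>P\<close> one has
      \<open>I R \<le> R powr (n - 2)\<close>, and the total power of \<open>R\<close> in the
      reverse Hoelder bound is \<open>n * (1 - q) + (n - 2) * q = n - 2 * q = 0\<close>. So the
      bound is independent of \<open>R\<close>.\<close>
    define M where "M = c powr (1 - q) * C powr q"
    have bound: "J r \<le> M" for r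
    proof -
      from unb obtain R where R: "R \<in> P" "R > r"
        unfolding bdd_above_def by (auto simp: not_le)
      then have "R > 0" "R powi (2 - int n) * I R \<le> 1" by (auto simp: P_def)
      then have "R powr (2 - real n) * I R \<le> 1"
        by (simp add: powi)
      then have "I R \<le> R powr (real n - 2)"
        using \<open>R > 0\<close> by (simp add: powr_diff field_simps)
      then have "I R powr q \<le> (R powr (real n - 2)) powr q"
        using I0 q by (intro powr_mono2) auto
      then have "C powr q * m R powr (1 - q) * I R powr q
          \<le> C powr q * m R powr (1 - q) * (R powr (real n - 2)) powr q"
        by (intro mult_left_mono) auto
      also have "\<dots> = M * (R powr (real n * (1 - q)) * R powr ((real n - 2) * q))"
        using \<open>R > 0\<close> c by (simp add: m M_def powr_mult powr_powr flip: powr_realpow)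
      also have "R powr (real n * (1 - q)) * R powr ((real n - 2) * q) = R powr 0"
        unfolding powr_add[symmetric] by (rule arg_cong2[of _ _ _ _ "(powr)"]) (simp_all add: q_def field_simps)
      finally have "J R \<le> M" using rH[OF \<open>R > 0\<close>] \<open>R > 0\<close> by simp
      then show ?thesis using monoD[OF \<open>mono J\<close>, of r R] R by simp
    qed
    have "filterlim (\<lambda>r. c * r ^ n) at_top at_top"
      using c n by (intro filterlim_tendsto_pos_mult_at_top[OF tendsto_const] filterlim_pow_at_top filterlim_ident)
        (auto simp: n_def)
    then have lim: "filterlim m at_top at_top"
      by (rule filterlim_mono_eventually) (auto simp: m intro!: eventually_mono[OF eventually_gt_at_top[of 0]])
    have "J r = 0" for r
      by (rule set_integral_powr_small[OF C(1) q m_pos lim I0 J0 \<open>mono J\<close> bound rH split])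
    then have "AE y in lebesgue. \<forall>k. indicat_real (ball x (real (Suc k))) y *\<^sub>R V y powr q = 0"
      using integral_nonneg_eq_0_iff_AE[OF intJ[unfolded set_integrable_def]] V0
      by (subst AE_all_countable) (auto simp: J_def set_lebesgue_integral_def)
    then have "AE y in lebesgue. V y = 0"
    proof eventually_elim
      case (elim y)
      obtain k :: nat where "dist x y \<le> real k" using real_arch_simple by blast
      then have "y \<in> ball x (real (Suc k))" by simp
      then show ?case using elim[rule_format, of k] by simp
    qed
    with nonzero show False by blast
  qed
  moreover obtain r where "r \<in> P"
  proof -
    \<comment> \<open>With \<open>s = \<eta> * r powr (- 2)\<close> this value makes
      \<open>s * m r\<close> exactly half of \<open>r powr (n - 2)\<close>. The other half is left
      for the term with \<open>J r\<close>, whose power of \<open>r\<close> fits because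
      \<open>2 * (q - 1) = n - 2\<close>.\<close>
    define \<eta> where "\<eta> = 1 / (2 * c)"
    have \<eta>: "\<eta> > 0" using c by (simp add: \<eta>_def)
    have "(\<lambda>k. J (1 / real (Suc k))) \<longlonglongrightarrow> 0"
      unfolding J_def by (rule set_integral_ball_tendsto_0[OF loc])
    then have "eventually (\<lambda>k. J (1 / real (Suc k)) < \<eta> powr (q - 1) / 2) sequentially"
      using \<eta> by (intro order_tendstoD) auto
    then obtain k where k: "J (1 / real (Suc k)) < \<eta> powr (q - 1) / 2"
      by (auto dest: eventually_happens)
    define r where "r = 1 / real (Suc k)"
    have r: "r > 0" by (simp add: r_def)
    define s where "s = \<eta> * r powr (- 2)"
    have s: "s > 0" using \<eta> r by (simp add: s_def)
    have "s * m r = r powr (real n - 2) / 2"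
      using r c by (simp add: m s_def \<eta>_def powr_diff powr_minus field_simps powr_realpow)
    moreover have "s powr (1 - q) * J r \<le> r powr (real n - 2) / 2"
    proof -
      have "s powr (1 - q) * J r \<le> s powr (1 - q) * (\<eta> powr (q - 1) / 2)"
        using k by (intro mult_left_mono) (auto simp: r_def)
      also have "\<dots> = (\<eta> powr (1 - q) * \<eta> powr (q - 1)) * r powr (- 2 * (1 - q)) / 2"
        using \<eta> r by (simp add: s_def powr_mult powr_powr)
      also have "\<eta> powr (1 - q) * \<eta> powr (q - 1) = 1"
        using \<eta> by (simp flip: powr_add)
      also have "- 2 * (1 - q) = real n - 2" by (simp add: q_def)
      finally show ?thesis by simp
    qed
    ultimately have "I r \<le> r powr (real n - 2)"
      using I_le[OF s, of r] by simp
    then have "r powr (2 - real n) * I r \<le> r powr (2 - real n) * r powr (real n - 2)"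
      by (intro mult_left_mono) auto
    also have "\<dots> = 1" using r by (simp flip: powr_add)
    finally have "r \<in> P" using r by (simp add: P_def powi)
    then show ?thesis by (rule that)
  qed
  ultimately have "r \<le> Sup P" "r > 0" by (auto intro: cSup_upper simp: P_def)
  moreover have "critical_radius V x = Sup P"
    by (simp add: critical_radius_def P_def I_def n_def)
  ultimately show ?thesis by simp
qed

section \<open>Weights\<close>

lemma weight_measurable:
  assumes "weight w"
  shows "w \<in> borel_measurable lebesgue"
proof (rule borel_measurable_LIMSEQ_real)
  fix x
  show "(\<lambda>i. indicat_real (ball 0 (real i)) x *\<^sub>R w x) \<longlonglongrightarrow> w x"
  proof (rule tendsto_eventually)
    obtain k :: nat where "norm x < real k" using reals_Archimedean2 by blast
    then show "eventually (\<lambda>i. indicat_real (ball 0 (real i)) x *\<^sub>R w x = w x) sequentially"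
      by (intro eventually_sequentiallyI[of k]) simp
  qed
next
  fix i
  show "(\<lambda>x. indicat_real (ball 0 (real i)) x *\<^sub>R w x) \<in> borel_measurable lebesgue"
    using set_integrable_ball[of w 0 "real i"] assms
    by (auto simp: weight_def set_integrable_def dest: borel_measurable_integrable)
qed

lemma locally_Lebesgue_integrableI:
  fixes f :: "real ^ 'n \<Rightarrow> real"
  assumes [measurable]: "f \<in> borel_measurable lebesgue" and f0: "\<And>x. f x \<ge> 0"
    and fin: "\<And>r. r > 0 \<Longrightarrow> (\<integral>\<^sup>+y\<in>ball 0 r. ennreal (f y) \<partial>lebesgue) < \<infinity>"
  shows "locally_Lebesgue_integrable f"
  unfolding locally_Lebesgue_integrable_def
proof (intro allI impI)
  fix S :: "(real ^ 'n) set" assume S: "compact S"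
  then obtain r where r: "r > 0" "S \<subseteq> ball 0 r"
    using bounded_subset_ballD compact_imp_bounded by blast
  have [measurable]: "ball 0 r \<in> sets lebesgue" by auto
  have "integrable lebesgue (\<lambda>y. indicat_real (ball 0 r) y *\<^sub>R f y)"
  proof (rule integrableI_nonneg)
    have "(\<integral>\<^sup>+y. ennreal (indicat_real (ball 0 r) y *\<^sub>R f y) \<partial>lebesgue) = (\<integral>\<^sup>+y\<in>ball 0 r. ennreal (f y) \<partial>lebesgue)"
      by (intro nn_integral_cong) (auto split: split_indicator)
    then show "(\<integral>\<^sup>+y. ennreal (indicat_real (ball 0 r) y *\<^sub>R f y) \<partial>lebesgue) < \<infinity>"
      using fin[OF r(1)] by simp
  qed (auto intro!: AE_I2 mult_nonneg_nonneg f0)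
  then have "f absolutely_integrable_on ball 0 r"
    by (simp add: set_integrable_def)
  then show "f absolutely_integrable_on S"
    using S r by (rule_tac set_integrable_subset) (auto intro: fmeasurableD[OF lmeasurable_compact])
qed

lemma weight_nn_integral_ball_finite:
  assumes "weight w"
  shows "(\<integral>\<^sup>+y\<in>ball x r. ennreal (w y) \<partial>lebesgue) < \<infinity>"
proof -
  have "set_integrable lebesgue (ball x r) w"
    using assms by (intro set_integrable_ball) (simp add: weight_def)
  then have "integrable lebesgue (\<lambda>y. indicat_real (ball x r) y *\<^sub>R w y)"
    by (simp add: set_integrable_def)
  then have "(\<integral>\<^sup>+y. ennreal (norm (indicat_real (ball x r) y *\<^sub>R w y)) \<partial>lebesgue) < \<infinity>"
    by (simp add: integrable_iff_bounded)
  also have "(\<integral>\<^sup>+y. ennreal (norm (indicat_real (ball x r) y *\<^sub>R w y)) \<partial>lebesgue)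
      = (\<integral>\<^sup>+y\<in>ball x r. ennreal (w y) \<partial>lebesgue)"
    using assms by (intro nn_integral_cong) (auto split: split_indicator simp: weight_def abs_of_pos)
  finally show ?thesis .
qed

lemma nn_integral_ball_pos:
  fixes f :: "real ^ 'n \<Rightarrow> real"
  assumes [measurable]: "f \<in> borel_measurable lebesgue" and f: "\<And>x. f x > 0" and "r > 0"
  shows "(\<integral>\<^sup>+y\<in>ball x r. ennreal (f y) \<partial>lebesgue) > 0"
proof (rule ccontr)
  have [measurable]: "ball x r \<in> sets lebesgue" by auto
  assume "\<not> ?thesis"
  then have "(\<integral>\<^sup>+y\<in>ball x r. ennreal (f y) \<partial>lebesgue) = 0" by simp
  then have "AE y in lebesgue. ennreal (f y) * indicator (ball x r) y = 0"
    by (subst (asm) nn_integral_0_iff_AE) auto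
  then have "AE y in lebesgue. y \<notin> ball x r"
    by eventually_elim (use f[THEN less_imp_le] f[THEN less_imp_neq] in
        \<open>auto simp: ennreal_eq_0_iff antisym_conv split: split_indicator_asm\<close>)
  then have "emeasure lebesgue (ball x r) = 0"
    by (subst (asm) AE_iff_measurable[of "ball x r"]) auto
  then show False
    using measure_lebesgue_ball_pos[OF \<open>r > 0\<close>, of x] by (simp add: measure_def)
qed

section \<open>The growth factor and the A_p inequality\<close>

lemma Psi_ge_1:
  assumes "critical_radius V x > 0" "\<theta> \<ge> 0" "r \<ge> 0"
  shows "Psi V \<theta> x r \<ge> 1"
  using assms unfolding Psi_def by (intro ge_one_powr_ge_zero) auto

lemma Psi_double: "Psi V (2 * \<theta>) x r = (Psi V \<theta> x r)\<^sup>2"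
  by (simp add: Psi_def power2_eq_square flip: powr_add)

lemma Psi_le_scale:
  assumes "critical_radius V x > 0" "\<theta> \<ge> 0" "0 < r" "r \<le> s"
  shows "Psi V \<theta> x s \<le> (s / r) powr \<theta> * Psi V \<theta> x r"
proof -
  have "1 + s / critical_radius V x \<le> s / r * (1 + r / critical_radius V x)"
    using assms by (simp add: field_simps)
  then have "(1 + s / critical_radius V x) powr \<theta> \<le> (s / r * (1 + r / critical_radius V x)) powr \<theta>"
    using assms by (intro powr_mono2) auto
  then show ?thesis
    unfolding Psi_def using assms by (subst (asm) powr_mult) auto
qed

text \<open>Both averages divide by the same number \<open>Psi * vol\<close>, which occurs to the
  power \<open>1 + (q - 1) = q\<close>. Clearing it leaves a condition on plain integrals, for which
  upper bounds suffice.\<close>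

lemma Ap_inequalityI:
  fixes w :: "real ^ 'n \<Rightarrow> real"
  assumes \<rho>: "\<And>x. critical_radius V x > 0" and "\<theta> \<ge> 0" "q > 1"
    and XY: "\<And>x r. r > 0 \<Longrightarrow> \<exists>X Y. X \<ge> 0 \<and> Y \<ge> 0 \<and> (\<integral>\<^sup>+y\<in>ball x r. ennreal (w y) \<partial>lebesgue) \<le> ennreal X \<and>
      (\<integral>\<^sup>+y\<in>ball x r. ennreal (w y powr (- 1 / (q - 1))) \<partial>lebesgue) \<le> ennreal Y \<and>
      X * Y powr (q - 1) \<le> K * (Psi V \<theta> x r * measure lebesgue (ball x r)) powr q"
  shows "Ap_inequality V \<theta> q w K"
proof -
  have "Psi_average V \<theta> x r (\<lambda>y. ennreal (w y)) *
        ennreal_powr (Psi_average V \<theta> x r (\<lambda>y. ennreal (w y powr (- 1 / (q - 1))))) (q - 1)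
        \<le> ennreal K" if r: "r > 0" for x r
  proof -
    obtain X Y where XY: "X \<ge> 0" "Y \<ge> 0" "(\<integral>\<^sup>+y\<in>ball x r. ennreal (w y) \<partial>lebesgue) \<le> ennreal X"
      "(\<integral>\<^sup>+y\<in>ball x r. ennreal (w y powr (- 1 / (q - 1))) \<partial>lebesgue) \<le> ennreal Y"
      "X * Y powr (q - 1) \<le> K * (Psi V \<theta> x r * measure lebesgue (ball x r)) powr q"
      using XY[OF r, of x] by blast
    define P where "P = Psi V \<theta> x r * measure lebesgue (ball x r)"
    have P: "P > 0"
      using Psi_ge_1[OF \<rho>[of x] \<open>\<theta> \<ge> 0\<close>, of r] r measure_lebesgue_ball_pos[OF r, of x]
      unfolding P_def by (intro mult_pos_pos) auto
    have "Psi_average V \<theta> x r (\<lambda>y. ennreal (w y)) *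
        ennreal_powr (Psi_average V \<theta> x r (\<lambda>y. ennreal (w y powr (- 1 / (q - 1))))) (q - 1)
      \<le> (ennreal X / ennreal P) * ennreal_powr (ennreal Y / ennreal P) (q - 1)"
      unfolding Psi_average_def P_def[symmetric] using \<open>q > 1\<close>
      by (intro mult_mono ennreal_powr_mono divide_right_mono_ennreal XY) auto
    also have "\<dots> = ennreal (X / P * (Y / P) powr (q - 1))"
      using XY P by (simp add: divide_ennreal ennreal_powr_ennreal flip: ennreal_mult)
    also have "X / P * (Y / P) powr (q - 1) = X * Y powr (q - 1) / P powr q"
      using XY P by (simp add: powr_divide powr_diff)
    also have "\<dots> \<le> K"
      using XY(5)[folded P_def] P by (simp add: field_simps)
    finally show ?thesis by (simp add: ennreal_leI)
  qed
  then show ?thesis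
    using \<open>q > 1\<close> by (simp add: Ap_inequality_def)
qed

lemma Ap_inequalityE:
  fixes w :: "real ^ 'n \<Rightarrow> real" and x :: "real ^ 'n"
  assumes \<rho>: "\<And>x. critical_radius V x > 0" and "\<theta> \<ge> 0" "q > 1" "K > 0" and w: "weight w"
    and Ap: "Ap_inequality V \<theta> q w K" and r: "r > 0"
  obtains X Y where "X > 0" "Y > 0" "(\<integral>\<^sup>+y\<in>ball x r. ennreal (w y) \<partial>lebesgue) = ennreal X"
    "(\<integral>\<^sup>+y\<in>ball x r. ennreal (w y powr (- 1 / (q - 1))) \<partial>lebesgue) = ennreal Y"
    "X * Y powr (q - 1) \<le> K * (Psi V \<theta> x r * measure lebesgue (ball x r)) powr q"
proof -
  define P where "P = Psi V \<theta> x r * measure lebesgue (ball x r)"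
  have P: "P > 0"
    using Psi_ge_1[OF \<rho>[of x] \<open>\<theta> \<ge> 0\<close>, of r] r measure_lebesgue_ball_pos[OF r, of x]
    unfolding P_def by (intro mult_pos_pos) auto
  have [measurable]: "w \<in> borel_measurable lebesgue" by (rule weight_measurable[OF w])
  have w0: "w x > 0" for x using w by (simp add: weight_def)
  let ?X = "\<integral>\<^sup>+y\<in>ball x r. ennreal (w y) \<partial>lebesgue"
  let ?Y = "\<integral>\<^sup>+y\<in>ball x r. ennreal (w y powr (- 1 / (q - 1))) \<partial>lebesgue"
  have "?X > 0" "?X < \<infinity>"
    using nn_integral_ball_pos[of w r x] weight_nn_integral_ball_finite[OF w, of x r] w0 r by auto
  then obtain X where X: "X > 0" "?X = ennreal X"
    by (cases ?X) auto
  have XP: "?X / ennreal P = ennreal (X / P)"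
    using X P by (simp add: divide_ennreal)
  have le: "(?X / ennreal P) * ennreal_powr (?Y / ennreal P) (q - 1) \<le> ennreal K"
    using Ap r \<open>q > 1\<close> by (simp add: Ap_inequality_def Psi_average_def P_def)
  have "?Y > 0"
    by (rule nn_integral_ball_pos) (use w0 r in \<open>auto simp: less_imp_neq[THEN not_sym]\<close>)
  \<comment> \<open>The average of the weight is positive, so an infinite dual average would make
    the product infinite.\<close>
  have "?Y \<noteq> \<infinity>"
  proof
    assume Y: "?Y = \<infinity>"
    have "?Y / ennreal P = \<infinity>"
      unfolding Y using P by (simp add: ennreal_top_divide)
    then have "(?X / ennreal P) * ennreal_powr (?Y / ennreal P) (q - 1) = \<infinity>"
      using X P XP by (simp add: ennreal_mult_top ennreal_powr_def)
    with le show False by (simp add: top_unique)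
  qed
  then obtain Y where Y: "Y > 0" "?Y = ennreal Y"
    using \<open>?Y > 0\<close> by (cases ?Y) auto
  have YP: "?Y / ennreal P = ennreal (Y / P)"
    using Y P by (simp add: divide_ennreal)
  have "ennreal (X / P * (Y / P) powr (q - 1)) \<le> ennreal K"
    using le X Y P unfolding XP YP by (simp add: ennreal_powr_ennreal flip: ennreal_mult)
  then have "X / P * (Y / P) powr (q - 1) \<le> K"
    using \<open>K > 0\<close> by (simp add: ennreal_le_iff)
  moreover have "X / P * (Y / P) powr (q - 1) = X * Y powr (q - 1) / P powr q"
    using X Y P by (simp add: powr_divide powr_diff)
  ultimately have "X * Y powr (q - 1) / P powr q \<le> K" by simp
  then have "X * Y powr (q - 1) \<le> K * P powr q"
    using P by (simp add: divide_le_eq)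
  with X Y show ?thesis by (intro that) (auto simp: P_def)
qed

text \<open>On a ball the A_1 condition bounds \<open>1 / w\<close> a.e. by
  \<open>K * P / X\<close>, where \<open>X\<close> is the mass of the ball; integrating over the
  ball, of volume at most \<open>P\<close>, gives the A_2 inequality with the same \<open>K\<close>.
  The endpoint is thereby reduced to exponents \<open>q > 1\<close>.\<close>

lemma Ap_inequality_1_imp_2:
  fixes w :: "real ^ 'n \<Rightarrow> real"
  assumes \<rho>: "\<And>x. critical_radius V x > 0" and "\<theta> \<ge> 0" "K > 0" and w: "weight w"
    and A1: "Ap_inequality V \<theta> 1 w K"
  shows "Ap_inequality V \<theta> 2 w K"
proof (rule Ap_inequalityI[OF \<rho> \<open>\<theta> \<ge> 0\<close>])
  fix x :: "real ^ 'n" and r :: real assume r: "r > 0"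
  have [measurable]: "w \<in> borel_measurable lebesgue" by (rule weight_measurable[OF w])
  have w0: "w x > 0" for x using w by (simp add: weight_def)
  define m where "m = measure lebesgue (ball x r)"
  define P where "P = Psi V \<theta> x r * m"
  have m: "m > 0" unfolding m_def by (rule measure_lebesgue_ball_pos[OF r])
  have Psi: "Psi V \<theta> x r \<ge> 1" using Psi_ge_1[OF \<rho>[of x] \<open>\<theta> \<ge> 0\<close>, of r] r by simp
  then have P: "P > 0" and "m \<le> P"
    using m by (auto simp: P_def)
  let ?X = "\<integral>\<^sup>+y\<in>ball x r. ennreal (w y) \<partial>lebesgue"
  have "?X > 0" "?X < \<infinity>"
    using nn_integral_ball_pos[of w r x] weight_nn_integral_ball_finite[OF w, of x r] w0 r by auto
  then obtain X where X: "X > 0" "?X = ennreal X"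
    by (cases ?X) auto
  have avg: "Psi_average V \<theta> x r (\<lambda>y. ennreal \<bar>w y\<bar>) = ennreal (X / P)"
    using X P w0 by (simp add: Psi_average_def abs_of_pos divide_ennreal m_def[symmetric] P_def[symmetric])
  have "AE y in lebesgue. y \<in> ball x r \<longrightarrow> w y powr (- 1 / (2 - 1)) \<le> K * P / X"
    using A1[unfolded Ap_inequality_def, simplified]
  proof eventually_elim
    case (elim y)
    show ?case
    proof
      assume "y \<in> ball x r"
      then have "ennreal (X / P) \<le> Psi_maximal V \<theta> w y"
        unfolding Psi_maximal_def avg[symmetric] using r by (intro SUP_upper2[of "(x, r)"]) auto
      with elim have "ennreal (X / P) \<le> ennreal (K * w y)" by simp
      then have "X / P \<le> K * w y"
        using \<open>K > 0\<close> w0[of y] by (simp add: ennreal_le_iff)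
      then have "inverse (w y) \<le> K * P / X"
        using X P w0[of y] by (simp add: field_simps)
      then show "w y powr (- 1 / (2 - 1)) \<le> K * P / X"
        using w0[of y] by (simp add: powr_minus)
    qed
  qed
  then have "(\<integral>\<^sup>+y\<in>ball x r. ennreal (w y powr (- 1 / (2 - 1))) \<partial>lebesgue)
      \<le> (\<integral>\<^sup>+y. ennreal (K * P / X) * indicator (ball x r) y \<partial>lebesgue)"
    by (intro nn_integral_mono_AE) (auto elim!: eventually_mono intro!: ennreal_leI split: split_indicator)
  also have "\<dots> = ennreal (K * P / X) * emeasure lebesgue (ball x r)"
    by (rule nn_integral_cmult_indicator) auto
  also have "emeasure lebesgue (ball x r) = ennreal m"
    unfolding m_def using emeasure_lebesgue_ball_finite[of x r] by (intro emeasure_eq_ennreal_measure) auto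
  also have "ennreal (K * P / X) * ennreal m = ennreal (K * P / X * m)"
    using \<open>K > 0\<close> P X m by (subst ennreal_mult) auto
  finally have "(\<integral>\<^sup>+y\<in>ball x r. ennreal (w y powr (- 1 / (2 - 1))) \<partial>lebesgue) \<le> ennreal (K * P / X * m)" .
  moreover have "X * (K * P / X * m) powr (2 - 1) \<le> K * P powr 2"
    using \<open>K > 0\<close> P X m \<open>m \<le> P\<close> by (simp add: power2_eq_square)
  ultimately show "\<exists>X Y. 0 \<le> X \<and> 0 \<le> Y \<and> (\<integral>\<^sup>+y\<in>ball x r. ennreal (w y) \<partial>lebesgue) \<le> ennreal X \<and>
      (\<integral>\<^sup>+y\<in>ball x r. ennreal (w y powr (- 1 / (2 - 1))) \<partial>lebesgue) \<le> ennreal Y \<and>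
      X * Y powr (2 - 1) \<le> K * (Psi V \<theta> x r * measure lebesgue (ball x r)) powr 2"
    using X P m \<open>K > 0\<close> by (intro exI[of _ X] exI[of _ "K * P / X * m"]) (auto simp: P_def m_def)
qed simp

section \<open>Masses of balls and the doubling majorant\<close>

locale Ap_weight =
  fixes V w :: "real ^ 'n \<Rightarrow> real" and \<theta> q K :: real
  assumes \<rho>_pos: "critical_radius V x > 0" and weight: "weight w"
    and \<theta>: "\<theta> \<ge> 0" and q: "q > 1" and K: "K \<ge> 1" and Ap: "Ap_inequality V \<theta> q w K"
begin

lemma w_pos: "w x > 0"
  using weight by (simp add: weight_def)

lemma w_measurable [measurable]: "w \<in> borel_measurable lebesgue"
  by (rule weight_measurable[OF weight])

lemma ball_sets [measurable]: "ball x r \<in> sets lebesgue"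
  for x :: "real ^ 'n"
  by auto

definition mass :: "real ^ 'n \<Rightarrow> real \<Rightarrow> real" where
  "mass x r = enn2real (\<integral>\<^sup>+y\<in>ball x r. ennreal (w y) \<partial>lebesgue)"

definition dual_mass :: "real ^ 'n \<Rightarrow> real \<Rightarrow> real" where
  "dual_mass x r = enn2real (\<integral>\<^sup>+y\<in>ball x r. ennreal (w y powr (- 1 / (q - 1))) \<partial>lebesgue)"

abbreviation vol :: "real ^ 'n \<Rightarrow> real \<Rightarrow> real" where
  "vol x r \<equiv> measure lebesgue (ball x r)"

lemma mass:
  assumes "r > 0"
  shows "mass x r > 0" "(\<integral>\<^sup>+y\<in>ball x r. ennreal (w y) \<partial>lebesgue) = ennreal (mass x r)"
    and "dual_mass x r > 0"
    and "(\<integral>\<^sup>+y\<in>ball x r. ennreal (w y powr (- 1 / (q - 1))) \<partial>lebesgue) = ennreal (dual_mass x r)"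
    and "mass x r * dual_mass x r powr (q - 1) \<le> K * (Psi V \<theta> x r * vol x r) powr q"
proof -
  have "K > 0" using K by simp
  obtain X Y where "X > 0" "Y > 0" and
    XY: "(\<integral>\<^sup>+y\<in>ball x r. ennreal (w y) \<partial>lebesgue) = ennreal X"
    "(\<integral>\<^sup>+y\<in>ball x r. ennreal (w y powr (- 1 / (q - 1))) \<partial>lebesgue) = ennreal Y"
    "X * Y powr (q - 1) \<le> K * (Psi V \<theta> x r * vol x r) powr q"
    by (rule Ap_inequalityE[OF \<rho>_pos \<theta> q \<open>K > 0\<close> weight Ap assms, of x]) blast
  have "mass x r = X" "dual_mass x r = Y"
    unfolding mass_def dual_mass_def XY(1,2) using \<open>X > 0\<close> \<open>Y > 0\<close> by simp_all
  with XY \<open>X > 0\<close> \<open>Y > 0\<close> show "mass x r > 0" "(\<integral>\<^sup>+y\<in>ball x r. ennreal (w y) \<partial>lebesgue) = ennreal (mass x r)"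
    "dual_mass x r > 0"
    "(\<integral>\<^sup>+y\<in>ball x r. ennreal (w y powr (- 1 / (q - 1))) \<partial>lebesgue) = ennreal (dual_mass x r)"
    "mass x r * dual_mass x r powr (q - 1) \<le> K * (Psi V \<theta> x r * vol x r) powr q"
    by (simp_all only:)
qed

lemma vol_pos: "r > 0 \<Longrightarrow> vol x r > 0"
  by (rule measure_lebesgue_ball_pos)

lemma Psi1: "r > 0 \<Longrightarrow> Psi V \<theta> x r \<ge> 1"
  using Psi_ge_1[OF \<rho>_pos \<theta>, of r] by simp

text \<open>Hoelder's inequality for the product
  \<open>1 = w powr (1 / q) * w powr (- 1 / q)\<close> on the small ball bounds its volume by mass
  and dual mass. The dual mass increases with the radius, so the A_q inequality on the large ball
  finishes the estimate.\<close>

lemma mass_vol_le: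
  assumes "0 < r" "r \<le> s"
  shows "mass x s * vol x r powr q \<le> K * (Psi V \<theta> x s * vol x s) powr q * mass x r"
proof -
  have s: "s > 0" using assms by simp
  have "dual_mass x r \<le> dual_mass x s"
  proof -
    have "ennreal (dual_mass x r) \<le> ennreal (dual_mass x s)"
      unfolding mass(4)[OF assms(1), symmetric] mass(4)[OF s, symmetric]
      using assms by (intro nn_integral_mono) (auto split: split_indicator)
    then show ?thesis using mass(3)[OF s, of x] by simp
  qed
  have "ennreal (vol x r) = emeasure lebesgue (ball x r)"
    using emeasure_lebesgue_ball_finite[of x r] by (intro emeasure_eq_ennreal_measure[symmetric]) auto
  also have "\<dots> = (\<integral>\<^sup>+y\<in>ball x r. ennreal (w y powr (1 / q) * (w y powr (- 1 / (q - 1))) powr (1 - 1 / q)) \<partial>lebesgue)"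
  proof -
    have "w y powr (1 / q) * (w y powr (- 1 / (q - 1))) powr (1 - 1 / q) = 1" for y
    proof -
      have "1 / q + - 1 / (q - 1) * (1 - 1 / q) = 0" using q by (simp add: field_simps)
      then show ?thesis using w_pos[of y] by (simp add: powr_powr flip: powr_add)
    qed
    then show ?thesis by simp
  qed
  also have "\<dots> \<le> ennreal (mass x r powr (1 / q) * dual_mass x r powr (1 - 1 / q))"
    using q w_pos mass[OF assms(1), of x]
    by (intro nn_integral_Hoelder) (auto simp: less_imp_le)
  finally have "vol x r \<le> mass x r powr (1 / q) * dual_mass x r powr (1 - 1 / q)"
    by simp
  then have "vol x r powr q \<le> (mass x r powr (1 / q) * dual_mass x r powr (1 - 1 / q)) powr q"
    using q by (intro powr_mono2) auto
  also have "\<dots> = mass x r * dual_mass x r powr (q - 1)"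
  proof -
    have "(1 - 1 / q) * q = q - 1" using q by (simp add: field_simps)
    then show ?thesis
      using mass[OF assms(1), of x] q by (simp add: powr_mult powr_powr)
  qed
  also have "\<dots> \<le> mass x r * dual_mass x s powr (q - 1)"
    using mass(1,3)[OF assms(1), of x] \<open>dual_mass x r \<le> dual_mass x s\<close> q
    by (intro mult_left_mono powr_mono2) auto
  finally have "mass x s * vol x r powr q \<le> mass x r * (mass x s * dual_mass x s powr (q - 1))"
    using mass(1)[OF s, of x] by (simp add: mult_ac)
  also have "\<dots> \<le> mass x r * (K * (Psi V \<theta> x s * vol x s) powr q)"
    using mass(1)[OF assms(1), of x] mass(5)[OF s, of x] by (intro mult_left_mono) auto
  finally show ?thesis by (simp add: mult_ac)
qed

text \<open>The exponent \<open>N\<close> of the growth estimate: the dimension comes from the ratio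
  of volumes, \<theta> from the scaling of \<open>Psi\<close>, and both are raised to the power
  \<open>q\<close>.\<close>

definition dexp :: real where
  "dexp = (real CARD('n) + \<theta>) * q"

text \<open>In \<open>mass_vol_le\<close> both \<open>vol\<close> and \<open>Psi\<close> at radius
  \<open>s\<close> are at most powers of \<open>s / r\<close> times their values at
  \<open>r\<close>, after which the volume of the small ball cancels.\<close>

lemma mass_growth:
  assumes "0 < r" "r \<le> s"
  shows "mass x s * (r / s) powr dexp \<le> K * Psi V \<theta> x r powr q * mass x r"
proof -
  have s: "s > 0" using assms by simp
  have vol: "vol x s = (s / r) powr real CARD('n) * vol x r"
    using measure_lebesgue_ball[of r x] measure_lebesgue_ball[of s x] assms s
    by (simp add: powr_realpow power_divide del: measure_completion)
  have "Psi V \<theta> x s * vol x s \<le> (s / r) powr (real CARD('n) + \<theta>) * (Psi V \<theta> x r * vol x r)"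
    using mult_right_mono[OF Psi_le_scale[OF \<rho>_pos \<theta> assms, of x], of "vol x s"] vol_pos[OF s, of x]
    by (simp add: vol powr_add mult_ac del: measure_completion)
  then have "(Psi V \<theta> x s * vol x s) powr q \<le> ((s / r) powr (real CARD('n) + \<theta>) * (Psi V \<theta> x r * vol x r)) powr q"
    using q vol_pos[OF s, of x] Psi1[OF s, of x] by (intro powr_mono2) auto
  also have "\<dots> = (s / r) powr dexp * (Psi V \<theta> x r powr q * vol x r powr q)"
    using Psi1[OF assms(1), of x] vol_pos[OF assms(1), of x]
    by (simp add: powr_mult powr_powr dexp_def del: measure_completion)
  finally have "mass x s * vol x r powr q \<le> K * ((s / r) powr dexp * (Psi V \<theta> x r powr q * vol x r powr q)) * mass x r"
    using mass_vol_le[OF assms, of x] mass(1)[OF assms(1), of x] K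
    by (smt (verit) mult_left_mono mult_right_mono)
  then have "mass x s * vol x r powr q \<le> (K * (s / r) powr dexp * Psi V \<theta> x r powr q * mass x r) * vol x r powr q"
    by (simp add: mult_ac)
  moreover have "vol x r powr q > 0" using vol_pos[OF assms(1), of x] by simp
  ultimately have "mass x s \<le> K * (s / r) powr dexp * Psi V \<theta> x r powr q * mass x r"
    by (simp add: mult_le_cancel_right)
  then have "mass x s * (r / s) powr dexp \<le> (K * (s / r) powr dexp * Psi V \<theta> x r powr q * mass x r) * (r / s) powr dexp"
    by (intro mult_right_mono) auto
  also have "\<dots> = K * Psi V \<theta> x r powr q * mass x r * ((s / r) powr dexp * (r / s) powr dexp)"
    by (simp add: mult_ac)
  also have "(s / r) powr dexp * (r / s) powr dexp = 1"
    using assms s by (simp flip: powr_mult)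
  finally show ?thesis by simp
qed

text \<open>Unlike \<open>mass\<close>, this majorant is doubling with a constant independent of the radius, because
  the factor \<open>Psi\<close> is absorbed into the supremum.\<close>

definition majorant :: "real ^ 'n \<Rightarrow> real \<Rightarrow> real" where
  "majorant x r = (SUP s\<in>{r..}. mass x s * (r / s) powr dexp)"

lemma bdd_majorant:
  assumes "r > 0"
  shows "bdd_above ((\<lambda>s. mass x s * (r / s) powr dexp) ` {r..})"
  by (rule bdd_aboveI[where M = "K * Psi V \<theta> x r powr q * mass x r"]) (use mass_growth[OF assms] in auto)

lemma mass_le_majorant:
  assumes "r > 0"
  shows "mass x r \<le> majorant x r"
  unfolding majorant_def using assms by (intro cSUP_upper2[where x = r] bdd_majorant) auto

lemma majorant_le:
  assumes "r > 0"
  shows "majorant x r \<le> K * Psi V \<theta> x r powr q * mass x r"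
  unfolding majorant_def using mass_growth[OF assms] by (intro cSUP_least) auto

text \<open>Every \<open>s \<ge> 5 * r\<close> also competes in the supremum for radius
  \<open>r\<close>, and the two competing values differ by the factor
  \<open>5 powr dexp\<close>.\<close>

lemma majorant_5:
  assumes "r > 0"
  shows "majorant x (5 * r) \<le> 5 powr dexp * majorant x r"
  unfolding majorant_def[of x "5 * r"]
proof (rule cSUP_least)
  fix s assume "s \<in> {5 * r..}"
  then have s: "s \<ge> 5 * r" by simp
  have "(5 * r / s) powr dexp = 5 powr dexp * (r / s) powr dexp"
    using powr_mult[of 5 "r / s" dexp] assms s by simp
  then have "mass x s * (5 * r / s) powr dexp = 5 powr dexp * (mass x s * (r / s) powr dexp)"
    by simp
  also have "\<dots> \<le> 5 powr dexp * majorant x r"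
    unfolding majorant_def using s assms by (intro mult_left_mono cSUP_upper bdd_majorant) auto
  finally show "mass x s * (5 * r / s) powr dexp \<le> 5 powr dexp * majorant x r" .
qed auto

abbreviation wmeasure :: "(real ^ 'n) measure" where
  "wmeasure \<equiv> density lebesgue (\<lambda>x. ennreal (w x))"

text \<open>From here on \<open>avg\<close>, \<open>maxf\<close> and \<open>A1_const\<close> refer
  to the measure \<open>w dx\<close> and to this majorant.\<close>

sublocale doubling_majorant wmeasure majorant "5 powr dexp"
proof
  show "sets wmeasure = sets lebesgue" by simp
  fix z and r :: real assume r: "r > 0"
  show "emeasure wmeasure (ball z r) \<le> ennreal (majorant z r)"
  proof -
    have "emeasure wmeasure (ball z r) = (\<integral>\<^sup>+y\<in>ball z r. ennreal (w y) \<partial>lebesgue)"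
      by (intro emeasure_density) auto
    also have "\<dots> = ennreal (mass z r)" by (rule mass(2)[OF r])
    finally show ?thesis using mass_le_majorant[OF r, of z] by (simp add: ennreal_leI)
  qed
  show "majorant z r > 0"
    using mass(1)[OF r, of z] mass_le_majorant[OF r, of z] by linarith
  show "majorant z (5 * r) \<le> 5 powr dexp * majorant z r"
    by (rule majorant_5[OF r])
qed

lemma A_infty_if:
  assumes u: "weight u" and "\<theta>' \<ge> 0" "Q > 1" "K' > 0" and "Ap_inequality V \<theta>' Q u K'"
  shows "u \<in> A_infty V" "Ap_constant V \<theta>' Q u \<le> ennreal K'"
proof -
  have "u \<in> Ap V \<theta>' Q" using assms by (auto simp: Ap_def)
  then show "u \<in> A_infty V"
    using assms unfolding A_infty_def Ap_infty_def by fastforce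
  show "Ap_constant V \<theta>' Q u \<le> ennreal K'"
    unfolding Ap_constant_def using assms by (intro Inf_lower) auto
qed

end

text \<open>A multiplier that is an \<open>A\<^sub>1\<close> weight relative to \<open>w dx\<close>, with the majorant in place of the mass.\<close>

locale A1_multiplier = Ap_weight V w \<theta> q K
  for V w :: "real ^ 'n \<Rightarrow> real" and \<theta> q K :: real +
  fixes v :: "real ^ 'n \<Rightarrow> real" and C :: real
  assumes v_measurable [measurable]: "v \<in> borel_measurable lebesgue" and v_pos: "v x > 0" and C: "C > 0"
    and A1: "r > 0 \<Longrightarrow> \<exists>Z>0. (\<integral>\<^sup>+y\<in>ball x r. ennreal (w y * v y) \<partial>lebesgue) \<le> ennreal Z \<and>
      (AE y in lebesgue. y \<in> ball x r \<longrightarrow> Z \<le> C * majorant x r * v y)"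
begin

section \<open>Weights built from a multiplier\<close>

lemma weight_mult: "weight (\<lambda>x. w x * v x)"
  unfolding weight_def
proof (intro conjI allI locally_Lebesgue_integrableI)
  show "(\<integral>\<^sup>+y\<in>ball 0 r. ennreal (w y * v y) \<partial>lebesgue) < \<infinity>" if "r > 0" for r
    using A1[OF that, of 0] by (auto intro: order.strict_trans1)
qed (use w_pos v_pos in \<open>auto simp: less_imp_le\<close>)

text \<open>On the ball \<open>1 / v\<close> is a.e. at most \<open>C * majorant / Z\<close>, which
  bounds the dual integral, and \<open>Z\<close> cancels in the product. Replacing the majorant by
  the mass costs \<open>K * Psi powr q\<close>, and the A_q inequality for \<open>w\<close> costs
  the same again; hence \<open>K\<^sup>2\<close> and the doubled \<theta>.\<close>

lemma Ap_mult: "Ap_inequality V (2 * \<theta>) q (\<lambda>x. w x * v x) (C * K\<^sup>2)"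
proof (rule Ap_inequalityI[OF \<rho>_pos _ q])
  fix x and r :: real assume r: "r > 0"
  obtain Z where Z: "Z > 0" "(\<integral>\<^sup>+y\<in>ball x r. ennreal (w y * v y) \<partial>lebesgue) \<le> ennreal Z"
    "AE y in lebesgue. y \<in> ball x r \<longrightarrow> Z \<le> C * majorant x r * v y"
    using A1[OF r, of x] by blast
  define L where "L = C * majorant x r / Z"
  have maj: "majorant x r > 0" by (rule majorant_pos[OF r])
  have L: "L > 0" using C maj Z by (simp add: L_def)
  let ?Y = "L powr (1 / (q - 1)) * dual_mass x r"
  have "(\<integral>\<^sup>+y\<in>ball x r. ennreal ((w y * v y) powr (- 1 / (q - 1))) \<partial>lebesgue)
      \<le> (\<integral>\<^sup>+y. ennreal (L powr (1 / (q - 1))) * (ennreal (w y powr (- 1 / (q - 1))) * indicator (ball x r) y) \<partial>lebesgue)"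
  proof (rule nn_integral_mono_AE, use Z(3) in eventually_elim)
    case (elim y)
    show ?case
    proof (cases "y \<in> ball x r")
      case True
      with elim have "Z \<le> C * majorant x r * v y" by simp
      then have "inverse (v y) \<le> L"
        using Z(1) v_pos[of y] by (simp add: L_def field_simps)
      then have "inverse (v y) powr (1 / (q - 1)) \<le> L powr (1 / (q - 1))"
        using q v_pos[of y] by (intro powr_mono2) auto
      moreover have "inverse (v y) powr (1 / (q - 1)) = v y powr (- 1 / (q - 1))"
        using v_pos[of y] by (simp add: powr_minus inverse_powr)
      ultimately have "(w y * v y) powr (- 1 / (q - 1)) \<le> L powr (1 / (q - 1)) * w y powr (- 1 / (q - 1))"
        using w_pos[of y] v_pos[of y] by (simp add: powr_mult)
      from ennreal_leI[OF this] show ?thesis using True by (simp add: ennreal_mult)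
    next
      case False
      then show ?thesis by simp
    qed
  qed
  also have "\<dots> = ennreal ?Y"
    using mass[OF r, of x] by (simp add: nn_integral_cmult ennreal_mult)
  finally have Y: "(\<integral>\<^sup>+y\<in>ball x r. ennreal ((w y * v y) powr (- 1 / (q - 1))) \<partial>lebesgue) \<le> ennreal ?Y" .
  have "Z * ?Y powr (q - 1) = Z * L * dual_mass x r powr (q - 1)"
    using q L mass(3)[OF r, of x] by (simp add: powr_mult powr_powr)
  also have "\<dots> = C * (majorant x r * dual_mass x r powr (q - 1))"
    using Z by (simp add: L_def)
  also have "\<dots> \<le> C * (K * Psi V \<theta> x r powr q * mass x r * dual_mass x r powr (q - 1))"
    using C majorant_le[OF r, of x] by (intro mult_left_mono mult_right_mono) auto
  also have "\<dots> = C * K * Psi V \<theta> x r powr q * (mass x r * dual_mass x r powr (q - 1))"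
    by (simp add: mult_ac)
  also have "\<dots> \<le> C * K * Psi V \<theta> x r powr q * (K * (Psi V \<theta> x r * vol x r) powr q)"
    using C K by (intro mult_left_mono mass(5)[OF r]) auto
  also have "\<dots> = C * K\<^sup>2 * (Psi V (2 * \<theta>) x r * vol x r) powr q"
    using Psi1[OF r, of x] vol_pos[OF r, of x]
    unfolding Psi_double by (simp add: powr_mult power2_eq_square mult_ac del: measure_completion)
  finally show "\<exists>X Y. X \<ge> 0 \<and> Y \<ge> 0 \<and> (\<integral>\<^sup>+y\<in>ball x r. ennreal (w y * v y) \<partial>lebesgue) \<le> ennreal X \<and>
      (\<integral>\<^sup>+y\<in>ball x r. ennreal ((w y * v y) powr (- 1 / (q - 1))) \<partial>lebesgue) \<le> ennreal Y \<and>
      X * Y powr (q - 1) \<le> C * K\<^sup>2 * (Psi V (2 * \<theta>) x r * measure lebesgue (ball x r)) powr q"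
    using Z Y mass(3)[OF r, of x] by (intro exI[of _ Z] exI[of _ ?Y]) auto
qed (use \<theta> in auto)

lemma nn_integral_neg_power_le:
  assumes r: "r > 0" and "b > 0" "Z > 0"
    and Z: "AE y in lebesgue. y \<in> ball x r \<longrightarrow> Z \<le> C * majorant x r * v y"
  shows "(\<integral>\<^sup>+y\<in>ball x r. ennreal (w y * v y powr (- b)) \<partial>lebesgue)
    \<le> ennreal ((C * majorant x r / Z) powr b * mass x r)"
proof -
  define L where "L = C * majorant x r / Z"
  have L: "L > 0" using C majorant_pos[OF r, of x] \<open>Z > 0\<close> by (simp add: L_def)
  have "(\<integral>\<^sup>+y\<in>ball x r. ennreal (w y * v y powr (- b)) \<partial>lebesgue)
      \<le> (\<integral>\<^sup>+y. ennreal (L powr b) * (ennreal (w y) * indicator (ball x r) y) \<partial>lebesgue)"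
  proof (rule nn_integral_mono_AE, use Z in eventually_elim)
    case (elim y)
    show ?case
    proof (cases "y \<in> ball x r")
      case True
      with elim have "Z \<le> C * majorant x r * v y" by simp
      then have "inverse (v y) \<le> L"
        using \<open>Z > 0\<close> v_pos[of y] by (simp add: L_def field_simps)
      then have "inverse (v y) powr b \<le> L powr b"
        using \<open>b > 0\<close> v_pos[of y] by (intro powr_mono2) auto
      moreover have "inverse (v y) powr b = v y powr (- b)"
        using v_pos[of y] by (simp add: powr_minus inverse_powr)
      ultimately have "w y * v y powr (- b) \<le> L powr b * w y"
        using w_pos[of y] by (simp add: mult.commute)
      from ennreal_leI[OF this] show ?thesis using True w_pos[of y] by (simp add: ennreal_mult)
    next
      case False
      then show ?thesis by simp
    qed
  qed
  also have "\<dots> = ennreal (L powr b * mass x r)"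
    using mass[OF r, of x] by (simp add: nn_integral_cmult ennreal_mult)
  finally show ?thesis by (simp add: L_def)
qed

lemma weight_neg_power:
  assumes "b > 0"
  shows "weight (\<lambda>x. w x * v x powr (- b))"
  unfolding weight_def
proof (intro conjI allI locally_Lebesgue_integrableI)
  show "(\<integral>\<^sup>+y\<in>ball 0 r. ennreal (w y * v y powr (- b)) \<partial>lebesgue) < \<infinity>" if r: "r > 0" for r
  proof -
    obtain Z where "Z > 0" "AE y in lebesgue. y \<in> ball 0 r \<longrightarrow> Z \<le> C * majorant 0 r * v y"
      using A1[OF r, of 0] by blast
    from nn_integral_neg_power_le[OF r assms this] show ?thesis
      by (rule order.strict_trans1) simp
  qed
qed (use w_pos v_pos in \<open>auto simp: less_imp_le less_imp_neq[THEN not_sym]\<close>)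

text \<open>The weight itself is bounded through \<open>1 / v \<le> C * majorant / Z\<close>, its
  dual power by Hoelder's inequality between \<open>w * v\<close> and the dual power of
  \<open>w\<close>. The powers of \<open>Z\<close> cancel. Passing from majorant to mass gives
  \<open>K powr b\<close>, and the A_q inequality to the power \<open>b + 1\<close> gives
  \<open>K powr (b + 1)\<close>.\<close>

lemma Ap_neg_power:
  assumes b: "b > 0"
  shows "Ap_inequality V (2 * \<theta>) (q * (b + 1)) (\<lambda>x. w x * v x powr (- b)) (C powr b * K powr (2 * b + 1))"
proof (rule Ap_inequalityI[OF \<rho>_pos])
  define Q where "Q = q * (b + 1)"
  have bq: "b < q * b" using q b by simp
  have Q: "Q - 1 > b" using bq q by (simp add: Q_def algebra_simps)
  then show "q * (b + 1) > 1" using b by (simp add: Q_def)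
  fix x and r :: real assume r: "r > 0"
  obtain Z where Z: "Z > 0" "(\<integral>\<^sup>+y\<in>ball x r. ennreal (w y * v y) \<partial>lebesgue) \<le> ennreal Z"
    "AE y in lebesgue. y \<in> ball x r \<longrightarrow> Z \<le> C * majorant x r * v y"
    using A1[OF r, of x] by blast
  have maj: "majorant x r > 0" by (rule majorant_pos[OF r])
  \<comment> \<open>Forced by matching the exponent of \<open>v\<close> in the factorisation
    \<open>split\<close>; the value \<open>Q = q * (b + 1)\<close> then makes the exponents of
    \<open>w\<close> match too.\<close>
  define \<beta> where "\<beta> = b / (Q - 1)"
  have \<beta>: "0 < \<beta>" "\<beta> < 1" using b Q by (simp_all add: \<beta>_def)
  have \<beta>Q: "\<beta> * (Q - 1) = b" using Q b by (simp add: \<beta>_def)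
  have \<beta>Q': "(1 - \<beta>) * (Q - 1) = (b + 1) * (q - 1)"
    using \<beta>Q by (simp add: Q_def algebra_simps)
  define X where "X = (C * majorant x r / Z) powr b * mass x r"
  define Y where "Y = Z powr \<beta> * dual_mass x r powr (1 - \<beta>)"
  have X: "(\<integral>\<^sup>+y\<in>ball x r. ennreal (w y * v y powr (- b)) \<partial>lebesgue) \<le> ennreal X"
    unfolding X_def by (rule nn_integral_neg_power_le[OF r b Z(1,3)])
  have split: "(w y * v y powr (- b)) powr (- 1 / (Q - 1))
      = (w y * v y) powr \<beta> * (w y powr (- 1 / (q - 1))) powr (1 - \<beta>)" for y
  proof -
    have 1: "\<beta> + - 1 / (q - 1) * (1 - \<beta>) = - 1 / (Q - 1)"
    proof -
      have "(1 - \<beta>) = (b + 1) * (q - 1) / (Q - 1)"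
        using \<beta>Q' Q b by (simp add: field_simps)
      then have "- 1 / (q - 1) * (1 - \<beta>) = - (b + 1) / (Q - 1)"
        using q by simp
      then show ?thesis by (simp add: \<beta>_def diff_divide_distrib add_divide_distrib)
    qed
    have "(w y * v y) powr \<beta> * (w y powr (- 1 / (q - 1))) powr (1 - \<beta>)
        = (w y powr \<beta> * w y powr (- 1 / (q - 1) * (1 - \<beta>))) * v y powr \<beta>"
      using w_pos[of y] v_pos[of y] by (simp add: powr_mult powr_powr)
    also have "w y powr \<beta> * w y powr (- 1 / (q - 1) * (1 - \<beta>)) = w y powr (- 1 / (Q - 1))"
      unfolding powr_add[symmetric] 1 ..
    also have "\<dots> * v y powr \<beta> = (w y * v y powr (- b)) powr (- 1 / (Q - 1))"
      using w_pos[of y] v_pos[of y] by (simp add: powr_mult powr_powr \<beta>_def)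
    finally show ?thesis ..
  qed
  have Y: "(\<integral>\<^sup>+y\<in>ball x r. ennreal ((w y * v y powr (- b)) powr (- 1 / (Q - 1))) \<partial>lebesgue) \<le> ennreal Y"
    unfolding split Y_def using \<beta> Z(1,2) w_pos v_pos mass[OF r, of x]
    by (intro nn_integral_Hoelder) (auto simp: less_imp_le)
  let ?P = "Psi V \<theta> x r"
  have XY: "X * Y powr (Q - 1) = (C * majorant x r) powr b * mass x r * (dual_mass x r powr (q - 1)) powr (b + 1)"
  proof -
    have "Y powr (Q - 1) = Z powr b * dual_mass x r powr ((b + 1) * (q - 1))"
      using Z(1) mass(3)[OF r, of x] unfolding Y_def by (simp add: powr_mult powr_powr \<beta>Q \<beta>Q')
    then show ?thesis
      using Z(1) C maj unfolding X_def by (simp add: powr_divide powr_powr mult.commute)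
  qed
  also have "\<dots> \<le> (C * (K * ?P powr q * mass x r)) powr b * mass x r * (dual_mass x r powr (q - 1)) powr (b + 1)"
    using C b maj majorant_le[OF r, of x] mass(1)[OF r, of x]
    by (intro mult_right_mono powr_mono2 mult_left_mono) auto
  also have "\<dots> = C powr b * K powr b * ?P powr (q * b) * (mass x r * dual_mass x r powr (q - 1)) powr (b + 1)"
    using C K mass(1,3)[OF r, of x] by (simp add: powr_mult powr_powr powr_add)
  also have "\<dots> \<le> C powr b * K powr b * ?P powr (q * b) * (K * (?P * vol x r) powr q) powr (b + 1)"
    using C K b mass(1,3,5)[OF r, of x] by (intro mult_left_mono powr_mono2) auto
  also have "\<dots> = C powr b * K powr (2 * b + 1) * (?P powr (q * b) * (?P * vol x r) powr Q)"
  proof -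
    have "K powr (2 * b + 1) = K powr b * K powr (b + 1)"
      by (simp flip: powr_add)
    then show ?thesis
      using K by (simp add: powr_mult powr_powr Q_def)
  qed
  \<comment> \<open>Since \<open>Psi \<ge> 1\<close>, its exponent \<open>q * b\<close> may be
    raised to \<open>Q\<close>, so that both factors merge into one with parameter
    \<open>2 * \<theta>\<close>.\<close>
  also have "\<dots> \<le> C powr b * K powr (2 * b + 1) * (?P powr Q * (?P * vol x r) powr Q)"
    using Psi1[OF r, of x] q b
    by (intro mult_left_mono mult_right_mono powr_mono) (auto simp: Q_def)
  also have "?P powr Q * (?P * vol x r) powr Q = (Psi V (2 * \<theta>) x r * vol x r) powr Q"
    unfolding Psi_double using Psi1[OF r, of x] vol_pos[OF r, of x]
    by (simp add: powr_mult power2_eq_square mult_ac del: measure_completion)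
  finally have "X * Y powr (Q - 1) \<le> C powr b * K powr (2 * b + 1) * (Psi V (2 * \<theta>) x r * vol x r) powr Q" .
  moreover have "X \<ge> 0" "Y \<ge> 0"
    using mass(1)[OF r, of x] by (simp_all add: X_def Y_def)
  ultimately show "\<exists>X Y. X \<ge> 0 \<and> Y \<ge> 0 \<and> (\<integral>\<^sup>+y\<in>ball x r. ennreal (w y * v y powr (- b)) \<partial>lebesgue) \<le> ennreal X \<and>
      (\<integral>\<^sup>+y\<in>ball x r. ennreal ((w y * v y powr (- b)) powr (- 1 / (q * (b + 1) - 1))) \<partial>lebesgue) \<le> ennreal Y \<and>
      X * Y powr (q * (b + 1) - 1) \<le> C powr b * K powr (2 * b + 1) * (Psi V (2 * \<theta>) x r * measure lebesgue (ball x r)) powr (q * (b + 1))"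
    using X Y unfolding Q_def by blast
qed (use \<theta> in auto)

end

section \<open>The multiplier of Coifman and Rochberg\<close>

context Ap_weight
begin

text \<open>The Coifman--Rochberg multiplier, set to \<open>1\<close> on the null set where \<open>maxf h\<close> is infinite.\<close>

definition CR :: "real \<Rightarrow> (real ^ 'n \<Rightarrow> ennreal) \<Rightarrow> real ^ 'n \<Rightarrow> real" where
  "CR \<delta> h x = (if maxf h x = \<infinity> then 1 else enn2real (maxf h x) powr \<delta>)"

lemma null_wmeasure: "(AE x in wmeasure. P x) \<longleftrightarrow> (AE x in lebesgue. P x)"
  using w_pos by (subst AE_density) (auto simp: less_imp_neq[THEN not_sym] not_le)

text \<open>The number \<open>Z\<close> is the weighted integral itself: \<open>maxf_A1\<close>
  compares it with the multiplier at every point where \<open>maxf h\<close> is finite, that is,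
  almost everywhere.\<close>

lemma A1_multiplier_CR:
  assumes h [measurable]: "h \<in> borel_measurable lebesgue" and \<delta>: "0 < \<delta>" "\<delta> < 1"
    and pos: "(\<integral>\<^sup>+x. h x \<partial>wmeasure) > 0" and fin: "AE x in lebesgue. maxf h x \<noteq> \<infinity>"
  shows "A1_multiplier V w \<theta> q K (CR \<delta> h) (A1_const \<delta>)"
proof
  have [measurable]: "h \<in> borel_measurable wmeasure" by simp
  have meas [measurable]: "maxf h \<in> borel_measurable lebesgue"
    using measurable_maxf[of h] by simp
  show "CR \<delta> h \<in> borel_measurable lebesgue"
    unfolding CR_def by measurable
  have k_pos: "maxf h x > 0" for x
    by (rule maxf_pos) (use pos in auto)
  show CR_pos: "CR \<delta> h x > 0" for x
    using k_pos[of x] by (cases "maxf h x") (auto simp: CR_def)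
  have "2 powr (\<delta> - 1) < (1::real)" using \<delta> by (simp add: powr_less_one)
  then show C: "A1_const \<delta> > 0"
    unfolding A1_const_def by (intro add_nonneg_pos mult_nonneg_nonneg add_nonneg_nonneg divide_nonneg_nonneg) auto
  fix x and r :: real assume r: "r > 0"
  have CR_eq: "ennreal_powr (maxf h y) \<delta> = ennreal (CR \<delta> h y)" if "maxf h y \<noteq> \<infinity>" for y
    using that by (simp add: CR_def ennreal_powr_def)
  have int_eq: "(\<integral>\<^sup>+y\<in>ball x r. ennreal (w y * CR \<delta> h y) \<partial>lebesgue)
      = (\<integral>\<^sup>+y\<in>ball x r. ennreal_powr (maxf h y) \<delta> \<partial>wmeasure)"
  proof -
    have "(\<integral>\<^sup>+y\<in>ball x r. ennreal_powr (maxf h y) \<delta> \<partial>wmeasure)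
       = (\<integral>\<^sup>+y. ennreal (w y) * (ennreal_powr (maxf h y) \<delta> * indicator (ball x r) y) \<partial>lebesgue)"
      by (rule nn_integral_density) auto
    also have "\<dots> = (\<integral>\<^sup>+y\<in>ball x r. ennreal (w y * CR \<delta> h y) \<partial>lebesgue)"
    proof (rule nn_integral_cong_AE, use fin in eventually_elim)
      case (elim y)
      then show ?case
        using w_pos[of y] CR_pos[of y] by (simp add: CR_eq ennreal_mult mult.assoc)
    qed
    finally show ?thesis ..
  qed
  have A1: "(\<integral>\<^sup>+y\<in>ball x r. ennreal (w y * CR \<delta> h y) \<partial>lebesgue) \<le> ennreal (A1_const \<delta> * majorant x r * CR \<delta> h u)"
    if u: "u \<in> ball x r" "maxf h u \<noteq> \<infinity>" for u
  proof -
    obtain Y where Y: "maxf h u = ennreal Y" "Y > 0"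
      using u k_pos[of u] by (cases "maxf h u") auto
    from maxf_A1[OF _ \<delta> r u(1) this] show ?thesis
      unfolding int_eq using Y by (simp add: CR_def)
  qed
  let ?Z = "\<integral>\<^sup>+y\<in>ball x r. ennreal (w y * CR \<delta> h y) \<partial>lebesgue"
  have "?Z > 0"
    by (rule nn_integral_ball_pos) (use w_pos CR_pos r in \<open>auto simp: CR_def\<close>)
  \<comment> \<open>One such point in the ball is enough to make the integral finite.\<close>
  have "\<exists>u\<in>ball x r. maxf h u \<noteq> \<infinity>"
  proof (rule ccontr)
    assume "\<not> ?thesis"
    then have "AE u in lebesgue. u \<notin> ball x r"
      using fin by (auto elim!: eventually_mono)
    then have "emeasure lebesgue (ball x r) = 0"
      by (subst (asm) AE_iff_measurable[of "ball x r"]) auto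
    then show False
      using vol_pos[OF r, of x] by (simp add: measure_def)
  qed
  then obtain u where "?Z \<le> ennreal (A1_const \<delta> * majorant x r * CR \<delta> h u)"
    using A1 by blast
  then obtain Z where Z: "?Z = ennreal Z" "Z > 0"
    using \<open>?Z > 0\<close> by (cases ?Z) (auto simp: top_unique)
  have "AE y in lebesgue. y \<in> ball x r \<longrightarrow> Z \<le> A1_const \<delta> * majorant x r * CR \<delta> h y"
    using fin
  proof eventually_elim
    case (elim y)
    then show ?case
      using A1[of y] C majorant_pos[OF r, of x] CR_pos[of y] Z by (auto simp: ennreal_le_iff)
  qed
  then show "\<exists>Z>0. (\<integral>\<^sup>+y\<in>ball x r. ennreal (w y * CR \<delta> h y) \<partial>lebesgue) \<le> ennreal Z \<and>
      (AE y in lebesgue. y \<in> ball x r \<longrightarrow> Z \<le> A1_const \<delta> * majorant x r * CR \<delta> h y)"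
    using Z by (intro exI[of _ Z]) auto
qed

end

section \<open>Extrapolation\<close>

text \<open>Allowing every positive upper bound \<open>G\<close> for the norm of \<open>g\<close>
  also covers norm zero; the slack \<open>e / C\<close> is removed at the end.\<close>

lemma weak_Lp_norm_le_multI:
  assumes p: "p > 0" and C: "C > 0"
    and le: "\<And>G s. G > 0 \<Longrightarrow> weak_Lp_norm p w g \<le> ennreal G \<Longrightarrow> s > 0 \<Longrightarrow>
      emeasure (density lebesgue (\<lambda>x. ennreal (w x))) {x. f x > ennreal s} \<le> ennreal ((C * G / s) powr p)"
  shows "weak_Lp_norm p w f \<le> ennreal C * weak_Lp_norm p w g"
proof (cases "weak_Lp_norm p w g")
  case (real G)
  have "weak_Lp_norm p w f \<le> ennreal (C * G) + ennreal e" if "e > 0" for e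
  proof -
    have "weak_Lp_norm p w f \<le> ennreal (C * (G + e / C))"
    proof (subst weak_Lp_norm_le_iff)
      show "\<forall>s>0. emeasure (density lebesgue (\<lambda>x. ennreal (w x))) {x. f x > ennreal s}
          \<le> ennreal ((C * (G + e / C) / s) powr p)"
        using real C that by (intro allI impI le) (auto intro!: ennreal_leI add_nonneg_pos)
    qed (use real C p that in auto)
    also have "C * (G + e / C) = C * G + e" using C by (simp add: field_simps)
    finally show ?thesis using real C that by simp
  qed
  then have "weak_Lp_norm p w f \<le> ennreal (C * G)"
    by (rule ennreal_le_epsilon)
  then show ?thesis using real C by (simp add: ennreal_mult)
next
  case top
  then show ?thesis using C by (simp add: ennreal_mult_top)
qed

section \<open>Raising and lowering the exponent for a fixed weight\<close>

context Ap_weight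
begin

lemma superlevel_sets [measurable]:
  fixes f :: "real ^ 'n \<Rightarrow> ennreal"
  assumes [measurable]: "f \<in> borel_measurable lebesgue"
  shows "{x. f x > c} \<in> sets lebesgue"
proof -
  have "{x \<in> space lebesgue. f x > c} \<in> sets lebesgue" by measurable
  then show ?thesis by simp
qed

lemma emeasure_density_mult:
  fixes u :: "real ^ 'n \<Rightarrow> real"
  assumes [measurable]: "u \<in> borel_measurable lebesgue" "S \<in> sets lebesgue" and "\<And>x. u x \<ge> 0"
  shows "emeasure (density lebesgue (\<lambda>x. ennreal (w x * u x))) S = (\<integral>\<^sup>+x\<in>S. ennreal (u x) \<partial>wmeasure)"
proof -
  have "(\<integral>\<^sup>+x\<in>S. ennreal (u x) \<partial>wmeasure) = (\<integral>\<^sup>+x. ennreal (w x) * (ennreal (u x) * indicator S x) \<partial>lebesgue)"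
    by (rule nn_integral_density) auto
  also have "\<dots> = (\<integral>\<^sup>+x\<in>S. ennreal (w x * u x) \<partial>lebesgue)"
    using w_pos assms(3) by (intro nn_integral_cong) (simp add: ennreal_mult less_imp_le mult.assoc)
  finally show ?thesis by (simp add: emeasure_density)
qed

lemma nn_integral_wmeasure_cmult_indicator:
  assumes [measurable]: "S \<in> sets lebesgue"
  shows "(\<integral>\<^sup>+x. c * indicator S x \<partial>wmeasure) = c * emeasure wmeasure S"
  by (rule nn_integral_cmult_indicator) simp

text \<open>Kolmogorov's constant times the power \<delta> of the weak-type constant of
  \<open>maxf\<close>.\<close>

definition Kolmogorov_const :: "real \<Rightarrow> real" where
  "Kolmogorov_const \<delta> = (1 + 2 powr \<delta> / (1 - 2 powr (\<delta> - 1))) * (5 powr dexp + 1) powr \<delta>"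

lemma Kolmogorov_const_pos:
  assumes "0 < \<delta>" "\<delta> < 1"
  shows "Kolmogorov_const \<delta> > 0"
proof -
  have "2 powr (\<delta> - 1) < (1::real)" using assms by (simp add: powr_less_one)
  then have "1 + 2 powr \<delta> / (1 - 2 powr (\<delta> - 1)) > 0"
    by (intro add_pos_nonneg) auto
  moreover have "(5::real) powr dexp + 1 > 0" by (simp add: add_nonneg_pos)
  ultimately show ?thesis unfolding Kolmogorov_const_def by simp
qed

text \<open>Put \<open>e = w(E)\<close> and \<open>u = w * CR \<delta> h\<close>. Kolmogorov's
  inequality gives \<open>u(S) \<le> B * w(S) powr (1 - \<delta>) * e powr \<delta>\<close>, and
  \<open>p * (1 - \<delta>) = p\<^sub>0\<close> turns weak \<open>L\<^sup>p\<close> bounds for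
  \<open>w\<close> into weak bounds with exponent \<open>p\<^sub>0\<close> for \<open>u\<close>: for
  \<open>f\<close> to obtain finiteness, for \<open>g\<close> to obtain the estimate. As
  \<open>e \<le> u(E)\<close>, the factor \<open>e powr \<delta>\<close> can be absorbed.\<close>

lemma weak_type_larger_exponent:
  fixes f g :: "real ^ 'n \<Rightarrow> ennreal"
  assumes p: "0 < p\<^sub>0" "p\<^sub>0 < p" and [measurable]: "f \<in> borel_measurable lebesgue" "g \<in> borel_measurable lebesgue"
    and C: "C > 0"
    and hyp: "\<And>u. u \<in> A_infty V \<Longrightarrow> Ap_constant V (2 * \<theta>) q u \<le> ennreal (A1_const (1 - p\<^sub>0 / p) * K\<^sup>2) \<Longrightarrow>
      weak_Lp_norm p\<^sub>0 u f < \<infinity> \<Longrightarrow> weak_Lp_norm p\<^sub>0 u f \<le> ennreal C * weak_Lp_norm p\<^sub>0 u g"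
    and fin: "weak_Lp_norm p w f < \<infinity>"
  shows "weak_Lp_norm p w f \<le> ennreal (C * Kolmogorov_const (1 - p\<^sub>0 / p) powr (1 / p\<^sub>0)) * weak_Lp_norm p w g"
proof (rule weak_Lp_norm_le_multI)
  define \<delta> where "\<delta> = 1 - p\<^sub>0 / p"
  have \<delta>: "0 < \<delta>" "\<delta> < 1" and p\<delta>: "p * (1 - \<delta>) = p\<^sub>0"
    using p by (simp_all add: \<delta>_def field_simps)
  let ?B = "Kolmogorov_const \<delta>"
  have B: "?B > 0" by (rule Kolmogorov_const_pos[OF \<delta>])
  show "p > 0" using p by simp
  show "C * Kolmogorov_const (1 - p\<^sub>0 / p) powr (1 / p\<^sub>0) > 0"
    using C B by (simp add: \<delta>_def)
  fix G s :: real assume G: "G > 0" "weak_Lp_norm p w g \<le> ennreal G" and s: "s > 0"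
  \<comment> \<open>\<open>F + 1\<close> keeps the bound positive when the norm is zero.
    \<open>F\<close> serves for finiteness only and does not enter the constant.\<close>
  obtain F where F: "F > 0" "weak_Lp_norm p w f \<le> ennreal F"
  proof -
    obtain F where "F \<ge> 0" "weak_Lp_norm p w f = ennreal F"
      using fin by (cases "weak_Lp_norm p w f") auto
    then show ?thesis by (intro that[of "F + 1"]) (auto intro: ennreal_leI)
  qed
  have wf: "emeasure wmeasure {x. f x > ennreal m} \<le> ennreal ((F / m) powr p)" if "m > 0" for m
    using F p that weak_Lp_norm_le_iff[of p F w f] by auto
  have wg: "emeasure wmeasure {x. g x > ennreal m} \<le> ennreal ((G / m) powr p)" if "m > 0" for m
    using G p that weak_Lp_norm_le_iff[of p G w g] by auto
  define E where "E = {x. f x > ennreal s}"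
  have [measurable]: "E \<in> sets lebesgue" unfolding E_def by measurable
  obtain e where e: "e \<ge> 0" "emeasure wmeasure E = ennreal e"
    using wf[OF s] by (cases "emeasure wmeasure E") (auto simp: E_def top_unique)
  show "emeasure wmeasure {x. f x > ennreal s} \<le> ennreal ((C * Kolmogorov_const (1 - p\<^sub>0 / p) powr (1 / p\<^sub>0) * G / s) powr p)"
  proof (cases "e = 0")
    case True
    then show ?thesis using e by (simp add: E_def)
  next
    case False
    then have e0: "e > 0" using e by simp
    define h :: "real ^ 'n \<Rightarrow> ennreal" where "h = indicator E"
    have h_meas [measurable]: "h \<in> borel_measurable lebesgue" unfolding h_def by measurable
    have h_int: "(\<integral>\<^sup>+x. h x \<partial>wmeasure) = ennreal e"
      unfolding h_def using e by (subst nn_integral_indicator) auto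
    let ?A = "(5 powr dexp + 1) * e"
    have A: "?A > 0" using e0 by (simp add: add_nonneg_pos)
    have weak: "emeasure wmeasure {x \<in> space wmeasure. maxf h x > ennreal t} \<le> ennreal (?A / t)" if "t > 0" for t
    proof -
      have "emeasure wmeasure {x. maxf h x > ennreal t} \<le> ennreal ((5 powr dexp + 1) / t) * ennreal e"
        using weak_type_maxf[of h t] that by (simp add: h_int)
      also have "\<dots> = ennreal (?A / t)"
        using e that by (simp flip: ennreal_mult)
      finally show ?thesis by simp
    qed
    have maxf_meas [measurable]: "maxf h \<in> borel_measurable lebesgue"
      using measurable_maxf[of h] by simp
    have fin_AE: "AE x in lebesgue. maxf h x \<noteq> \<infinity>"
      using weak_type_imp_AE_finite[of "maxf h" wmeasure 1 ?A] weak
      by (simp add: null_wmeasure powr_minus divide_inverse)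
    interpret M: A1_multiplier V w \<theta> q K "CR \<delta> h" "A1_const \<delta>"
      by (rule A1_multiplier_CR[OF h_meas \<delta> _ fin_AE]) (use e0 in \<open>simp add: h_int\<close>)
    define u where "u x = w x * CR \<delta> h x" for x
    have "A1_const \<delta> * K\<^sup>2 > 0" using M.C K by simp
    from A_infty_if[OF M.weight_mult _ q this M.Ap_mult] \<theta>
    have u: "u \<in> A_infty V" "Ap_constant V (2 * \<theta>) q u \<le> ennreal (A1_const \<delta> * K\<^sup>2)"
      by (simp_all add: u_def[abs_def])
    have u_eq: "emeasure (density lebesgue (\<lambda>x. ennreal (u x))) S = (\<integral>\<^sup>+x\<in>S. ennreal (CR \<delta> h x) \<partial>wmeasure)"
      if "S \<in> sets lebesgue" for S
      unfolding u_def using that by (intro emeasure_density_mult) (auto intro: less_imp_le M.v_pos)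
    have u_le: "emeasure (density lebesgue (\<lambda>x. ennreal (u x))) S \<le> ennreal (?B * b powr (1 - \<delta>) * e powr \<delta>)"
      if S: "S \<in> sets lebesgue" and b: "b > 0" "emeasure wmeasure S \<le> ennreal b" for S b
    proof -
      have "(\<integral>\<^sup>+x\<in>S. ennreal (CR \<delta> h x) \<partial>wmeasure) = (\<integral>\<^sup>+x\<in>S. ennreal_powr (maxf h x) \<delta> \<partial>wmeasure)"
        using fin_AE[folded null_wmeasure]
        by (intro nn_integral_cong_AE) (auto elim!: eventually_mono simp: CR_def ennreal_powr_def)
      also have "\<dots> \<le> ennreal ((1 + 2 powr \<delta> / (1 - 2 powr (\<delta> - 1))) * (b powr (1 - \<delta>) * ?A powr \<delta>))"
        using S b \<delta> A weak by (intro Kolmogorov_inequality) auto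
      also have "(1 + 2 powr \<delta> / (1 - 2 powr (\<delta> - 1))) * (b powr (1 - \<delta>) * ?A powr \<delta>) = ?B * b powr (1 - \<delta>) * e powr \<delta>"
        using e0 by (simp add: Kolmogorov_const_def powr_mult mult_ac)
      finally show ?thesis using S by (simp add: u_eq)
    qed
    \<comment> \<open>The factor gained by a weak-type bound on passing from \<open>w\<close> with
      exponent \<open>p\<close> to \<open>u\<close> with exponent \<open>p\<^sub>0\<close>.\<close>
    define L where "L = (?B * e powr \<delta>) powr (1 / p\<^sub>0)"
    have L: "L > 0" "L powr p\<^sub>0 = ?B * e powr \<delta>"
      using B e0 p by (simp_all add: L_def powr_powr)
    have norm_le: "weak_Lp_norm p\<^sub>0 u k \<le> ennreal (L * H)"
      if [measurable]: "k \<in> borel_measurable lebesgue" and H: "H > 0"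
        and k: "\<And>m. m > 0 \<Longrightarrow> emeasure wmeasure {x. k x > ennreal m} \<le> ennreal ((H / m) powr p)" for k H
    proof (subst weak_Lp_norm_le_iff[OF p(1)])
      show "\<forall>m>0. emeasure (density lebesgue (\<lambda>x. ennreal (u x))) {x. k x > ennreal m} \<le> ennreal ((L * H / m) powr p\<^sub>0)"
      proof (intro allI impI)
        fix m :: real assume m: "m > 0"
        have "emeasure (density lebesgue (\<lambda>x. ennreal (u x))) {x. k x > ennreal m}
            \<le> ennreal (?B * ((H / m) powr p) powr (1 - \<delta>) * e powr \<delta>)"
          using H m by (intro u_le k) auto
        also have "?B * ((H / m) powr p) powr (1 - \<delta>) * e powr \<delta> = (L * (H / m)) powr p\<^sub>0"
          using L H m by (subst powr_mult) (auto simp: powr_powr p\<delta> mult_ac)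
        finally show "emeasure (density lebesgue (\<lambda>x. ennreal (u x))) {x. k x > ennreal m}
            \<le> ennreal ((L * H / m) powr p\<^sub>0)" by simp
      qed
    qed (use L H in auto)
    have "weak_Lp_norm p\<^sub>0 u f < \<infinity>"
      using norm_le[OF _ F(1) wf] by (auto intro: order.strict_trans1)
    then have "weak_Lp_norm p\<^sub>0 u f \<le> ennreal C * weak_Lp_norm p\<^sub>0 u g"
      by (rule hyp[OF u[unfolded \<delta>_def]])
    also have "\<dots> \<le> ennreal C * ennreal (L * G)"
      by (intro mult_left_mono norm_le G wg) auto
    also have "\<dots> = ennreal (C * (L * G))" using C L G by (simp add: ennreal_mult)
    finally have "emeasure (density lebesgue (\<lambda>x. ennreal (u x))) E \<le> ennreal ((C * (L * G) / s) powr p\<^sub>0)"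
      using s C L G p by (subst (asm) weak_Lp_norm_le_iff) (auto simp: E_def)
    moreover have "ennreal e \<le> emeasure (density lebesgue (\<lambda>x. ennreal (u x))) E"
    proof -
      have "ennreal e = (\<integral>\<^sup>+x. h x \<partial>wmeasure)" by (rule h_int[symmetric])
      also have "\<dots> \<le> (\<integral>\<^sup>+x\<in>E. ennreal (CR \<delta> h x) \<partial>wmeasure)"
      proof (rule nn_integral_mono)
        fix x
        have "CR \<delta> h x \<ge> 1" if "x \<in> E"
        proof (cases "maxf h x")
          case (real k)
          with le_maxf[of h x] that have "k \<ge> 1" by (simp add: h_def)
          then show ?thesis using real \<delta> by (simp add: CR_def ge_one_powr_ge_zero)
        qed (simp add: CR_def)
        then show "h x \<le> ennreal (CR \<delta> h x) * indicator E x"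
          by (auto simp: h_def split: split_indicator)
      qed
      finally show ?thesis by (simp add: u_eq)
    qed
    ultimately have "ennreal e \<le> ennreal ((C * (L * G) / s) powr p\<^sub>0)" by (rule order.trans[rotated])
    then have "e \<le> (L * (C * G / s)) powr p\<^sub>0" by (simp add: mult_ac)
    also have "\<dots> = ?B * (C * G / s) powr p\<^sub>0 * e powr \<delta>"
      using L C G s by (subst powr_mult) (auto simp: mult_ac)
    \<comment> \<open>Absorption is legitimate because \<open>e\<close> is finite and positive; the
      power \<open>p / p\<^sub>0\<close> then restores \<open>e\<close>, since
      \<open>(1 - \<delta>) * (p / p\<^sub>0) = 1\<close>.\<close>
    finally have "e / e powr \<delta> \<le> ?B * (C * G / s) powr p\<^sub>0"
      using e0 by (simp add: field_simps)
    then have "e powr (1 - \<delta>) \<le> ?B * (C * G / s) powr p\<^sub>0"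
      using e0 by (simp add: powr_diff)
    then have "(e powr (1 - \<delta>)) powr (p / p\<^sub>0) \<le> (?B * (C * G / s) powr p\<^sub>0) powr (p / p\<^sub>0)"
      using p by (intro powr_mono2) auto
    moreover have "(e powr (1 - \<delta>)) powr (p / p\<^sub>0) = e"
    proof -
      have 1: "(1 - \<delta>) * (p / p\<^sub>0) = 1" using p by (simp add: \<delta>_def)
      show ?thesis unfolding powr_powr 1 using e0 by simp
    qed
    moreover have "(?B * (C * G / s) powr p\<^sub>0) powr (p / p\<^sub>0) = (C * ?B powr (1 / p\<^sub>0) * G / s) powr p"
      using B C G s p by (simp add: powr_mult powr_powr powr_divide)
    ultimately have "e \<le> (C * ?B powr (1 / p\<^sub>0) * G / s) powr p"
      by simp
    then show ?thesis
      using e by (simp add: E_def[symmetric] \<delta>_def ennreal_leI)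
  qed
qed

text \<open>With \<open>u = w * v powr (- b)\<close> and \<open>v\<close> the square root of
  \<open>maxf h\<close>, \<open>u\<close> is at most \<open>m powr (- a) * w\<close> on
  \<open>{g > m}\<close>; hence \<open>u({g > m}) \<le> m powr (- a) * (G / m) powr p\<close>, a
  weak bound with exponent \<open>p\<^sub>0 = p + a\<close>. Conversely
  \<open>maxf h \<le> T\<close> on at least half of \<open>E\<close>, which bounds
  \<open>u(E)\<close> below by \<open>T powr (- b / 2) * (e / 2)\<close>.\<close>

lemma weak_type_smaller_exponent:
  fixes f g :: "real ^ 'n \<Rightarrow> ennreal"
  assumes p: "0 < p" "p < p\<^sub>0" and [measurable]: "f \<in> borel_measurable lebesgue" "g \<in> borel_measurable lebesgue"
    and C: "C > 0"
    and hyp: "\<And>u. u \<in> A_infty V \<Longrightarrow> Ap_constant V (2 * \<theta>) (q * (4 * (p\<^sub>0 - p) / p + 1)) u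
        \<le> ennreal (A1_const (1 / 2) powr (4 * (p\<^sub>0 - p) / p) * K powr (2 * (4 * (p\<^sub>0 - p) / p) + 1)) \<Longrightarrow>
      weak_Lp_norm p\<^sub>0 u f < \<infinity> \<Longrightarrow> weak_Lp_norm p\<^sub>0 u f \<le> ennreal C * weak_Lp_norm p\<^sub>0 u g"
    and fin: "weak_Lp_norm p w f < \<infinity>"
  shows "weak_Lp_norm p w f
    \<le> ennreal (C * (2 * (64 * (5 powr dexp + 1)) powr ((p\<^sub>0 - p) / p)) powr (1 / p\<^sub>0)) * weak_Lp_norm p w g"
proof (rule weak_Lp_norm_le_multI)
  define a where "a = p\<^sub>0 - p"
  \<comment> \<open>Chosen so that \<open>(p / 2) * (1 / 2) * b = a\<close>, where
    \<open>p / 2\<close> is the power in \<open>h\<close> and \<open>1 / 2\<close> the one in the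
    multiplier.\<close>
  define b where "b = 4 * a / p"
  \<comment> \<open>The constant 16 of \<open>weak_type_maxf_2\<close>, doubled because
    \<open>h\<close> is a maximum of two functions.\<close>
  define M where "M = 32 * ((5::real) powr dexp + 1)"
  have a: "a > 0" and b: "b > 0" using p by (simp_all add: a_def b_def)
  have M: "M > 0" by (simp add: M_def add_nonneg_pos)
  let ?B = "2 * (2 * M) powr (a / p)"
  have B: "?B > 0" using M by simp
  have B_eq: "2 * (64 * (5 powr dexp + 1)) powr ((p\<^sub>0 - p) / p) = ?B"
    by (simp add: M_def a_def)
  show "p > 0" using p by simp
  show "C * (2 * (64 * (5 powr dexp + 1)) powr ((p\<^sub>0 - p) / p)) powr (1 / p\<^sub>0) > 0"
    unfolding B_eq using C B by simp
  fix G s :: real assume G: "G > 0" "weak_Lp_norm p w g \<le> ennreal G" and s: "s > 0"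
  obtain F where F: "F > 0" "weak_Lp_norm p w f \<le> ennreal F"
  proof -
    obtain F where "F \<ge> 0" "weak_Lp_norm p w f = ennreal F"
      using fin by (cases "weak_Lp_norm p w f") auto
    then show ?thesis by (intro that[of "F + 1"]) (auto intro: ennreal_leI)
  qed
  have wf: "emeasure wmeasure {x. f x > ennreal m} \<le> ennreal ((F / m) powr p)" if "m > 0" for m
    using F p that weak_Lp_norm_le_iff[of p F w f] by auto
  have wg: "emeasure wmeasure {x. g x > ennreal m} \<le> ennreal ((G / m) powr p)" if "m > 0" for m
    using G p that weak_Lp_norm_le_iff[of p G w g] by auto
  define E where "E = {x. f x > ennreal s}"
  have [measurable]: "E \<in> sets lebesgue" unfolding E_def by measurable
  obtain e where e: "e \<ge> 0" "emeasure wmeasure E = ennreal e"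
    using wf[OF s] by (cases "emeasure wmeasure E") (auto simp: E_def top_unique)
  show "emeasure wmeasure {x. f x > ennreal s}
      \<le> ennreal ((C * (2 * (64 * (5 powr dexp + 1)) powr ((p\<^sub>0 - p) / p)) powr (1 / p\<^sub>0) * G / s) powr p)"
    unfolding B_eq
  proof (cases "e = 0")
    case True
    then show "emeasure wmeasure {x. f x > ennreal s} \<le> ennreal ((C * ?B powr (1 / p\<^sub>0) * G / s) powr p)"
      using e by (simp add: E_def)
  next
    case False
    then have e0: "e > 0" using e by simp
    define \<epsilon> where "\<epsilon> = G / F"
    have \<epsilon>: "\<epsilon> > 0" using F G by (simp add: \<epsilon>_def)
    text \<open>Including \<open>\<epsilon> f\<close> makes the left-hand side for the new weight finite, as the hypothesis demands;
      by the choice of \<open>\<epsilon>\<close> it costs no more than \<open>g\<close> itself.\<close>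
    define h where "h x = ennreal_powr (max (g x) (ennreal \<epsilon> * f x)) (p / 2)" for x
    have h_meas [measurable]: "h \<in> borel_measurable lebesgue" unfolding h_def by measurable
    have h_less: "ennreal t < h x \<longleftrightarrow> ennreal (t powr (2 / p)) < g x \<or> ennreal (t powr (2 / p) / \<epsilon>) < f x"
      if "t \<ge> 0" for t x
    proof -
      have "ennreal m < ennreal \<epsilon> * f x \<longleftrightarrow> ennreal (m / \<epsilon>) < f x" if "m \<ge> 0" for m
      proof (cases "f x")
        case (real y)
        then show ?thesis using \<epsilon> that by (simp add: ennreal_less_iff divide_less_eq mult.commute flip: ennreal_mult)
      next
        case top
        then show ?thesis using \<epsilon> by (simp add: ennreal_mult_top)
      qed
      then show ?thesis
        using p that by (simp add: h_def ennreal_less_powr_iff less_max_iff_disj)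
    qed
    have sf: "{x. f x > c} \<in> sets lebesgue" and sg: "{x. g x > c} \<in> sets lebesgue" for c
      by (rule superlevel_sets, rule assms)+
    have h_weak: "emeasure wmeasure {x. h x > ennreal t} \<le> ennreal (2 * G powr p * t powr (- 2))" if t: "t > 0" for t
    proof -
      let ?\<tau> = "t powr (2 / p)"
      have \<tau>p: "?\<tau> powr p = t powr 2" using t p by (simp add: powr_powr)
      have "emeasure wmeasure {x. h x > ennreal t}
          \<le> emeasure wmeasure ({x. g x > ennreal ?\<tau>} \<union> {x. f x > ennreal (?\<tau> / \<epsilon>)})"
      proof (rule emeasure_mono)
        show "{x. h x > ennreal t} \<subseteq> {x. g x > ennreal ?\<tau>} \<union> {x. f x > ennreal (?\<tau> / \<epsilon>)}"
          unfolding h_less[OF less_imp_le[OF t]] by blast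
        show "{x. g x > ennreal ?\<tau>} \<union> {x. f x > ennreal (?\<tau> / \<epsilon>)} \<in> sets wmeasure"
          unfolding sets_density by (intro sets.Un sf sg)
      qed
      also have "\<dots> \<le> emeasure wmeasure {x. g x > ennreal ?\<tau>} + emeasure wmeasure {x. f x > ennreal (?\<tau> / \<epsilon>)}"
        by (intro emeasure_subadditive) (simp_all only: sets_density sf sg)
      also have "\<dots> \<le> ennreal ((G / ?\<tau>) powr p) + ennreal ((F / (?\<tau> / \<epsilon>)) powr p)"
        using t \<epsilon> by (intro add_mono wf wg) auto
      also have "\<dots> = ennreal (2 * G powr p * t powr (- 2))"
      proof -
        have 1: "F / (?\<tau> / \<epsilon>) = G / ?\<tau>" using F by (simp add: \<epsilon>_def)
        have 2: "(G / ?\<tau>) powr p = G powr p * t powr (- 2)"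
          unfolding powr_divide \<tau>p powr_minus_divide by simp
        show ?thesis unfolding 1 2 by (simp flip: ennreal_plus)
      qed
      finally show ?thesis .
    qed
    have maxf_meas [measurable]: "maxf h \<in> borel_measurable lebesgue"
      using measurable_maxf[of h] by simp
    have weak: "emeasure wmeasure {x. maxf h x > ennreal t} \<le> ennreal (M * G powr p * t powr (- 2))" if "t > 0" for t
    proof -
      have "emeasure wmeasure {x. maxf h x > ennreal t} \<le> ennreal (16 * (5 powr dexp + 1) * (2 * G powr p) * t powr (- 2))"
        by (rule weak_type_maxf_2[OF _ _ that h_weak]) auto
      also have "16 * (5 powr dexp + 1) * (2 * G powr p) = M * G powr p" by (simp add: M_def)
      finally show ?thesis .
    qed
    have fin_AE: "AE x in lebesgue. maxf h x \<noteq> \<infinity>"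
      using weak_type_imp_AE_finite[of "maxf h" wmeasure 2 "M * G powr p"] weak
      by (simp add: null_wmeasure)
    have h_pos: "(\<integral>\<^sup>+x. h x \<partial>wmeasure) > 0"
    proof (rule ccontr)
      assume "\<not> ?thesis"
      then have "AE x in wmeasure. h x = 0"
        by (simp add: nn_integral_0_iff_AE)
      then have "AE x in wmeasure. x \<notin> E"
      proof eventually_elim
        case (elim x)
        show ?case
        proof
          assume "x \<in> E"
          then have "ennreal 0 < f x" using s by (auto simp: E_def intro: le_less_trans)
          then have "ennreal 0 < h x" by (subst h_less) auto
          with elim show False by simp
        qed
      qed
      then have "emeasure wmeasure E = 0"
        by (subst (asm) AE_iff_measurable[of E]) auto
      with e e0 show False by simp
    qed
    interpret M: A1_multiplier V w \<theta> q K "CR (1 / 2) h" "A1_const (1 / 2)"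
      by (rule A1_multiplier_CR[OF h_meas _ _ h_pos fin_AE]) auto
    let ?v = "CR (1 / 2) h"
    define u where "u x = w x * ?v x powr (- b)" for x
    have "q * (b + 1) > 1" using q b by (simp add: less_1_mult)
    moreover have "A1_const (1 / 2) powr b * K powr (2 * b + 1) > 0" using M.C K by simp
    ultimately have u: "u \<in> A_infty V" "Ap_constant V (2 * \<theta>) (q * (b + 1)) u
        \<le> ennreal (A1_const (1 / 2) powr b * K powr (2 * b + 1))"
      using A_infty_if[OF M.weight_neg_power[OF b] _ _ _ M.Ap_neg_power[OF b]] \<theta>
      by (simp_all add: u_def[abs_def])
    have u_eq: "emeasure (density lebesgue (\<lambda>x. ennreal (u x))) S = (\<integral>\<^sup>+x\<in>S. ennreal (?v x powr (- b)) \<partial>wmeasure)"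
      if "S \<in> sets lebesgue" for S
      unfolding u_def using that by (intro emeasure_density_mult) auto
    have v_less: "ennreal t < maxf h x \<longleftrightarrow> t powr (1 / 2) < ?v x" if "maxf h x \<noteq> \<infinity>" "t \<ge> 0" for t x
      using that by (cases "maxf h x") (auto simp: CR_def ennreal_less_iff powr_half_sqrt)
    have u_le: "emeasure (density lebesgue (\<lambda>x. ennreal (u x))) S \<le> ennreal (m powr (- a)) * emeasure wmeasure S"
      if S [measurable]: "S \<in> sets lebesgue" and m: "m > 0" "\<And>x. x \<in> S \<Longrightarrow> ennreal (m powr (p / 2)) < h x" for S m
    proof -
      have "(\<integral>\<^sup>+x\<in>S. ennreal (?v x powr (- b)) \<partial>wmeasure) \<le> (\<integral>\<^sup>+x. ennreal (m powr (- a)) * indicator S x \<partial>wmeasure)"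
      proof (rule nn_integral_mono_AE, use fin_AE[folded null_wmeasure] in eventually_elim)
        case (elim x)
        have "?v x powr (- b) \<le> m powr (- a)" if "x \<in> S"
        proof -
          have "ennreal (m powr (p / 2)) < maxf h x"
            using m(2)[OF that] le_maxf[of h x] by (rule less_le_trans)
          then have "(m powr (p / 2)) powr (1 / 2) < ?v x"
            using v_less[OF elim] by simp
          then have "?v x powr (- b) \<le> ((m powr (p / 2)) powr (1 / 2)) powr (- b)"
            using b m(1) by (intro powr_mono2') auto
          also have "\<dots> = m powr (- a)" using p by (simp add: powr_powr b_def)
          finally show ?thesis .
        qed
        then show ?case by (auto intro: ennreal_leI split: split_indicator)
      qed
      also have "\<dots> = ennreal (m powr (- a)) * emeasure wmeasure S"
        by (rule nn_integral_wmeasure_cmult_indicator[OF S])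
      finally show ?thesis by (simp add: u_eq)
    qed
    have ug: "weak_Lp_norm p\<^sub>0 u g \<le> ennreal (G powr (p / p\<^sub>0))"
    proof (subst weak_Lp_norm_le_iff)
      show "\<forall>m>0. emeasure (density lebesgue (\<lambda>x. ennreal (u x))) {x. g x > ennreal m} \<le> ennreal ((G powr (p / p\<^sub>0) / m) powr p\<^sub>0)"
      proof (intro allI impI)
        fix m :: real assume m: "m > 0"
        have "emeasure (density lebesgue (\<lambda>x. ennreal (u x))) {x. g x > ennreal m} \<le> ennreal (m powr (- a)) * emeasure wmeasure {x. g x > ennreal m}"
          using m p by (intro u_le) (auto simp: h_less powr_powr)
        also have "\<dots> \<le> ennreal (m powr (- a)) * ennreal ((G / m) powr p)"
          by (intro mult_left_mono wg m) auto
        also have "\<dots> = ennreal (G powr p * (m powr (- a) * m powr (- p)))"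
          using G m by (simp add: powr_divide powr_minus field_simps flip: ennreal_mult)
        also have "m powr (- a) * m powr (- p) = m powr (- p\<^sub>0)"
          by (simp add: a_def flip: powr_add)
        also have "G powr p * m powr (- p\<^sub>0) = (G powr (p / p\<^sub>0) / m) powr p\<^sub>0"
          using G m p by (simp add: powr_divide powr_powr powr_minus field_simps)
        finally show "emeasure (density lebesgue (\<lambda>x. ennreal (u x))) {x. g x > ennreal m} \<le> ennreal ((G powr (p / p\<^sub>0) / m) powr p\<^sub>0)" .
      qed
    qed (use p in auto)
    \<comment> \<open>This bound depends on \<open>F\<close> through \<epsilon>; it only supplies
      the finiteness that the hypothesis asks for.\<close>
    have "weak_Lp_norm p\<^sub>0 u f \<le> ennreal ((\<epsilon> powr (- a) * F powr p) powr (1 / p\<^sub>0))"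
    proof (subst weak_Lp_norm_le_iff)
      show "\<forall>m>0. emeasure (density lebesgue (\<lambda>x. ennreal (u x))) {x. f x > ennreal m} \<le> ennreal (((\<epsilon> powr (- a) * F powr p) powr (1 / p\<^sub>0) / m) powr p\<^sub>0)"
      proof (intro allI impI)
        fix m :: real assume m: "m > 0"
        have "emeasure (density lebesgue (\<lambda>x. ennreal (u x))) {x. f x > ennreal m} \<le> ennreal ((\<epsilon> * m) powr (- a)) * emeasure wmeasure {x. f x > ennreal m}"
          using m p \<epsilon> by (intro u_le) (auto simp: h_less powr_powr)
        also have "\<dots> \<le> ennreal ((\<epsilon> * m) powr (- a)) * ennreal ((F / m) powr p)"
          by (intro mult_left_mono wf m) auto
        also have "\<dots> = ennreal (\<epsilon> powr (- a) * F powr p * (m powr (- a) * m powr (- p)))"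
          using F m \<epsilon> by (simp add: powr_mult powr_divide powr_minus field_simps flip: ennreal_mult)
        also have "m powr (- a) * m powr (- p) = m powr (- p\<^sub>0)"
          by (simp add: a_def flip: powr_add)
        also have "\<epsilon> powr (- a) * F powr p * m powr (- p\<^sub>0) = ((\<epsilon> powr (- a) * F powr p) powr (1 / p\<^sub>0) / m) powr p\<^sub>0"
        proof -
          have "(X powr (1 / p\<^sub>0) / m) powr p\<^sub>0 = X * m powr (- p\<^sub>0)" if "X > 0" for X
            unfolding powr_divide powr_powr powr_minus_divide using p that by simp
          then show ?thesis using F \<epsilon> by simp
        qed
        finally show "emeasure (density lebesgue (\<lambda>x. ennreal (u x))) {x. f x > ennreal m}
            \<le> ennreal (((\<epsilon> powr (- a) * F powr p) powr (1 / p\<^sub>0) / m) powr p\<^sub>0)" .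
      qed
    qed (use p in auto)
    then have "weak_Lp_norm p\<^sub>0 u f < \<infinity>" by (rule order.strict_trans1) simp
    then have "weak_Lp_norm p\<^sub>0 u f \<le> ennreal C * weak_Lp_norm p\<^sub>0 u g"
      by (rule hyp[OF u[unfolded b_def a_def]])
    also have "\<dots> \<le> ennreal C * ennreal (G powr (p / p\<^sub>0))"
      by (intro mult_left_mono ug) auto
    also have "\<dots> = ennreal (C * G powr (p / p\<^sub>0))" using C by (simp add: ennreal_mult)
    finally have upper: "emeasure (density lebesgue (\<lambda>x. ennreal (u x))) E \<le> ennreal ((C * G powr (p / p\<^sub>0) / s) powr p\<^sub>0)"
      using s C G p by (subst (asm) weak_Lp_norm_le_iff) (auto simp: E_def)
    \<comment> \<open>The level at which the weak-type bound for \<open>maxf h\<close> equals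
      \<open>e / 2\<close>, so that \<open>E'\<close> keeps at least half of the mass of
      \<open>E\<close>.\<close>
    define T where "T = (2 * M * G powr p / e) powr (1 / 2)"
    have T: "T > 0" using M G e0 by (simp add: T_def)
    define E' where "E' = E - {x. maxf h x > ennreal T}"
    have [measurable]: "E' \<in> sets lebesgue" unfolding E'_def by measurable
    have "ennreal e \<le> emeasure wmeasure E' + ennreal (e / 2)"
    proof -
      have "ennreal e = emeasure wmeasure E" using e by simp
      also have "\<dots> \<le> emeasure wmeasure (E' \<union> {x. maxf h x > ennreal T})"
        by (intro emeasure_mono) (auto simp: E'_def)
      also have "\<dots> \<le> emeasure wmeasure E' + emeasure wmeasure {x. maxf h x > ennreal T}"
        by (intro emeasure_subadditive) auto
      also have "\<dots> \<le> emeasure wmeasure E' + ennreal (M * G powr p * T powr (- 2))"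
        by (intro add_left_mono weak T)
      also have "T powr (- 2) = e / (2 * M * G powr p)"
        using M G e0 by (simp add: T_def powr_powr powr_minus)
      also have "M * G powr p * (e / (2 * M * G powr p)) = e / 2"
        using M G by simp
      finally show ?thesis .
    qed
    then have half: "ennreal (e / 2) \<le> emeasure wmeasure E'"
      using e0 by (cases "emeasure wmeasure E'") (auto simp flip: ennreal_plus)
    have "ennreal (T powr (- b / 2) * (e / 2)) \<le> ennreal (T powr (- b / 2)) * emeasure wmeasure E'"
      using mult_left_mono[OF half, of "ennreal (T powr (- b / 2))"] e0 by (simp flip: ennreal_mult)
    also have "\<dots> = (\<integral>\<^sup>+x. ennreal (T powr (- b / 2)) * indicator E' x \<partial>wmeasure)"
      by (rule nn_integral_wmeasure_cmult_indicator[symmetric]) simp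
    also have "\<dots> \<le> (\<integral>\<^sup>+x\<in>E. ennreal (?v x powr (- b)) \<partial>wmeasure)"
    proof (rule nn_integral_mono_AE, use fin_AE[folded null_wmeasure] in eventually_elim)
      case (elim x)
      have "T powr (- b / 2) \<le> ?v x powr (- b)" if "x \<in> E'"
      proof -
        have "?v x \<le> T powr (1 / 2)"
          using that v_less[OF elim, of T] T by (auto simp: E'_def)
        then have "(T powr (1 / 2)) powr (- b) \<le> ?v x powr (- b)"
          using b M.v_pos[of x] by (intro powr_mono2') auto
        then show ?thesis by (simp add: powr_powr)
      qed
      then show ?case by (auto intro!: ennreal_leI split: split_indicator simp: E'_def)
    qed
    also have "\<dots> \<le> ennreal ((C * G powr (p / p\<^sub>0) / s) powr p\<^sub>0)"
      using upper by (simp add: u_eq)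
    finally have le: "T powr (- b / 2) * (e / 2) \<le> (C * G powr (p / p\<^sub>0) / s) powr p\<^sub>0"
      by simp
    have pa: "p * (a / p) = a" "p / p\<^sub>0 * p\<^sub>0 = p" "1 / p\<^sub>0 * p\<^sub>0 = 1" "p\<^sub>0 / p * (p / p\<^sub>0) = 1" "p\<^sub>0 * (p / p\<^sub>0) = p"
      using p by simp_all
    have "T powr (- b / 2) = (2 * M * G powr p / e) powr (- (a / p))"
      by (simp add: T_def powr_powr b_def)
    also have "\<dots> = inverse ((2 * M) powr (a / p) * G powr (p * (a / p)) / e powr (a / p))"
      by (simp only: powr_minus powr_divide powr_mult powr_powr)
    also have "\<dots> = e powr (a / p) / ((2 * M) powr (a / p) * G powr a)"
      unfolding pa by (simp add: divide_inverse mult_ac)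
    finally have "T powr (- b / 2) * (e / 2) = e powr (a / p) * e / (?B * G powr a)"
      by simp
    \<comment> \<open>The exponents of \<open>e\<close> add up to \<open>p\<^sub>0 / p\<close>,
      which the final power \<open>p / p\<^sub>0\<close> turns back into 1.\<close>
    also have "e powr (a / p) * e = e powr (p\<^sub>0 / p)"
    proof -
      have "p\<^sub>0 / p = a / p + 1" using p by (simp add: a_def diff_divide_distrib)
      then show ?thesis using e0 by (simp only: powr_add powr_one less_imp_le)
    qed
    finally have "e powr (p\<^sub>0 / p) / (?B * G powr a) \<le> (C * G powr (p / p\<^sub>0) / s) powr p\<^sub>0"
      using le by simp
    then have "e powr (p\<^sub>0 / p) \<le> (C * G powr (p / p\<^sub>0) / s) powr p\<^sub>0 * (?B * G powr a)"
      using B G by (simp add: pos_divide_le_eq)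
    also have "(C * G powr (p / p\<^sub>0) / s) powr p\<^sub>0 = C powr p\<^sub>0 * G powr p / s powr p\<^sub>0"
      unfolding powr_divide powr_mult powr_powr pa ..
    also have "C powr p\<^sub>0 * G powr p / s powr p\<^sub>0 * (?B * G powr a) = C powr p\<^sub>0 * ?B powr 1 * (G powr p * G powr a) / s powr p\<^sub>0"
      using B by simp
    also have "G powr p * G powr a = G powr p\<^sub>0" by (simp add: a_def flip: powr_add)
    also have "C powr p\<^sub>0 * ?B powr 1 * G powr p\<^sub>0 / s powr p\<^sub>0 = (C * ?B powr (1 / p\<^sub>0) * G / s) powr p\<^sub>0"
    proof -
      have "C powr p\<^sub>0 * Z powr 1 * G powr p\<^sub>0 / s powr p\<^sub>0 = (C * Z powr (1 / p\<^sub>0) * G / s) powr p\<^sub>0" for Z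
        unfolding powr_divide powr_mult powr_powr pa ..
      then show ?thesis .
    qed
    finally have "(e powr (p\<^sub>0 / p)) powr (p / p\<^sub>0) \<le> ((C * ?B powr (1 / p\<^sub>0) * G / s) powr p\<^sub>0) powr (p / p\<^sub>0)"
      using p by (intro powr_mono2) auto
    then have "e \<le> (C * ?B powr (1 / p\<^sub>0) * G / s) powr p"
      using e0 unfolding powr_powr pa by simp
    then show "emeasure wmeasure {x. f x > ennreal s} \<le> ennreal ((C * ?B powr (1 / p\<^sub>0) * G / s) powr p)"
      using e by (simp add: E_def[symmetric] ennreal_leI)
  qed
qed

end

section \<open>Uniformity of the constants and conclusion\<close>

lemma Ap_inequality_mono:
  assumes "Ap_inequality V \<theta> p w K" "K \<le> K'" "weight w"
  shows "Ap_inequality V \<theta> p w K'"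
proof -
  have "ennreal (K * w x) \<le> ennreal (K' * w x)" for x
    using assms by (intro ennreal_leI mult_right_mono) (auto simp: weight_def less_imp_le)
  moreover have "ennreal K \<le> ennreal K'" using assms by (intro ennreal_leI)
  ultimately show ?thesis
    using assms(1) unfolding Ap_inequality_def
    by (auto split: if_splits elim!: eventually_mono intro: order.trans)
qed

text \<open>The bound \<open>K + 1\<close> leaves room below which some admissible constant lies,
  without asking whether the infimum is attained, and it is at least 1. For \<open>t = 1\<close> the
  weight is treated as an A_2 weight.\<close>

lemma Ap_constant_le_imp_Ap_weight:
  assumes \<rho>: "\<And>x. critical_radius V x > 0" and "t \<ge> 1" "\<theta> \<ge> 0" "K > 0"
    and w: "w \<in> A_infty V" "Ap_constant V \<theta> t w \<le> ennreal K"
  shows "Ap_weight V w \<theta> (if t = 1 then 2 else t) (K + 1)"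
proof -
  have weight: "weight w"
    using w(1) by (auto simp: A_infty_def Ap_infty_def Ap_def)
  have "ennreal K < ennreal (K + 1)"
    using \<open>K > 0\<close> by (simp add: ennreal_less_iff)
  with w(2) have "Inf {ennreal K |K. K > 0 \<and> Ap_inequality V \<theta> t w K} < ennreal (K + 1)"
    unfolding Ap_constant_def by (rule le_less_trans)
  then obtain K' where K': "K' > 0" "Ap_inequality V \<theta> t w K'" "K' < K + 1"
    using \<open>K > 0\<close> unfolding Inf_less_iff by (fastforce simp: ennreal_less_iff simp del: ennreal_plus)
  have "Ap_inequality V \<theta> t w (K + 1)"
    by (rule Ap_inequality_mono[OF K'(2) less_imp_le[OF K'(3)] weight])
  then have "Ap_inequality V \<theta> (if t = 1 then 2 else t) w (K + 1)"
    using Ap_inequality_1_imp_2[OF \<rho> \<open>\<theta> \<ge> 0\<close> _ weight, of "K + 1"] \<open>K > 0\<close> by auto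
  then show ?thesis
    using assms weight by unfold_locales auto
qed

text \<open>The order of quantifiers is the point: the constants of the two exponent ranges depend
  on the dimension, the exponents, \<theta>, \<open>q\<close> and \<open>K\<close>, so the
  hypothesis can be invoked and \<open>C\<close> fixed before any weight is given.\<close>

lemma weak_type_extrapolation:
  fixes V :: "real ^ 'n \<Rightarrow> real"
  assumes p: "0 < p\<^sub>0" "0 < p" and F: "\<And>f g. (f, g) \<in> F \<Longrightarrow> f \<in> borel_measurable lebesgue \<and> g \<in> borel_measurable lebesgue"
    and hyp: "weak_type_inequality V F p\<^sub>0" and \<theta>: "\<theta> \<ge> 0" and q: "q > 1"
  shows "\<exists>C>0. \<forall>w. Ap_weight V w \<theta> q K \<longrightarrow>
    (\<forall>(f, g)\<in>F. weak_Lp_norm p w f < \<infinity> \<longrightarrow> weak_Lp_norm p w f \<le> ennreal C * weak_Lp_norm p w g)"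
proof -
  \<comment> \<open>The hypothesis asks for a positive bound on the weight constant;
    \<open>max 1 L\<close> provides one whatever the sign of \<open>L\<close>, about which nothing
    is known before a weight is fixed.\<close>
  have apply_hyp: "\<exists>C>0. \<forall>u f g. u \<in> A_infty V \<longrightarrow> Ap_constant V \<theta>' Q u \<le> ennreal L \<longrightarrow> (f, g) \<in> F \<longrightarrow>
      weak_Lp_norm p\<^sub>0 u f < \<infinity> \<longrightarrow> weak_Lp_norm p\<^sub>0 u f \<le> ennreal C * weak_Lp_norm p\<^sub>0 u g"
    if "Q > 1" "\<theta>' \<ge> 0" for Q \<theta>' L
  proof -
    have "max 1 L > 0" "Q \<ge> 1" using that by auto
    then obtain C where "C > 0" and C: "\<forall>\<omega>\<in>A_infty V. Ap_constant V \<theta>' Q \<omega> \<le> ennreal (max 1 L) \<longrightarrow>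
        (\<forall>(f, g)\<in>F. weak_Lp_norm p\<^sub>0 \<omega> f < \<infinity> \<longrightarrow> weak_Lp_norm p\<^sub>0 \<omega> f \<le> ennreal C * weak_Lp_norm p\<^sub>0 \<omega> g)"
      using hyp[unfolded weak_type_inequality_def, rule_format, OF \<open>Q \<ge> 1\<close> \<open>\<theta>' \<ge> 0\<close> \<open>max 1 L > 0\<close>]
      by (elim exE conjE) (rule that)
    have L: "ennreal L \<le> ennreal (max 1 L)" by (intro ennreal_leI) simp
    show ?thesis
    proof (intro exI[of _ C] conjI allI impI \<open>C > 0\<close>)
      fix u f g
      assume "u \<in> A_infty V" "Ap_constant V \<theta>' Q u \<le> ennreal L" "(f, g) \<in> F" "weak_Lp_norm p\<^sub>0 u f < \<infinity>"
      with C[rule_format, OF _ order.trans[OF _ L], of u "(f, g)"]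
      show "weak_Lp_norm p\<^sub>0 u f \<le> ennreal C * weak_Lp_norm p\<^sub>0 u g"
        by simp
    qed
  qed
  \<comment> \<open>Enlarging a constant to \<open>max 1 C\<close> makes it visibly positive outside
    the locale.\<close>
  have max_le: "x \<le> ennreal (max 1 C) * y" if "x \<le> ennreal C * y" for x y C
    using that by (rule order.trans) (intro mult_right_mono ennreal_leI, auto)
  \<comment> \<open>Outside its locale the exponent takes only the index type, \<theta> and
    \<open>q\<close> as arguments, which shows that it is the same for all weights
    considered.\<close>
  define D where "D = (5::real) powr Ap_weight.dexp TYPE('n) \<theta> q"
  consider "p = p\<^sub>0" | "p\<^sub>0 < p" | "p < p\<^sub>0" by linarith
  then show ?thesis
  proof cases
    case 1
    obtain C where "C > 0" and C: "\<And>u f g. u \<in> A_infty V \<Longrightarrow> Ap_constant V \<theta> q u \<le> ennreal K \<Longrightarrow> (f, g) \<in> F \<Longrightarrow>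
      weak_Lp_norm p\<^sub>0 u f < \<infinity> \<Longrightarrow> weak_Lp_norm p\<^sub>0 u f \<le> ennreal C * weak_Lp_norm p\<^sub>0 u g"
      using apply_hyp[OF q \<theta>, of K] by blast
    show ?thesis
    proof (intro exI[of _ C] conjI allI impI \<open>C > 0\<close>, safe)
      fix w f g assume "Ap_weight V w \<theta> q K" and fg: "(f, g) \<in> F" and fin: "weak_Lp_norm p w f < \<infinity>"
      then interpret Ap_weight V w \<theta> q K by simp
      have "w \<in> A_infty V" "Ap_constant V \<theta> q w \<le> ennreal K"
        using A_infty_if[OF weight \<theta> q _ Ap] K by auto
      then show "weak_Lp_norm p w f \<le> ennreal C * weak_Lp_norm p w g"
        using C fg fin 1 by auto
    qed
  next
    case 2
    define L where "L = doubling_majorant.A1_const D (1 - p\<^sub>0 / p) * K\<^sup>2"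
    have "2 * \<theta> \<ge> 0" using \<theta> by simp
    obtain C where "C > 0" and C: "\<And>u f g. u \<in> A_infty V \<Longrightarrow> Ap_constant V (2 * \<theta>) q u \<le> ennreal L \<Longrightarrow> (f, g) \<in> F \<Longrightarrow>
      weak_Lp_norm p\<^sub>0 u f < \<infinity> \<Longrightarrow> weak_Lp_norm p\<^sub>0 u f \<le> ennreal C * weak_Lp_norm p\<^sub>0 u g"
      using apply_hyp[OF q \<open>2 * \<theta> \<ge> 0\<close>, of L] by blast
    let ?C = "C * Ap_weight.Kolmogorov_const TYPE('n) \<theta> q (1 - p\<^sub>0 / p) powr (1 / p\<^sub>0)"
    show ?thesis
    proof (intro exI[of _ "max 1 ?C"] conjI allI impI, simp, safe)
      fix w f g assume "Ap_weight V w \<theta> q K" and fg: "(f, g) \<in> F" and fin: "weak_Lp_norm p w f < \<infinity>"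
      then interpret Ap_weight V w \<theta> q K by simp
      show "weak_Lp_norm p w f \<le> ennreal (max 1 ?C) * weak_Lp_norm p w g"
        using F[OF fg] \<open>C > 0\<close> p 2 fin C[OF _ _ fg]
        by (intro max_le weak_type_larger_exponent) (auto simp: L_def D_def)
    qed
  next
    case 3
    define b where "b = 4 * (p\<^sub>0 - p) / p"
    define L where "L = doubling_majorant.A1_const D (1 / 2) powr b * K powr (2 * b + 1)"
    have "b > 0" using p 3 by (simp add: b_def)
    then have "q * (b + 1) > 1" using q by (simp add: less_1_mult)
    moreover have "2 * \<theta> \<ge> 0" using \<theta> by simp
    ultimately obtain C where "C > 0" and C: "\<And>u f g. u \<in> A_infty V \<Longrightarrow> Ap_constant V (2 * \<theta>) (q * (b + 1)) u \<le> ennreal L \<Longrightarrow> (f, g) \<in> F \<Longrightarrow>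
      weak_Lp_norm p\<^sub>0 u f < \<infinity> \<Longrightarrow> weak_Lp_norm p\<^sub>0 u f \<le> ennreal C * weak_Lp_norm p\<^sub>0 u g"
      using apply_hyp[of "q * (b + 1)" "2 * \<theta>" L] by blast
    let ?C = "C * (2 * (64 * (D + 1)) powr ((p\<^sub>0 - p) / p)) powr (1 / p\<^sub>0)"
    show ?thesis
    proof (intro exI[of _ "max 1 ?C"] conjI allI impI, simp, safe)
      fix w f g assume "Ap_weight V w \<theta> q K" and fg: "(f, g) \<in> F" and fin: "weak_Lp_norm p w f < \<infinity>"
      then interpret Ap_weight V w \<theta> q K by simp
      show "weak_Lp_norm p w f \<le> ennreal (max 1 ?C) * weak_Lp_norm p w g"
        unfolding D_def
      proof (rule max_le, rule weak_type_smaller_exponent)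
        fix u assume "u \<in> A_infty V" and fin: "weak_Lp_norm p\<^sub>0 u f < \<infinity>" and
          "Ap_constant V (2 * \<theta>) (q * (4 * (p\<^sub>0 - p) / p + 1)) u
            \<le> ennreal (A1_const (1 / 2) powr (4 * (p\<^sub>0 - p) / p) * K powr (2 * (4 * (p\<^sub>0 - p) / p) + 1))"
        then show "weak_Lp_norm p\<^sub>0 u f \<le> ennreal C * weak_Lp_norm p\<^sub>0 u g"
          by (intro C[OF _ _ fg]) (simp_all only: L_def D_def b_def)
      qed (use p 3 F[OF fg] \<open>C > 0\<close> fin in auto)
    qed
  qed
qed

theorem theorem3p2:
  fixes V :: "real ^ 'n \<Rightarrow> real"
    and F :: "((real ^ 'n \<Rightarrow> ennreal) \<times> (real ^ 'n \<Rightarrow> ennreal)) set"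
    and p\<^sub>0 :: real
  assumes "CARD('n) \<ge> 3"
    and "V \<in> reverse_Hoelder (real CARD('n) / 2)"
    and "\<not> (AE x in lebesgue. V x = 0)"
    and "\<And>f g. (f, g) \<in> F \<Longrightarrow> f \<in> borel_measurable lebesgue \<and> g \<in> borel_measurable lebesgue"
    and "0 < p\<^sub>0"
    and "weak_type_inequality V F p\<^sub>0"
  shows "\<forall>p>0. weak_type_inequality V F p"
proof (intro allI impI)
  fix p :: real assume "p > 0"
  have \<rho>: "critical_radius V x > 0" for x
    by (rule critical_radius_pos[OF assms(1-3)])
  show "weak_type_inequality V F p"
    unfolding weak_type_inequality_def
  proof (intro allI impI)
    fix t \<theta> K :: real assume tK: "t \<ge> 1" "\<theta> \<ge> 0" "K > 0"
    then have "(if t = 1 then 2 else t) > 1" by auto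
    then obtain C where "C > 0" and C: "\<And>w. Ap_weight V w \<theta> (if t = 1 then 2 else t) (K + 1) \<Longrightarrow>
        (\<forall>(f, g)\<in>F. weak_Lp_norm p w f < \<infinity> \<longrightarrow> weak_Lp_norm p w f \<le> ennreal C * weak_Lp_norm p w g)"
      using weak_type_extrapolation[OF \<open>0 < p\<^sub>0\<close> \<open>p > 0\<close> assms(4,6) \<open>\<theta> \<ge> 0\<close>] by blast
    show "\<exists>C>0. \<forall>\<omega>\<in>A_infty V. Ap_constant V \<theta> t \<omega> \<le> ennreal K \<longrightarrow>
        (\<forall>(f, g)\<in>F. weak_Lp_norm p \<omega> f < \<infinity> \<longrightarrow> weak_Lp_norm p \<omega> f \<le> ennreal C * weak_Lp_norm p \<omega> g)"
      using \<open>C > 0\<close> C Ap_constant_le_imp_Ap_weight[OF \<rho> tK] by (intro exI[of _ C] conjI ballI impI) auto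
  qed
qed

end
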